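(* Let $b,p,q,f,g$ satisfy the hypotheses (h1)-(h4) and the accompanying conditions listed in the context. Assume in addition that $f,g\in C^1(\Omega\times\mathbb{R},\mathbb{R})$ and that $f(t,x,\xi)$, $g(t,x,\xi)$ are strictly increasing in $\xi$ for all $(t,x)\in\Omega$. Then for sufficiently small $\varepsilon$ the solution $(u,v)$ (the one obtained by local linking as described in the context) of $$u_{tt}-u_{xx}+bu+\varepsilon v+f(t,x,u)=0,\qquad v_{tt}-v_{xx}+bv+\varepsilon u+g(t,x,v)=0,$$ with $u,v$ vanishing at $x=0,\pi$ and $2\pi$-periodic in $t$, is continuous on $\Omega$.
   Context: $\Omega=[0,2\pi]\times[0,\pi]$, $L=\partial_t^2-\partial_x^2$ with Dirichlet conditions in $x$ at $0,\pi$ and $2\pi$-periodicity in $t$, $\sigma(L)=\{j^2-k^2:j\in\mathbb{Z}_+,k\in\mathbb{Z}\}$, $\mathbb{Z}_+=\{1,2,\dots\}$. Hypotheses: $b>0$, $-b\notin\sigma(L)$, $f,g\in C(\Omega\times\mathbb{R},\mathbb{R})$ are $2\pi$-periodic in $t$, $F(t,x,\xi)=\int_0^\xi f(t,x,s)ds$, $G(t,x,\xi)=\int_0^\xi g(t,x,s)ds$, and: (h1) there are $p>1$, $q>1$, $c_0>0$ with $|f(t,x,\xi)|\le c_0(1+|\xi|^p)$ and $|g(t,x,\xi)|\le c_0(1+|\xi|^q)$ for all $t,x,\xi$; (h2) $f(t,x,\xi)=o(|\xi|)$, $g(t,x,\xi)=o(|\xi|)$ as $\xi\to0$ uniformly in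 $(t,x)$; (h3) $(p+1)F\le f\xi$ and $(q+1)G\le g\xi$ for all $t,x,\xi$; (h4) $f,g$ are nondecreasing in $\xi$. Spaces: $u\in L^2(\Omega)$ is expanded as $u=\sum u_{jk}\sin(jx)e^{ikt}$, $\overline{u_{jk}}=u_{j,-k}$. $H=\{u\in L^2(\Omega):\|u\|_H^2=\pi^2\sum_{j\ne|k|}|j^2-k^2+b||u_{jk}|^2+\pi^2\sum_{j=|k|}|u_{jk}|^2<\infty\}$; $E=H\times H$ with $\|(u,v)\|_E=(\|u\|_H^2+\|v\|_H^2)^{1/2}$. $H_b^+,H_b^-,H^0$ are the closed subspaces of $H$ spanned by the $\sin(jx)e^{ikt}$ with, respectively, $j^2-k^2>-b$ and $j\ne|k|$; $j^2-k^2<-b$; $j=|k|$. $E^1=H_b^-\times H_b^-$, $E^2=(H_b^+\times H_b^+)\oplus(H^0\times H^0)$; $E_m^j=\mathrm{span}\{e_1^j,\dots,e_m^j\}$ where $(e_n^j)_{n\ge1}$ is a basis of $E^j$, $j=1,2$. Functional: $\Phi(u,v)=-\frac12\langle Lu,u\rangle-\frac b2\int u^2-\frac12\langle Lv,v\rangle-\frac b2\int v^2-\varepsilon\int uv-\int F(t,x,u)-\int G(t,x,v)$ on $E$, with $\int=\iint_\Omega\cdot\,dt\,dx$ and $\langle Lu,\varphi\rangle=\pi^2\sum(j^2-k^2)u_{jk}\overline{\varphi_{jk}}$. Its critical points in $E$ are the weak solutions of the system, i.e. $\iint_\Omega[u(\varphi_{tt}-\varphi_{xx})+bu\varphi+\varepsilon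 v\varphi+f(t,x,u)\varphi]\,dt\,dx=0$ and $\iint_\Omega[v(\psi_{tt}-\psi_{xx})+bv\psi+\varepsilon u\psi+g(t,x,v)\psi]\,dt\,dx=0$ for all $\varphi,\psi\in H$ satisfying the Dirichlet and periodicity conditions. Solutions obtained by local linking: under the hypotheses (h1)-(h4) above, the existence result for the system asserts that for all sufficiently small $|\varepsilon|$ the system has at least one nontrivial weak solution with time period $2\pi$. It is obtained as the nontrivial critical point in $E$ of $\Phi$ furnished by the local linking theorem: if a $C^1$ functional on $E=E^1\oplus E^2$ satisfies the (PS)$^*$ condition, has a local linking at $0$ (for some $r>0$ it is $\ge0$ on $\{w\in E^1:\|w\|\le r\}$ and $\le0$ on $\{w\in E^2:\|w\|\le r\}$), maps bounded sets into bounded sets, and for every $m$ tends to $-\infty$ as $\|w\|\to\infty$ with $w\in E^1_m\oplus E^2$, then it has a nontrivial critical point. Here (PS)$^*$ means: with $E_\theta=E^1_{\theta^1}\oplus E^2_{\theta^2}$ and $\Phi_\theta=\Phi|_{E_\theta}$ for $\theta=(\theta^1,\theta^2)\in\mathbb{N}^2$, every sequence $w_n\in E_{\theta_n}$ such that both components of $\theta_n$ tend to infinity, $\sup_n\Phi(w_n)<\infty$ and $\Phi'_{\theta_n}(w_n)\to0$ has a subsequence converging to a critical point of $\Phi$. *)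

theory Defs
  imports "HOL-Analysis.Analysis"
begin

text \<open>Points of the plane are pairs \<open>(t, x)\<close>, time first.\<close>

definition Omega :: "(real \<times> real) set" where
  "Omega = {0..2 * pi} \<times> {0..pi}"

definition spectrum_L :: "real set" where
  "spectrum_L = {real_of_int ((int j)\<^sup>2 - k\<^sup>2) | (j::nat) (k::int). j \<ge> 1}"

text \<open>
  The coefficient of \<open>sin (j x) exp (i k t)\<close> in the expansion of a function in \<open>L\<^sup>2(\<Omega>)\<close>.
  These functions are orthogonal on \<open>\<Omega>\<close>, with squared norm \<open>\<pi>\<^sup>2\<close>.
\<close>

definition fourier_coeff :: "(real \<times> real \<Rightarrow> real) \<Rightarrow> nat \<Rightarrow> int \<Rightarrow> complex" where
  "fourier_coeff u j k =
     (\<integral>(t, x). complex_of_real (u (t, x) * sin (real j * x)) * cis (- (of_int k * t))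
        \<partial>lebesgue_on Omega) / (of_real pi)\<^sup>2"

definition L2_Omega :: "(real \<times> real \<Rightarrow> real) set" where
  "L2_Omega = {u. u \<in> borel_measurable (lebesgue_on Omega) \<and>
                  integrable (lebesgue_on Omega) (\<lambda>z. (u z)\<^sup>2)}"

definition H_weight :: "real \<Rightarrow> nat \<Rightarrow> int \<Rightarrow> real" where
  "H_weight b j k =
     (if int j = \<bar>k\<bar> then 1 else \<bar>real_of_int ((int j)\<^sup>2 - k\<^sup>2) + b\<bar>)"

text \<open>
  Elements of \<open>H\<close> are represented by functions; two of them stand for the same element
  when they agree almost everywhere on \<open>\<Omega>\<close>.
\<close>

definition H_space :: "real \<Rightarrow> (real \<times> real \<Rightarrow> real) set" where
  "H_space b = {u \<in> L2_Omega.
     (\<lambda>(j, k). pi\<^sup>2 * H_weight b j k * (cmod (fourier_coeff u j k))\<^sup>2) summable_on ({1..} \<times> UNIV)}"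

definition E_space :: "real \<Rightarrow> ((real \<times> real \<Rightarrow> real) \<times> (real \<times> real \<Rightarrow> real)) set" where
  "E_space b = H_space b \<times> H_space b"

text \<open>
  The derivative is taken within \<open>S\<close>, hence one-sided at boundary points; it is unique
  when \<open>S\<close> is convex with nonempty interior, the only case used below.
\<close>

definition C1_on :: "'a::real_normed_vector set \<Rightarrow> ('a \<Rightarrow> 'b::real_normed_vector) \<Rightarrow> bool" where
  "C1_on S f \<longleftrightarrow> (\<exists>f'. (\<forall>z\<in>S. (f has_derivative blinfun_apply (f' z)) (at z within S))
                        \<and> continuous_on S f')"

definition C2_on :: "'a::real_normed_vector set \<Rightarrow> ('a \<Rightarrow> 'b::real_normed_vector) \<Rightarrow> bool" where
  "C2_on S f \<longleftrightarrow> (\<exists>f'. (\<forall>z\<in>S. (f has_derivative blinfun_apply (f' z)) (at z within S))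
                        \<and> C1_on S f')"

definition partial_t :: "(real \<times> real \<Rightarrow> real) \<Rightarrow> real \<times> real \<Rightarrow> real" where
  "partial_t \<phi> = (\<lambda>(t, x). deriv (\<lambda>s. \<phi> (s, x)) t)"

definition partial_x :: "(real \<times> real \<Rightarrow> real) \<Rightarrow> real \<times> real \<Rightarrow> real" where
  "partial_x \<phi> = (\<lambda>(t, x). deriv (\<lambda>y. \<phi> (t, y)) x)"

definition wave_op :: "(real \<times> real \<Rightarrow> real) \<Rightarrow> real \<times> real \<Rightarrow> real" where
  "wave_op \<phi> z = partial_t (partial_t \<phi>) z - partial_x (partial_x \<phi>) z"

definition test_functions :: "real \<Rightarrow> (real \<times> real \<Rightarrow> real) set" where
  "test_functions b = {\<phi> \<in> H_space b. C2_on UNIV \<phi> \<and>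
     (\<forall>t x. \<phi> (t + 2 * pi, x) = \<phi> (t, x)) \<and> (\<forall>t. \<phi> (t, 0) = 0 \<and> \<phi> (t, pi) = 0)}"

text \<open>
  A weak solution lies in \<open>E\<close> and satisfies both integral identities. The integrability of
  the nonlinear terms must be required: membership in \<open>E\<close> only places the components along
  the kernel of \<open>\<partial>\<^sub>t\<^sup>2 - \<partial>\<^sub>x\<^sup>2\<close> in \<open>L\<^sup>2\<close>, so it is not automatic, and a Bochner integral that
  does not exist has the value 0.
\<close>

definition weak_solution ::
  "real \<Rightarrow> real \<Rightarrow> (real \<times> real \<Rightarrow> real \<Rightarrow> real) \<Rightarrow> (real \<times> real \<Rightarrow> real \<Rightarrow> real) \<Rightarrow>
   (real \<times> real \<Rightarrow> real) \<Rightarrow> (real \<times> real \<Rightarrow> real) \<Rightarrow> bool" where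
  "weak_solution b \<epsilon> f g u v \<longleftrightarrow>
     (u, v) \<in> E_space b \<and>
     integrable (lebesgue_on Omega) (\<lambda>z. f z (u z)) \<and>
     integrable (lebesgue_on Omega) (\<lambda>z. g z (v z)) \<and>
     (\<forall>\<phi>\<in>test_functions b.
        (\<integral>z. u z * wave_op \<phi> z + b * u z * \<phi> z + \<epsilon> * v z * \<phi> z + f z (u z) * \<phi> z
           \<partial>lebesgue_on Omega) = 0) \<and>
     (\<forall>\<psi>\<in>test_functions b.
        (\<integral>z. v z * wave_op \<psi> z + b * v z * \<psi> z + \<epsilon> * u z * \<psi> z + g z (v z) * \<psi> z
           \<partial>lebesgue_on Omega) = 0)"

definition nontrivial_weak_solution ::
  "real \<Rightarrow> real \<Rightarrow> (real \<times> real \<Rightarrow> real \<Rightarrow> real) \<Rightarrow> (real \<times> real \<Rightarrow> real \<Rightarrow> real) \<Rightarrow>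
   (real \<times> real \<Rightarrow> real) \<Rightarrow> (real \<times> real \<Rightarrow> real) \<Rightarrow> bool" where
  "nontrivial_weak_solution b \<epsilon> f g u v \<longleftrightarrow>
     weak_solution b \<epsilon> f g u v \<and> \<not> (AE z in lebesgue_on Omega. u z = 0 \<and> v z = 0)"

text \<open>Continuity of an element of \<open>L\<^sup>2(\<Omega>)\<close>: it has a continuous representative.\<close>

definition continuous_ae_on_Omega :: "(real \<times> real \<Rightarrow> real) \<Rightarrow> bool" where
  "continuous_ae_on_Omega u \<longleftrightarrow>
     (\<exists>w. continuous_on Omega w \<and> (AE z in lebesgue_on Omega. u z = w z))"

definition primitive :: "(real \<times> real \<Rightarrow> real \<Rightarrow> real) \<Rightarrow> real \<times> real \<Rightarrow> real \<Rightarrow> real" where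
  "primitive f z \<xi> = (LBINT s=0..\<xi>. f z s)"

end

theory Submission
  imports Defs
begin

text \<open>
  A weak solution satisfies \<open>(j\<^sup>2 - k\<^sup>2) u\<^sub>j\<^sub>k + h\<^sub>j\<^sub>k = 0\<close> for \<open>h = b u + \<epsilon> v + f(u)\<close>, and \<open>h\<close> is integrable. Hence \<open>h\<close> is
  orthogonal to the kernel of the wave operator, and \<open>u = U + p(t + x) - p(t - x)\<close> with \<open>U\<close> given by
  Duhamel's formula, an integral of \<open>h\<close> over characteristic triangles, which is continuous because \<open>h\<close> is
  integrable. Likewise \<open>v = V + q(t + x) - q(t - x)\<close>.

  To handle the kernel part, test the orthogonality relation with \<open>\<theta>(p(t + x)) - \<theta>(p(t - x))\<close>
  for \<open>\<theta>(s) = sgn s\<close> if \<open>\<bar>s\<bar> > M\<close> and \<open>0\<close> otherwise. By monotonicity of \<open>f\<close> the nonlinear term may be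
  replaced by \<open>f(U)\<close>, and \<open>\<bar>\<epsilon>\<bar> < b\<close> absorbs the coupling, so \<open>p\<close> and \<open>q\<close> are bounded by a multiple of
  the supremum of the remaining terms. The same estimate applied to the differences \<open>p(\<cdot> + \<tau>) - p\<close>
  and \<open>q(\<cdot> + \<tau>) - q\<close> shows that these tend to \<open>0\<close> uniformly as \<open>\<tau> \<rightarrow> 0\<close>, so \<open>p\<close> and \<open>q\<close> have continuous
  representatives. Any \<open>\<epsilon>\<^sub>0 \<le> b\<close> works.
\<close>

section \<open>The measure on the cylinder\<close>

text \<open>The source \<open>h\<close> is only known to be integrable, so it can be paired only
  with bounded functions, while truncations of p and q are far from smooth enough to be admissible
  test functions. Orthogonality therefore has to be extended from trigonometric modes to all bounded
  Borel kernel functions; this rests on the fact that an integrable function with vanishing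
  coefficients is null, proved by Stone-Weierstrass. The jump \<theta> is chosen because its modulus
  is a nondecreasing function of the modulus of the argument: with one level M for both p and q, the
  mixed products caused by the coupling are dominated by the diagonal ones with constant exactly 1,
  so that |\<epsilon>| has to beat nothing but b. In the estimate for increments the constant is a
  modulus of continuity on a compact set. Such a set exists only after the first estimate has
  confined p and q to a bounded interval. The exceptional null sets then still depend on \<tau>, and
  Fubini is needed to turn them into one set of good points.\<close>

text \<open>A density on the whole line rather than a restricted space: its sets are all Borel sets,
  so translates of periodic functions stay in the same measurable space. Half-open intervals tile
  the line exactly.\<close>

definition seg :: "real \<Rightarrow> real \<Rightarrow> real measure" where
  "seg a b = density lborel (\<lambda>t. ennreal (indicator {a<..b} t))"

lemma sets_seg [simp, measurable_cong]: "sets (seg a b) = sets borel"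
  by (simp add: seg_def)

lemma space_seg [simp]: "space (seg a b) = UNIV"
  by (simp add: seg_def)

lemma emeasure_seg: "A \<in> sets borel \<Longrightarrow> emeasure (seg a b) A = emeasure lborel (A \<inter> {a<..b})"
  unfolding seg_def
  by (subst emeasure_density) (auto simp: ennreal_indicator indicator_inter_arith[symmetric]
    intro!: nn_integral_cong arg_cong2[where f=emeasure])

lemma finite_measure_seg: "finite_measure (seg a b)"
proof
  have "emeasure lborel ({a<..b}) \<le> emeasure lborel {a..b}"
    by (intro emeasure_mono) auto
  also have "\<dots> < \<infinity>" by (simp add: emeasure_lborel_Icc_eq)
  finally show "emeasure (seg a b) (space (seg a b)) \<noteq> \<infinity>"
    by (simp add: emeasure_seg)
qed

interpretation seg: finite_measure "seg a b" for a b
  by (rule finite_measure_seg)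

interpretation seg_pair: pair_sigma_finite "seg a b" "seg c d" for a b c d
  by unfold_locales

lemma AE_seg: "(AE t in seg a b. P t) \<longleftrightarrow> (AE t in lborel. t \<in> {a<..b} \<longrightarrow> P t)"
  unfolding seg_def by (subst AE_density) (auto simp: indicator_def)

lemma AE_seg_mem: "AE t in seg a b. t \<in> {a<..b}"
  by (simp add: AE_seg)

lemma integral_seg:
  fixes F :: "real \<Rightarrow> 'b::{banach, second_countable_topology}"
  assumes "F \<in> borel_measurable borel"
  shows "integral\<^sup>L (seg a b) F = (\<integral>t\<in>{a..b}. F t \<partial>lborel)"
proof -
  have "integral\<^sup>L (seg a b) F = (\<integral>t. indicator {a<..b} t *\<^sub>R F t \<partial>lborel)"
    unfolding seg_def using assms by (subst integral_density) auto
  also have "\<dots> = (\<integral>t. indicator {a..b} t *\<^sub>R F t \<partial>lborel)"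
    using AE_lborel_singleton[of a] assms
    by (intro integral_cong_AE) (auto simp: indicator_def)
  finally show ?thesis by (simp add: set_lebesgue_integral_def)
qed

abbreviation borel2 :: "(real \<times> real) measure" where "borel2 \<equiv> borel \<Otimes>\<^sub>M borel"
abbreviation circ :: "real measure" where "circ \<equiv> seg 0 (2 * pi)"
abbreviation cyl :: "(real \<times> real) measure" where "cyl \<equiv> circ \<Otimes>\<^sub>M seg 0 pi"

lemma sets_cyl: "sets cyl = sets borel"
  by (metis sets_seg sets_pair_measure_cong borel_prod)

lemma space_cyl [simp]: "space cyl = UNIV"
  by (simp add: space_pair_measure)

text \<open>The half-open rectangle and the closed set \<open>Omega\<close> differ only on the lines
  t = 0 and x = 0, which are null.\<close>

lemma cyl_eq_density: "cyl = density lborel (\<lambda>z. ennreal (indicator Omega z))"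
proof -
  have "cyl = density (lborel \<Otimes>\<^sub>M lborel)
      (\<lambda>(x, y). ennreal (indicator {0<..2*pi} x) * ennreal (indicator {0<..pi} y))"
    using seg.sigma_finite_measure_axioms lborel.sigma_finite_measure_axioms unfolding seg_def
    by (intro pair_measure_density) auto
  also have "\<dots> = density (lborel \<Otimes>\<^sub>M lborel) (\<lambda>z. ennreal (indicator Omega z))"
  proof (rule density_cong)
    have "AE z in lborel \<Otimes>\<^sub>M lborel. fst z \<noteq> (0::real) \<and> snd z \<noteq> (0::real)"
    proof (rule lborel_pair.AE_pair_measure)
      show "AE x in lborel. AE y in lborel. fst (x, y) \<noteq> (0::real) \<and> snd (x, y) \<noteq> (0::real)"
        using AE_lborel_singleton[of "0::real"] by (auto elim!: eventually_mono)
    qed measurable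
    then show "AE x in lborel \<Otimes>\<^sub>M lborel. (case x of (x, y) \<Rightarrow> ennreal (indicator {0<..2*pi} x) * ennreal (indicator {0<..pi} y)) = ennreal (indicator Omega x)"
      by (rule eventually_mono) (auto simp: Omega_def indicator_def split: prod.splits)
  next
    have "closed Omega" unfolding Omega_def by (intro closed_Times) auto
    then have "Omega \<in> sets borel" by (rule borel_closed)
    then show "(\<lambda>x. ennreal (indicat_real Omega x)) \<in> borel_measurable (lborel \<Otimes>\<^sub>M lborel)"
      by (simp add: lborel_prod)
  qed simp
  finally show ?thesis by (simp add: lborel_prod)
qed

lemma borel_measurable_seg: "integrable (seg a b) F \<Longrightarrow> F \<in> borel_measurable borel"
  using borel_measurable_integrable by simp

lemma borel_measurable_cyl: "integrable cyl F \<Longrightarrow> F \<in> borel_measurable borel2"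
  using borel_measurable_integrable by simp

section \<open>Periodic functions, translations and shears\<close>

definition periodic :: "(real \<Rightarrow> 'b) \<Rightarrow> bool" where
  "periodic F \<longleftrightarrow> (\<forall>t. F (t + 2 * pi) = F t)"

lemma periodic_add_int:
  assumes "periodic F"
  shows "F (t + of_int n * (2 * pi)) = F t"
proof -
  have nat: "F (t + of_nat m * (2 * pi)) = F t" for m :: nat and t
  proof (induction m arbitrary: t)
    case (Suc m)
    have "F (t + of_nat (Suc m) * (2 * pi)) = F ((t + of_nat m * (2 * pi)) + 2 * pi)"
      by (simp add: algebra_simps)
    also have "\<dots> = F t" using assms Suc by (simp add: periodic_def)
    finally show ?case .
  qed simp
  show ?thesis
  proof (cases "n \<ge> 0")
    case True
    then show ?thesis using nat[of t "nat n"] by simp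
  next
    case False
    then show ?thesis using nat[of "t + of_int n * (2 * pi)" "nat (- n)"] by simp
  qed
qed

lemma emeasure_lborel_shift:
  fixes c :: real
  assumes "B \<in> sets borel"
  shows "emeasure lborel {t. t + c \<in> B} = emeasure lborel B"
proof -
  have "emeasure lborel B = emeasure (distr lborel borel ((+) c)) B"
    by (simp add: lborel_distr_plus)
  also have "\<dots> = emeasure lborel ((+) c -` B)"
    using assms by (subst emeasure_distr) auto
  also have "(+) c -` B = {t. t + c \<in> B}" by (auto simp: add.commute)
  finally show ?thesis by simp
qed

text \<open>Cut and paste: the part of \<open>S\<close> in \<open>{2*pi<..2*pi+r}\<close> moves back
  by one period to \<open>{0<..r}\<close> and fills the gap left by the shift.\<close>

lemma emeasure_periodic_shift:
  assumes S: "S \<in> sets borel" and per: "\<And>t. t + 2 * pi \<in> S \<longleftrightarrow> t \<in> S" and r: "0 \<le> r" "r \<le> 2 * pi"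
  shows "emeasure circ {t. t + r \<in> S} = emeasure circ S"
proof -
  have mS: "{t. t + c \<in> S} \<in> sets borel" for c
    using measurable_sets[of "\<lambda>t. t + c" borel borel S] S by (simp add: vimage_def)
  have "emeasure circ {t. t + r \<in> S} = emeasure lborel ({t. t + r \<in> S} \<inter> {0<..2*pi})"
    using mS by (simp add: emeasure_seg)
  also have "{t. t + r \<in> S} \<inter> {0<..2*pi} = {t. t + r \<in> S \<inter> {r<..2*pi + r}}"
    by auto
  also have "emeasure lborel \<dots> = emeasure lborel (S \<inter> {r<..2*pi+r})"
    using S by (intro emeasure_lborel_shift) auto
  also have "S \<inter> {r<..2*pi+r} = (S \<inter> {r<..2*pi}) \<union> (S \<inter> {2*pi<..2*pi+r})"
    using r by auto
  also have "emeasure lborel \<dots> = emeasure lborel (S \<inter> {r<..2*pi}) + emeasure lborel (S \<inter> {2*pi<..2*pi+r})"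
    using S by (intro plus_emeasure[symmetric]) auto
  also have "emeasure lborel (S \<inter> {2*pi<..2*pi+r}) = emeasure lborel {t. t + 2 * pi \<in> S \<inter> {2*pi<..2*pi+r}}"
    using S by (intro emeasure_lborel_shift[symmetric]) auto
  also have "{t. t + 2 * pi \<in> S \<inter> {2*pi<..2*pi+r}} = S \<inter> {0<..r}"
    using per by auto
  also have "emeasure lborel (S \<inter> {r<..2*pi}) + emeasure lborel (S \<inter> {0<..r})
      = emeasure lborel ((S \<inter> {r<..2*pi}) \<union> (S \<inter> {0<..r}))"
    using S by (intro plus_emeasure) auto
  also have "(S \<inter> {r<..2*pi}) \<union> (S \<inter> {0<..r}) = S \<inter> {0<..2*pi}"
    using r by auto
  finally show ?thesis using S by (simp add: emeasure_seg)
qed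

text \<open>Stated for image measures, so that integrability and the value of the integral are both
  transported along one equality.\<close>

lemma distr_circ_shift:
  assumes F [measurable]: "F \<in> borel \<rightarrow>\<^sub>M N" and per: "periodic F"
  shows "distr circ N (\<lambda>t. F (t + c)) = distr circ N F"
proof (rule measure_eqI)
  fix A assume "A \<in> sets (distr circ N (\<lambda>t. F (t + c)))"
  then have A [measurable]: "A \<in> sets N" by simp
  define r where "r = c - of_int \<lfloor>c / (2 * pi)\<rfloor> * (2 * pi)"
  have r: "0 \<le> r" "r \<le> 2 * pi"
    using floor_divide_lower[of "2 * pi" c] floor_divide_upper[of "2 * pi" c]
    by (auto simp: r_def algebra_simps)
  have Fr: "F (t + c) = F (t + r)" for t
    using periodic_add_int[OF per, of "t + r" "\<lfloor>c / (2 * pi)\<rfloor>"] by (simp add: r_def)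
  define S where "S = F -` A"
  have S: "S \<in> sets borel" using measurable_sets[OF F A] by (simp add: S_def)
  have "emeasure (distr circ N (\<lambda>t. F (t + c))) A = emeasure circ {t. t + r \<in> S}"
    by (subst emeasure_distr) (auto simp: Fr S_def vimage_def)
  also have "\<dots> = emeasure circ S"
    using per S r by (intro emeasure_periodic_shift) (auto simp: S_def periodic_def)
  also have "\<dots> = emeasure (distr circ N F) A"
    by (subst emeasure_distr) (auto simp: S_def)
  finally show "emeasure (distr circ N (\<lambda>t. F (t + c))) A = emeasure (distr circ N F) A" .
qed simp

text \<open>On each slice of fixed y the shear is a translation by the constant
  \<open>\<sigma> y\<close>, which preserves \<open>circ\<close>. With \<open>\<sigma> x\<close>
  equal to x or - x this straightens the characteristics.\<close>

lemma distr_shear: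
  assumes F [measurable]: "F \<in> borel \<Otimes>\<^sub>M M \<rightarrow>\<^sub>M N" and per: "\<And>y. periodic (\<lambda>t. F (t, y))"
    and [measurable]: "\<sigma> \<in> borel_measurable M" and M: "sigma_finite_measure M"
  shows "distr (circ \<Otimes>\<^sub>M M) N (\<lambda>(t, y). F (t + \<sigma> y, y)) = distr (circ \<Otimes>\<^sub>M M) N F"
proof (rule measure_eqI)
  let ?G = "\<lambda>(t, y). F (t + \<sigma> y, y)" and ?S = "space (circ \<Otimes>\<^sub>M M)"
  interpret M: sigma_finite_measure M by fact
  interpret P: pair_sigma_finite circ M by unfold_locales
  fix A assume "A \<in> sets (distr (circ \<Otimes>\<^sub>M M) N ?G)"
  then have A [measurable]: "A \<in> sets N" by simp
  have "emeasure (distr (circ \<Otimes>\<^sub>M M) N ?G) A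
      = emeasure (circ \<Otimes>\<^sub>M M) (?G -` A \<inter> ?S)"
    by (subst emeasure_distr) auto
  also have "\<dots> = (\<integral>\<^sup>+y. emeasure circ ((\<lambda>t. (t, y)) -` (?G -` A \<inter> ?S)) \<partial>M)"
    by (intro P.emeasure_pair_measure_alt2 measurable_sets[OF _ A]) measurable
  also have "\<dots> = (\<integral>\<^sup>+y. emeasure circ ((\<lambda>t. (t, y)) -` (F -` A \<inter> ?S)) \<partial>M)"
  proof (intro nn_integral_cong)
    fix y assume y: "y \<in> space M"
    have meas: "(\<lambda>t. F (t, y)) \<in> borel \<rightarrow>\<^sub>M N" using y by measurable
    have meas': "(\<lambda>t. F (t + \<sigma> y, y)) \<in> borel \<rightarrow>\<^sub>M N" using y by measurable
    have "emeasure (distr circ N (\<lambda>t. F (t + \<sigma> y, y))) A = emeasure (distr circ N (\<lambda>t. F (t, y))) A"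
      using distr_circ_shift[OF meas per] by simp
    then show "emeasure circ ((\<lambda>t. (t, y)) -` (?G -` A \<inter> ?S))
       = emeasure circ ((\<lambda>t. (t, y)) -` (F -` A \<inter> ?S))"
      using meas meas' y A
      by (simp add: emeasure_distr vimage_def space_pair_measure)
  qed
  also have "\<dots> = emeasure (circ \<Otimes>\<^sub>M M) (F -` A \<inter> ?S)"
    by (intro P.emeasure_pair_measure_alt2[symmetric] measurable_sets[OF _ A]) measurable
  also have "\<dots> = emeasure (distr (circ \<Otimes>\<^sub>M M) N F) A"
    by (subst emeasure_distr) auto
  finally show "emeasure (distr (circ \<Otimes>\<^sub>M M) N ?G) A = emeasure (distr (circ \<Otimes>\<^sub>M M) N F) A" .
qed simp

lemma shear_integrable_iff:
  fixes F :: "real \<times> real \<Rightarrow> 'b::{banach, second_countable_topology}"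
  assumes F [measurable]: "F \<in> borel_measurable borel2" and per: "\<And>x. periodic (\<lambda>t. F (t, x))"
    and [measurable]: "\<sigma> \<in> borel_measurable borel"
  shows "integrable cyl (\<lambda>(t, x). F (t + \<sigma> x, x)) \<longleftrightarrow> integrable cyl F"
proof -
  have eq: "distr cyl borel (\<lambda>(t, y). F (t + \<sigma> y, y)) = distr cyl borel F"
    using seg.sigma_finite_measure_axioms by (intro distr_shear per) auto
  have "integrable cyl (\<lambda>(t, x). F (t + \<sigma> x, x))
    \<longleftrightarrow> integrable (distr cyl borel (\<lambda>(t, y). F (t + \<sigma> y, y))) (\<lambda>y. y)"
    by (subst integrable_distr_eq) auto
  also have "\<dots> \<longleftrightarrow> integrable cyl F"
    unfolding eq by (subst integrable_distr_eq) auto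
  finally show ?thesis .
qed

lemma shear_integral:
  fixes F :: "real \<times> real \<Rightarrow> 'b::{banach, second_countable_topology}"
  assumes F [measurable]: "F \<in> borel_measurable borel2" and per: "\<And>x. periodic (\<lambda>t. F (t, x))"
    and [measurable]: "\<sigma> \<in> borel_measurable borel"
  shows "(\<integral>(t, x). F (t + \<sigma> x, x) \<partial>cyl) = integral\<^sup>L cyl F"
proof -
  have eq: "distr cyl borel (\<lambda>(t, y). F (t + \<sigma> y, y)) = distr cyl borel F"
    using seg.sigma_finite_measure_axioms by (intro distr_shear per) auto
  have "(\<integral>(t, x). F (t + \<sigma> x, x) \<partial>cyl)
    = integral\<^sup>L (distr cyl borel (\<lambda>(t, y). F (t + \<sigma> y, y))) (\<lambda>y. y)"
    by (subst integral_distr) auto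
  also have "\<dots> = integral\<^sup>L cyl F"
    unfolding eq by (subst integral_distr) auto
  finally show ?thesis .
qed

lemma cyl_product:
  fixes A B :: "real \<Rightarrow> 'b::{real_normed_field, banach, second_countable_topology}"
  assumes A: "integrable circ A" and B: "integrable (seg 0 pi) B"
  shows "integrable cyl (\<lambda>(t, x). A t * B x)"
    and "(\<integral>(t, x). A t * B x \<partial>cyl) = integral\<^sup>L circ A * integral\<^sup>L (seg 0 pi) B"
proof -
  have [measurable]: "A \<in> borel_measurable borel" "B \<in> borel_measurable borel"
    using borel_measurable_integrable[OF A] borel_measurable_integrable[OF B] by simp_all
  show int: "integrable cyl (\<lambda>(t, x). A t * B x)"
  proof (rule seg_pair.Fubini_integrable)
    show "integrable circ (\<lambda>x. \<integral>y. norm (case (x, y) of (t, x) \<Rightarrow> A t * B x) \<partial>seg 0 pi)"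
      using A B by (simp add: norm_mult)
    show "AE x in circ. integrable (seg 0 pi) (\<lambda>y. case (x, y) of (t, x) \<Rightarrow> A t * B x)"
      using B by simp
  qed measurable
  have "(\<integral>(t, x). A t * B x \<partial>cyl) = (\<integral>t. (\<integral>x. A t * B x \<partial>seg 0 pi) \<partial>circ)"
    using seg_pair.integral_fst'[OF int] by simp
  then show "(\<integral>(t, x). A t * B x \<partial>cyl) = integral\<^sup>L circ A * integral\<^sup>L (seg 0 pi) B"
    using A B by simp
qed

lemma measure_seg: "a \<le> b \<Longrightarrow> measure (seg a b) UNIV = b - a"
  by (simp add: measure_def emeasure_seg)

lemma cyl_of_circ:
  fixes A :: "real \<Rightarrow> 'b::{real_normed_field, banach, second_countable_topology}"
  assumes A: "integrable circ A" and per: "periodic A" and [measurable]: "\<sigma> \<in> borel_measurable borel"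
  shows "integrable cyl (\<lambda>(t, x). A (t + \<sigma> x))"
    and "(\<integral>(t, x). A (t + \<sigma> x) \<partial>cyl) = of_real pi * integral\<^sup>L circ A"
proof -
  note [measurable] = borel_measurable_seg[OF A]
  have one: "integrable cyl (\<lambda>(t, x). A t)" "(\<integral>(t, x). A t \<partial>cyl) = of_real pi * integral\<^sup>L circ A"
    using cyl_product[OF A, of "\<lambda>_. 1"] by (auto simp: measure_seg scaleR_conv_of_real mult.commute)
  show "integrable cyl (\<lambda>(t, x). A (t + \<sigma> x))"
    using shear_integrable_iff[of "\<lambda>(t, x). A t" \<sigma>] per one(1) by (simp add: split_beta')
  show "(\<integral>(t, x). A (t + \<sigma> x) \<partial>cyl) = of_real pi * integral\<^sup>L circ A"
    using shear_integral[of "\<lambda>(t, x). A t" \<sigma>] per one(2) by (simp add: split_beta')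
qed

lemma integrable_mult_bounded:
  fixes F G :: "'a \<Rightarrow> 'b::{real_normed_algebra, banach, second_countable_topology}"
  assumes F: "integrable M F" and [measurable]: "G \<in> borel_measurable M" and B: "\<And>x. norm (G x) \<le> B"
  shows "integrable M (\<lambda>x. F x * G x)"
proof (rule Bochner_Integration.integrable_bound[of M "\<lambda>x. B * norm (F x)"])
  show "AE x in M. norm (F x * G x) \<le> norm (B * norm (F x))"
  proof (intro always_eventually allI)
    fix x
    have "norm (F x * G x) \<le> norm (F x) * norm (G x)" by (rule norm_mult_ineq)
    also have "\<dots> \<le> norm (F x) * B" by (intro mult_left_mono B) auto
    also have "\<dots> \<le> norm (B * norm (F x))" by (simp add: mult.commute)
    finally show "norm (F x * G x) \<le> norm (B * norm (F x))" .
  qed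
qed (use F in auto)

section \<open>Kernel functions and their adjoint\<close>

text \<open>The adjoint of \<open>wave\<close>: it integrates F along the two characteristics that
  issue from the boundary point (s, 0).\<close>

definition char_mean :: "(real \<times> real \<Rightarrow> real) \<Rightarrow> real \<Rightarrow> real" where
  "char_mean F s = (\<integral>x. F (s - x, x) - F (s + x, x) \<partial>seg 0 pi)"

text \<open>Kernel elements of the wave operator with Dirichlet conditions: at x = pi the value is
  p(t + pi) - p(t - pi), which is 0 for 2 pi-periodic p.\<close>

definition wave :: "(real \<Rightarrow> real) \<Rightarrow> real \<times> real \<Rightarrow> real" where
  "wave p = (\<lambda>(t, x). p (t + x) - p (t - x))"

lemma wave_measurable [measurable]:
  assumes [measurable]: "p \<in> borel_measurable borel"
  shows "wave p \<in> borel_measurable borel2"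
  unfolding wave_def by measurable

lemma periodic_wave: "periodic p \<Longrightarrow> periodic (\<lambda>t. wave p (t, x))"
proof -
  assume p: "periodic p"
  have "p (t + 2 * pi + x) = p (t + x)" "p (t + 2 * pi - x) = p (t - x)" for t
    using p[unfolded periodic_def, rule_format, of "t + x"] p[unfolded periodic_def, rule_format, of "t - x"]
    by (simp_all add: algebra_simps)
  then show ?thesis by (simp add: periodic_def wave_def)
qed

lemma integrable_wave:
  assumes "integrable circ p" "periodic p"
  shows "integrable cyl (wave p)"
proof -
  have "integrable cyl (\<lambda>z. (\<lambda>(t, x). p (t + x)) z - (\<lambda>(t, x). p (t + - x)) z)"
    using assms by (intro Bochner_Integration.integrable_diff cyl_of_circ) auto
  then show ?thesis by (simp add: wave_def split_beta')
qed

lemma char_mean_measurable [measurable]: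
  assumes [measurable]: "F \<in> borel_measurable borel2"
  shows "char_mean F \<in> borel_measurable borel"
  unfolding char_mean_def by measurable

lemma periodic_char_mean:
  assumes "\<And>x. periodic (\<lambda>t. F (t, x))"
  shows "periodic (char_mean F)"
proof -
  have "F (t + 2 * pi + x, x) = F (t + x, x)" "F (t + 2 * pi - x, x) = F (t - x, x)" for t x
    using assms[of x, unfolded periodic_def, rule_format, of "t + x"]
      assms[of x, unfolded periodic_def, rule_format, of "t - x"]
    by (simp_all add: algebra_simps)
  then show ?thesis by (simp add: periodic_def char_mean_def)
qed

text \<open>A shear along each family of characteristics turns \<open>\<Theta> (t + x)\<close> and
  \<open>\<Theta> (t - x)\<close> into \<open>\<Theta> t\<close>; Fubini then integrates out x.
  Boundedness of \<open>\<Theta>\<close> makes the pairing with a merely integrable F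
  meaningful.\<close>

lemma char_mean_dual:
  assumes F: "integrable cyl F" and per: "\<And>x. periodic (\<lambda>t. F (t, x))"
    and [measurable]: "\<Theta> \<in> borel_measurable borel" and perT: "periodic \<Theta>" and B: "\<And>s. \<bar>\<Theta> s\<bar> \<le> B"
  shows "integrable circ (char_mean F)"
    and "integrable cyl (\<lambda>z. F z * wave \<Theta> z)"
    and "(\<integral>z. F z * wave \<Theta> z \<partial>cyl) = (\<integral>s. char_mean F s * \<Theta> s \<partial>circ)"
proof -
  note [measurable] = borel_measurable_cyl[OF F]
  have shifted: "integrable cyl (\<lambda>(t, x). F (t + \<sigma> x, x))" if "\<sigma> \<in> borel_measurable borel" for \<sigma>
    using shear_integrable_iff[of F \<sigma>] per F that by simp
  have diff: "integrable cyl (\<lambda>(t, x). F (t - x, x) - F (t + x, x))"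
    using Bochner_Integration.integrable_diff[OF shifted[of "\<lambda>x. - x"] shifted[of "\<lambda>x. x"]]
    by (simp add: split_beta')
  then show "integrable circ (char_mean F)"
    using seg_pair.integrable_fst'[OF diff] by (simp add: char_mean_def[abs_def])
  have int: "integrable cyl (\<lambda>(t, x). F (t, x) * \<Theta> (t + \<sigma> x))" if [measurable]: "\<sigma> \<in> borel_measurable borel" for \<sigma>
    using integrable_mult_bounded[OF F, of "\<lambda>(t, x). \<Theta> (t + \<sigma> x)" B] B by (simp add: split_beta')
  have perF\<Theta>: "periodic (\<lambda>t. F (t, x) * \<Theta> (t + c))" for x c
    using per[of x] perT[unfolded periodic_def, rule_format, of "_ + c"]
    by (simp add: periodic_def algebra_simps)
  have eq: "(\<integral>(t, x). F (t, x) * \<Theta> (t + \<sigma> x) \<partial>cyl) = (\<integral>(t, x). F (t - \<sigma> x, x) * \<Theta> t \<partial>cyl)"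
    if [measurable]: "\<sigma> \<in> borel_measurable borel" for \<sigma>
    using shear_integral[of "\<lambda>(t, x). F (t, x) * \<Theta> (t + \<sigma> x)" "\<lambda>x. - \<sigma> x"] perF\<Theta>
    by (simp add: split_beta')
  have int': "integrable cyl (\<lambda>(t, x). F (t - \<sigma> x, x) * \<Theta> t)" if [measurable]: "\<sigma> \<in> borel_measurable borel" for \<sigma>
    using shear_integrable_iff[of "\<lambda>(t, x). F (t, x) * \<Theta> (t + \<sigma> x)" "\<lambda>x. - \<sigma> x"] perF\<Theta> int[of \<sigma>]
    by (simp add: split_beta')
  show "integrable cyl (\<lambda>z. F z * wave \<Theta> z)"
    using Bochner_Integration.integrable_diff[OF int[of "\<lambda>x. x"] int[of "\<lambda>x. - x"]]
    by (simp add: wave_def split_beta' algebra_simps)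
  have "(\<integral>z. F z * wave \<Theta> z \<partial>cyl)
      = (\<integral>z. (\<lambda>(t, x). F (t, x) * \<Theta> (t + x)) z - (\<lambda>(t, x). F (t, x) * \<Theta> (t + - x)) z \<partial>cyl)"
    by (simp add: wave_def split_beta' algebra_simps)
  also have "\<dots> = (\<integral>(t, x). F (t - x, x) * \<Theta> t \<partial>cyl) - (\<integral>(t, x). F (t - (- x), x) * \<Theta> t \<partial>cyl)"
    using int[of "\<lambda>x. x"] int[of "\<lambda>x. - x"] eq[of "\<lambda>x. x"] eq[of "\<lambda>x. - x"]
    by (subst Bochner_Integration.integral_diff) auto
  also have "\<dots> = (\<integral>z. (\<lambda>(t, x). F (t - x, x) * \<Theta> t) z - (\<lambda>(t, x). F (t - (- x), x) * \<Theta> t) z \<partial>cyl)"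
    using int'[of "\<lambda>x. x"] int'[of "\<lambda>x. - x"]
    by (intro Bochner_Integration.integral_diff[symmetric]) auto
  also have "\<dots> = (\<integral>(t, x). (F (t - x, x) - F (t + x, x)) * \<Theta> t \<partial>cyl)"
    by (simp add: split_beta' algebra_simps)
  also have "\<dots> = (\<integral>t. (\<integral>x. (F (t - x, x) - F (t + x, x)) * \<Theta> t \<partial>seg 0 pi) \<partial>circ)"
  proof -
    have "integrable cyl (\<lambda>(t, x). (F (t - x, x) - F (t + x, x)) * \<Theta> t)"
      using integrable_mult_bounded[OF diff, of "\<lambda>(t, x). \<Theta> t" B] B by (simp add: split_beta')
    from seg_pair.integral_fst'[OF this] show ?thesis by simp
  qed
  also have "\<dots> = (\<integral>s. char_mean F s * \<Theta> s \<partial>circ)"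
    by (simp add: char_mean_def)
  finally show "(\<integral>z. F z * wave \<Theta> z \<partial>cyl) = (\<integral>s. char_mean F s * \<Theta> s \<partial>circ)" .
qed

lemma seg_scale:
  fixes G :: "real \<Rightarrow> real"
  assumes G: "integrable circ G"
  shows "integrable (seg 0 pi) (\<lambda>x. G (2 * x))" "(\<integral>x. G (2 * x) \<partial>seg 0 pi) = integral\<^sup>L circ G / 2"
proof -
  note [measurable] = borel_measurable_seg[OF G]
  have int: "integrable lborel (\<lambda>t. indicator {0<..2*pi} t * G t)"
    using G unfolding seg_def by (subst (asm) integrable_density) auto
  have ind: "indicator {0<..2*pi} (0 + 2 * x) = (indicator {0<..pi} x :: real)" for x
    by (auto simp: indicator_def)
  have int2: "integrable lborel (\<lambda>x. indicator {0<..pi} x * G (2 * x))"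
    using lborel_integrable_real_affine[OF int, of 2 0] ind by simp
  then show "integrable (seg 0 pi) (\<lambda>x. G (2 * x))"
    unfolding seg_def by (subst integrable_density) auto
  have "(\<integral>x. G (2 * x) \<partial>seg 0 pi) = (\<integral>x. indicator {0<..pi} x * G (2 * x) \<partial>lborel)"
    unfolding seg_def by (subst integral_density) auto
  also have "\<dots> = (\<integral>t. indicator {0<..2*pi} t * G t \<partial>lborel) / 2"
    by (subst lborel_integral_real_affine[of 2 _ 0]) (auto simp: ind[simplified])
  also have "(\<integral>t. indicator {0<..2*pi} t * G t \<partial>lborel) = integral\<^sup>L circ G"
    unfolding seg_def by (subst integral_density) auto
  finally show "(\<integral>x. G (2 * x) \<partial>seg 0 pi) = integral\<^sup>L circ G / 2" .
qed

lemma seg_reflect: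
  fixes G :: "real \<Rightarrow> real"
  assumes G: "integrable (seg 0 a) G"
  shows "integrable (seg 0 a) (\<lambda>x. G (a - x))" "(\<integral>x. G (a - x) \<partial>seg 0 a) = integral\<^sup>L (seg 0 a) G"
proof -
  note [measurable] = borel_measurable_seg[OF G]
  have int: "integrable lborel (\<lambda>t. indicator {0<..a} t * G t)"
    using G unfolding seg_def by (subst (asm) integrable_density) auto
  have ind: "AE x in lborel. indicator {0<..a} (a - x) = (indicator {0<..a} x :: real)"
    using AE_lborel_singleton[of 0] AE_lborel_singleton[of a]
    by eventually_elim (auto simp: indicator_def)
  have "integrable lborel (\<lambda>x. indicator {0<..a} (a - x) * G (a - x))"
    using lborel_integrable_real_affine[OF int, of "-1" a] by simp
  then have int2: "integrable lborel (\<lambda>x. indicator {0<..a} x * G (a - x))"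
    by (rule integrable_cong_AE_imp) (use ind in \<open>auto elim!: eventually_mono\<close>)
  then show "integrable (seg 0 a) (\<lambda>x. G (a - x))"
    unfolding seg_def by (subst integrable_density) auto
  have "(\<integral>x. G (a - x) \<partial>seg 0 a) = (\<integral>x. indicator {0<..a} x * G (a - x) \<partial>lborel)"
    unfolding seg_def by (subst integral_density) auto
  also have "\<dots> = (\<integral>x. indicator {0<..a} (a - x) * G (a - x) \<partial>lborel)"
    by (rule integral_cong_AE) (use ind in \<open>auto elim!: eventually_mono\<close>)
  also have "\<dots> = (\<integral>t. indicator {0<..a} t * G t \<partial>lborel)"
    by (subst lborel_integral_real_affine[of "-1" _ a]) auto
  also have "\<dots> = integral\<^sup>L (seg 0 a) G"
    unfolding seg_def by (subst integral_density) auto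
  finally show "(\<integral>x. G (a - x) \<partial>seg 0 a) = integral\<^sup>L (seg 0 a) G" .
qed

lemma circ_shift:
  fixes A :: "real \<Rightarrow> 'b::{banach, second_countable_topology}"
  assumes [measurable]: "A \<in> borel_measurable borel" and per: "periodic A"
  shows "integrable circ (\<lambda>t. A (t + c)) \<longleftrightarrow> integrable circ A"
    "(\<integral>t. A (t + c) \<partial>circ) = integral\<^sup>L circ A"
proof -
  have eq: "distr circ borel (\<lambda>t. A (t + c)) = distr circ borel A"
    using per by (intro distr_circ_shift) auto
  have "integrable circ (\<lambda>t. A (t + c)) \<longleftrightarrow> integrable (distr circ borel (\<lambda>t. A (t + c))) (\<lambda>y. y)"
    by (subst integrable_distr_eq) auto
  also have "\<dots> \<longleftrightarrow> integrable circ A"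
    unfolding eq by (subst integrable_distr_eq) auto
  finally show "integrable circ (\<lambda>t. A (t + c)) \<longleftrightarrow> integrable circ A" .
  have "(\<integral>t. A (t + c) \<partial>circ) = integral\<^sup>L (distr circ borel (\<lambda>t. A (t + c))) (\<lambda>y. y)"
    by (subst integral_distr) auto
  also have "\<dots> = integral\<^sup>L circ A"
    unfolding eq by (subst integral_distr) auto
  finally show "(\<integral>t. A (t + c) \<partial>circ) = integral\<^sup>L circ A" .
qed

text \<open>While x runs over (0, pi), 2 x runs over a full period, so each of
  \<open>Q (s - 2 * x)\<close> and \<open>Q (s + 2 * x)\<close> contributes half of the integral
  over the circle. On mean-zero functions \<open>char_mean\<close> thus inverts \<open>wave\<close>
  up to the factor 2 pi.\<close>

lemma char_mean_wave:
  assumes Q: "integrable circ Q" and per: "periodic Q"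
  shows "char_mean (wave Q) s = 2 * pi * Q s - integral\<^sup>L circ Q"
proof -
  note [measurable] = borel_measurable_seg[OF Q]
  have "integrable circ (\<lambda>y. Q (y + s))"
    using circ_shift[of Q s] per Q by simp
  from seg_scale[OF this] circ_shift[of Q s] per
  have plus: "integrable (seg 0 pi) (\<lambda>x. Q (2 * x + s))" "(\<integral>x. Q (2 * x + s) \<partial>seg 0 pi) = integral\<^sup>L circ Q / 2"
    by simp_all
  have refl: "Q (2 * (pi - x) + s) = Q (s - 2 * x)" for x
    using per[unfolded periodic_def, rule_format, of "s - 2 * x"] by (simp add: algebra_simps)
  have minus: "integrable (seg 0 pi) (\<lambda>x. Q (s - 2 * x))" "(\<integral>x. Q (s - 2 * x) \<partial>seg 0 pi) = integral\<^sup>L circ Q / 2"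
    using seg_reflect[OF plus(1)] plus(2) refl by simp_all
  have "char_mean (wave Q) s = (\<integral>x. 2 * Q s - (Q (s - 2 * x) + Q (2 * x + s)) \<partial>seg 0 pi)"
    unfolding char_mean_def by (intro Bochner_Integration.integral_cong) (auto simp: wave_def algebra_simps)
  also have "\<dots> = 2 * pi * Q s - integral\<^sup>L circ Q"
    using plus minus by (simp add: measure_seg)
  finally show ?thesis .
qed

lemma wave_dual:
  assumes Q: "integrable circ Q" and per: "periodic Q" and mean: "integral\<^sup>L circ Q = 0"
    and [measurable]: "\<Theta> \<in> borel_measurable borel" and perT: "periodic \<Theta>" and B: "\<And>s. \<bar>\<Theta> s\<bar> \<le> B"
  shows "(\<integral>z. wave Q z * wave \<Theta> z \<partial>cyl) = 2 * pi * (\<integral>s. Q s * \<Theta> s \<partial>circ)"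
  using char_mean_dual(3)[OF integrable_wave[OF Q per] periodic_wave[OF per], of \<Theta> B]
    assms char_mean_wave[OF Q per]
  by (simp add: mult.assoc)

lemma wave_abs_le:
  assumes Q: "integrable circ Q" and per: "periodic Q"
  shows "(\<integral>z. \<bar>wave Q z\<bar> \<partial>cyl) \<le> 2 * pi * (\<integral>s. \<bar>Q s\<bar> \<partial>circ)"
proof -
  have per': "periodic (\<lambda>s. \<bar>Q s\<bar>)" using per by (simp add: periodic_def)
  note plus = cyl_of_circ[OF integrable_abs[OF Q] per', of "\<lambda>x. x"]
  note minus = cyl_of_circ[OF integrable_abs[OF Q] per', of "\<lambda>x. - x"]
  have "(\<integral>z. \<bar>wave Q z\<bar> \<partial>cyl)
    \<le> (\<integral>z. (\<lambda>(t, x). \<bar>Q (t + x)\<bar>) z + (\<lambda>(t, x). \<bar>Q (t + - x)\<bar>) z \<partial>cyl)"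
    using plus(1) minus(1) integrable_wave[OF Q per]
    by (intro integral_mono) (auto simp: wave_def)
  also have "\<dots> = 2 * pi * (\<integral>s. \<bar>Q s\<bar> \<partial>circ)"
    using plus minus by (subst Bochner_Integration.integral_add) auto
  finally show ?thesis .
qed

section \<open>A priori bounds by truncated test functions\<close>

definition cutoff :: "real \<Rightarrow> real \<Rightarrow> real" where
  "cutoff M y = (if \<bar>y\<bar> > M then sgn y else 0)"

lemma cutoff_measurable [measurable]: "cutoff M \<in> borel_measurable borel"
  unfolding cutoff_def by measurable

lemma cutoff_abs_le: "\<bar>cutoff M y\<bar> \<le> 1"
  by (simp add: cutoff_def sgn_if)

lemma cutoff_mono: "M \<ge> 0 \<Longrightarrow> y \<le> z \<Longrightarrow> cutoff M y \<le> cutoff M z"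
  by (auto simp: cutoff_def sgn_if)

lemma cutoff_mult_self: "M \<ge> 0 \<Longrightarrow> y * cutoff M y = \<bar>y\<bar> * \<bar>cutoff M y\<bar>"
  by (auto simp: cutoff_def sgn_if)

lemma cutoff_ge: "M * \<bar>cutoff M y\<bar> \<le> \<bar>y\<bar> * \<bar>cutoff M y\<bar>"
  by (auto simp: cutoff_def sgn_if)

text \<open>Rearrangement inequality: the modulus of \<open>cutoff M y\<close> is a nondecreasing
  function of |y|, so pairing each modulus with its own cutoff gives the largest sum. The level M
  has to be the same for both arguments.\<close>

lemma cutoff_rearrangement:
  "\<bar>y\<bar> * \<bar>cutoff M z\<bar> + \<bar>z\<bar> * \<bar>cutoff M y\<bar> \<le> \<bar>y\<bar> * \<bar>cutoff M y\<bar> + \<bar>z\<bar> * \<bar>cutoff M z\<bar>"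
  by (auto simp: cutoff_def sgn_if)

lemma integrable_cutoff:
  assumes [measurable]: "R \<in> borel_measurable borel"
  shows "integrable circ (\<lambda>s. cutoff M (R s))"
  using cutoff_abs_le by (intro seg.integrable_const_bound[of _ 1]) auto

definition kernel_orthogonal :: "(real \<times> real \<Rightarrow> real) \<Rightarrow> bool" where
  "kernel_orthogonal h \<longleftrightarrow> (\<forall>\<Theta>\<in>borel_measurable borel. periodic \<Theta> \<longrightarrow> (\<forall>s. \<bar>\<Theta> s\<bar> \<le> 1) \<longrightarrow>
     (\<integral>z. h z * wave \<Theta> z \<partial>cyl) = 0)"

lemma kernel_orthogonalI:
  assumes "\<And>\<Theta>. \<Theta> \<in> borel_measurable borel \<Longrightarrow> periodic \<Theta> \<Longrightarrow> (\<And>s. \<bar>\<Theta> s\<bar> \<le> 1) \<Longrightarrow>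
    (\<integral>z. h z * wave \<Theta> z \<partial>cyl) = 0"
  shows "kernel_orthogonal h"
  using assms by (simp add: kernel_orthogonal_def)

lemma kernel_orthogonalD:
  assumes "kernel_orthogonal h" "\<Theta> \<in> borel_measurable borel" "periodic \<Theta>" "\<And>s. \<bar>\<Theta> s\<bar> \<le> 1"
  shows "(\<integral>z. h z * wave \<Theta> z \<partial>cyl) = 0"
  using assms by (simp add: kernel_orthogonal_def)

lemma kernel_orthogonal_cong_AE:
  assumes h: "kernel_orthogonal h" and ae: "AE z in cyl. h z = h' z"
    and [measurable]: "h \<in> borel_measurable borel2" "h' \<in> borel_measurable borel2"
  shows "kernel_orthogonal h'"
proof (rule kernel_orthogonalI)
  fix \<Theta> :: "real \<Rightarrow> real" assume \<Theta>: "\<Theta> \<in> borel_measurable borel" "periodic \<Theta>" "\<And>s. \<bar>\<Theta> s\<bar> \<le> 1"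
  note [measurable] = \<Theta>(1)
  have "(\<integral>z. h' z * wave \<Theta> z \<partial>cyl) = (\<integral>z. h z * wave \<Theta> z \<partial>cyl)"
    by (rule integral_cong_AE) (auto intro!: eventually_mono[OF ae])
  then show "(\<integral>z. h' z * wave \<Theta> z \<partial>cyl) = 0"
    using kernel_orthogonalD[OF h \<Theta>] by simp
qed

text \<open>The kernel is invariant under time translation: shifting h by \<tau> amounts to testing
  h with \<open>\<Theta> (s - \<tau>)\<close>.\<close>

lemma kernel_orthogonal_increment:
  assumes h: "integrable cyl h" "\<And>x. periodic (\<lambda>t. h (t, x))" and orth: "kernel_orthogonal h"
  shows "kernel_orthogonal (\<lambda>z. h (fst z + \<tau>, snd z) - h z)"
proof (rule kernel_orthogonalI)
  fix \<Theta> :: "real \<Rightarrow> real" assume \<Theta>: "\<Theta> \<in> borel_measurable borel" "periodic \<Theta>" "\<And>s. \<bar>\<Theta> s\<bar> \<le> 1"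
  note [measurable] = \<Theta>(1)
  note [measurable] = borel_measurable_cyl[OF h(1)]
  define \<Theta>' where "\<Theta>' = (\<lambda>s. \<Theta> (s - \<tau>))"
  have \<Theta>': "\<Theta>' \<in> borel_measurable borel" "periodic \<Theta>'" "\<And>s. \<bar>\<Theta>' s\<bar> \<le> 1"
    using \<Theta> \<Theta>(2)[unfolded periodic_def, rule_format, of "_ - \<tau>"]
    by (auto simp: \<Theta>'_def periodic_def algebra_simps)
  have shift: "integrable cyl (\<lambda>z. h (fst z + \<tau>, snd z))"
    using shear_integrable_iff[of h "\<lambda>_. \<tau>"] h by (simp add: split_beta')
  have per: "periodic (\<lambda>t. h (fst (t, x) + \<tau>, snd (t, x)))" for x
    using h(2)[of x, unfolded periodic_def, rule_format, of "_ + \<tau>"] by (simp add: periodic_def algebra_simps)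
  have "(\<integral>z. h (fst z + \<tau>, snd z) * wave \<Theta> z \<partial>cyl)
    = (\<integral>(t, x). (\<lambda>z. h (fst z + \<tau>, snd z) * wave \<Theta> z) (t + - \<tau>, x) \<partial>cyl)"
  proof (rule shear_integral[symmetric])
    show "periodic (\<lambda>t. h (fst (t, x) + \<tau>, snd (t, x)) * wave \<Theta> (t, x))" for x
      using per[of x] periodic_wave[OF \<Theta>(2), of x] by (simp add: periodic_def)
  qed measurable
  also have "\<dots> = (\<integral>z. h z * wave \<Theta>' z \<partial>cyl)"
    by (intro Bochner_Integration.integral_cong) (auto simp: wave_def \<Theta>'_def algebra_simps)
  also have "\<dots> = 0" by (rule kernel_orthogonalD[OF orth \<Theta>'])
  finally show "(\<integral>z. (h (fst z + \<tau>, snd z) - h z) * wave \<Theta> z \<partial>cyl) = 0"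
    unfolding left_diff_distrib
    by (simp only: Bochner_Integration.integral_diff[OF char_mean_dual(2)[OF shift per \<Theta>] char_mean_dual(2)[OF h \<Theta>]]
      kernel_orthogonalD[OF orth \<Theta>] diff_self)
qed

text \<open>One-sided on purpose: monotonicity controls the nonlinear term from below where w > 0
  and from above where w < 0, but gives no bound for its modulus. Where w = 0 nothing is asked of
  K.\<close>

definition sign_bounded :: "(real \<times> real \<Rightarrow> real) \<Rightarrow> (real \<times> real \<Rightarrow> real) \<Rightarrow> real \<Rightarrow> bool" where
  "sign_bounded w K C \<longleftrightarrow> (AE z in cyl. (w z > 0 \<longrightarrow> K z \<ge> - C) \<and> (w z < 0 \<longrightarrow> K z \<le> C))"

text \<open>Since \<open>cutoff M\<close> is nondecreasing, \<open>wave (cutoff M \<circ> R)\<close> has the sign of \<open>wave R\<close> wherever it does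
  not vanish, so the sign condition bounds \<open>K\<close> from below after testing.\<close>

lemma truncation_test:
  assumes R: "integrable circ R" "periodic R" "integral\<^sup>L circ R = 0"
    and R': "integrable circ R'" "periodic R'" "integral\<^sup>L circ R' = 0"
    and K: "integrable cyl K"
    and sgn: "sign_bounded (wave R) K C"
    and orth: "kernel_orthogonal (\<lambda>z. b * wave R z + \<epsilon> * wave R' z + K z)"
    and M: "M \<ge> 0" and C: "C \<ge> 0"
  shows "b * (\<integral>s. R s * cutoff M (R s) \<partial>circ) + \<epsilon> * (\<integral>s. R' s * cutoff M (R s) \<partial>circ)
     \<le> C * (\<integral>s. \<bar>cutoff M (R s)\<bar> \<partial>circ)"
proof -
  define \<Theta> where "\<Theta> = (\<lambda>s. cutoff M (R s))"
  note [measurable] = borel_measurable_seg[OF R(1)]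
  have \<Theta> [measurable]: "\<Theta> \<in> borel_measurable borel" unfolding \<Theta>_def by measurable
  have per\<Theta>: "periodic \<Theta>" using R(2) by (simp add: \<Theta>_def periodic_def)
  have bd: "\<bar>\<Theta> s\<bar> \<le> 1" for s by (simp add: \<Theta>_def cutoff_abs_le)
  have int\<Theta>: "integrable circ \<Theta>" unfolding \<Theta>_def by (rule integrable_cutoff) measurable
  have bd2: "norm (wave \<Theta> z) \<le> 2" for z
    using bd[of "fst z + snd z"] bd[of "fst z - snd z"] by (auto simp: wave_def split_beta')
  have intK: "integrable cyl (\<lambda>z. K z * wave \<Theta> z)"
    by (rule integrable_mult_bounded[OF K _ bd2]) measurable
  note int1 = char_mean_dual(2)[OF integrable_wave[OF R(1,2)] periodic_wave[OF R(2)] \<Theta> per\<Theta> bd]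
  note int2 = char_mean_dual(2)[OF integrable_wave[OF R'(1,2)] periodic_wave[OF R'(2)] \<Theta> per\<Theta> bd]
  have "0 = (\<integral>z. b * (wave R z * wave \<Theta> z) + \<epsilon> * (wave R' z * wave \<Theta> z) + K z * wave \<Theta> z \<partial>cyl)"
    using kernel_orthogonalD[OF orth \<Theta> per\<Theta> bd] by (simp add: algebra_simps)
  also have "\<dots> = b * (2 * pi * (\<integral>s. R s * \<Theta> s \<partial>circ)) + \<epsilon> * (2 * pi * (\<integral>s. R' s * \<Theta> s \<partial>circ))
      + (\<integral>z. K z * wave \<Theta> z \<partial>cyl)"
    using int1 int2 intK wave_dual[OF R \<Theta> per\<Theta> bd] wave_dual[OF R' \<Theta> per\<Theta> bd] by simp
  finally have zero: "b * (2 * pi * (\<integral>s. R s * \<Theta> s \<partial>circ)) + \<epsilon> * (2 * pi * (\<integral>s. R' s * \<Theta> s \<partial>circ))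
      + (\<integral>z. K z * wave \<Theta> z \<partial>cyl) = 0" by simp
  \<comment> \<open>The factor 2 pi lost in \<open>wave_abs_le\<close> is the one gained in
    \<open>wave_dual\<close>, so it cancels and the final constant is C.\<close>
  have "- C * (2 * pi * (\<integral>s. \<bar>\<Theta> s\<bar> \<partial>circ)) \<le> - C * (\<integral>z. \<bar>wave \<Theta> z\<bar> \<partial>cyl)"
    using mult_left_mono[OF wave_abs_le[OF int\<Theta> per\<Theta>] C] by simp
  also have "\<dots> = (\<integral>z. - C * \<bar>wave \<Theta> z\<bar> \<partial>cyl)" by simp
  also have "\<dots> \<le> (\<integral>z. K z * wave \<Theta> z \<partial>cyl)"
  proof (rule integral_mono_AE)
    show "integrable cyl (\<lambda>z. - C * \<bar>wave \<Theta> z\<bar>)"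
      using integrable_wave[OF int\<Theta> per\<Theta>] by simp
    show "integrable cyl (\<lambda>z. K z * wave \<Theta> z)" by (rule intK)
    show "AE z in cyl. - C * \<bar>wave \<Theta> z\<bar> \<le> K z * wave \<Theta> z"
    proof (rule eventually_mono[OF sgn[unfolded sign_bounded_def]])
      fix z assume K: "(wave R z > 0 \<longrightarrow> K z \<ge> - C) \<and> (wave R z < 0 \<longrightarrow> K z \<le> C)"
      obtain t x where z: "z = (t, x)" by (cases z)
      consider "wave R z > 0" | "wave R z < 0" | "wave R z = 0" by linarith
      then show "- C * \<bar>wave \<Theta> z\<bar> \<le> K z * wave \<Theta> z"
      proof cases
        case 1
        then have "0 \<le> wave \<Theta> z"
          using cutoff_mono[OF M, of "R (t - x)" "R (t + x)"] by (simp add: z wave_def \<Theta>_def)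
        then show ?thesis using K 1 mult_right_mono[of "- C" "K z" "wave \<Theta> z"] by simp
      next
        case 2
        then have "wave \<Theta> z \<le> 0"
          using cutoff_mono[OF M, of "R (t + x)" "R (t - x)"] by (simp add: z wave_def \<Theta>_def)
        then show ?thesis using K 2 mult_right_mono_neg[of "K z" "C" "wave \<Theta> z"] by simp
      next
        \<comment> \<open>Here \<open>R (t + x) = R (t - x)\<close>, so the two truncations coincide
          and the uncontrolled value \<open>K z\<close> is multiplied by 0.\<close>
        case 3
        then have "wave \<Theta> z = 0"
          by (simp add: z wave_def \<Theta>_def)
        then show ?thesis by simp
      qed
    qed
  qed
  finally have "2 * pi * (b * (\<integral>s. R s * \<Theta> s \<partial>circ) + \<epsilon> * (\<integral>s. R' s * \<Theta> s \<partial>circ))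
      \<le> 2 * pi * (C * (\<integral>s. \<bar>\<Theta> s\<bar> \<partial>circ))"
    using zero by (simp add: algebra_simps)
  then show ?thesis by (simp add: \<Theta>_def)
qed

text \<open>Add the two tests at a common level M. Let S be the integral of |P| and |Q| over the
  sets where they exceed M, and T the total measure of these sets. Then (b - |\<epsilon>|) S <= C T
  and M T <= S, so T = 0 for every M above C / (b - |\<epsilon>|).\<close>

lemma sup_bound:
  assumes P: "integrable circ P" "periodic P" "integral\<^sup>L circ P = 0"
    and Q: "integrable circ Q" "periodic Q" "integral\<^sup>L circ Q = 0"
    and K: "integrable cyl K" and L: "integrable cyl L"
    and sgnK: "sign_bounded (wave P) K C"
    and sgnL: "sign_bounded (wave Q) L C"
    and orthK: "kernel_orthogonal (\<lambda>z. b * wave P z + \<epsilon> * wave Q z + K z)"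
    and orthL: "kernel_orthogonal (\<lambda>z. b * wave Q z + \<epsilon> * wave P z + L z)"
    and C: "C \<ge> 0" and b: "\<bar>\<epsilon>\<bar> < b"
  shows "AE s in circ. \<bar>P s\<bar> \<le> C / (b - \<bar>\<epsilon>\<bar>) \<and> \<bar>Q s\<bar> \<le> C / (b - \<bar>\<epsilon>\<bar>)"
proof -
  let ?c = "C / (b - \<bar>\<epsilon>\<bar>)"
  have [measurable]: "P \<in> borel_measurable borel" "Q \<in> borel_measurable borel"
    using borel_measurable_integrable[OF P(1)] borel_measurable_integrable[OF Q(1)] by simp_all
  have main: "AE s in circ. \<bar>P s\<bar> \<le> M \<and> \<bar>Q s\<bar> \<le> M" if M: "M > ?c" for M
  proof -
    have "0 \<le> ?c" using C b by simp
    then have M0: "M \<ge> 0" using M by simp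
    define A where "A = (\<lambda>s. cutoff M (P s))"
    define B where "B = (\<lambda>s. cutoff M (Q s))"
    have [measurable]: "A \<in> borel_measurable borel" "B \<in> borel_measurable borel"
      unfolding A_def B_def by measurable
    have bd: "norm (A s) \<le> 1" "norm (B s) \<le> 1" "norm \<bar>A s\<bar> \<le> 1" "norm \<bar>B s\<bar> \<le> 1" for s
      by (auto simp: A_def B_def cutoff_abs_le)
    have AB: "integrable circ A" "integrable circ B"
      unfolding A_def B_def by (auto intro: integrable_cutoff)
    have prods: "integrable circ (\<lambda>s. P s * A s)" "integrable circ (\<lambda>s. P s * B s)"
      "integrable circ (\<lambda>s. Q s * A s)" "integrable circ (\<lambda>s. Q s * B s)"
      using bd by (auto intro!: integrable_mult_bounded P Q)
    have aprods: "integrable circ (\<lambda>s. \<bar>P s\<bar> * \<bar>A s\<bar>)" "integrable circ (\<lambda>s. \<bar>P s\<bar> * \<bar>B s\<bar>)"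
      "integrable circ (\<lambda>s. \<bar>Q s\<bar> * \<bar>A s\<bar>)" "integrable circ (\<lambda>s. \<bar>Q s\<bar> * \<bar>B s\<bar>)"
      using prods[THEN integrable_abs] by (simp_all add: abs_mult)
    define S where "S = (\<integral>s. \<bar>P s\<bar> * \<bar>A s\<bar> + \<bar>Q s\<bar> * \<bar>B s\<bar> \<partial>circ)"
    define T where "T = (\<integral>s. \<bar>A s\<bar> + \<bar>B s\<bar> \<partial>circ)"
    have 1: "b * (\<integral>s. P s * A s \<partial>circ) + \<epsilon> * (\<integral>s. Q s * A s \<partial>circ) \<le> C * (\<integral>s. \<bar>A s\<bar> \<partial>circ)"
      unfolding A_def by (rule truncation_test[OF P Q K sgnK orthK M0 C])
    have 2: "b * (\<integral>s. Q s * B s \<partial>circ) + \<epsilon> * (\<integral>s. P s * B s \<partial>circ) \<le> C * (\<integral>s. \<bar>B s\<bar> \<partial>circ)"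
      unfolding B_def by (rule truncation_test[OF Q P L sgnL orthL M0 C])
    have self: "P s * A s = \<bar>P s\<bar> * \<bar>A s\<bar>" "Q s * B s = \<bar>Q s\<bar> * \<bar>B s\<bar>" for s
      using cutoff_mult_self[OF M0] by (auto simp: A_def B_def)
    have S_eq: "S = (\<integral>s. P s * A s \<partial>circ) + (\<integral>s. Q s * B s \<partial>circ)"
      using aprods unfolding S_def self by simp
    have T_eq: "T = (\<integral>s. \<bar>A s\<bar> \<partial>circ) + (\<integral>s. \<bar>B s\<bar> \<partial>circ)"
      using AB unfolding T_def by simp
    \<comment> \<open>Cross terms: each function meets the cutoff of the other one. Rearrangement
      bounds them by S with constant 1.\<close>
    have "- (\<epsilon> * (\<integral>s. Q s * A s + P s * B s \<partial>circ)) \<le> \<bar>\<epsilon>\<bar> * \<bar>\<integral>s. Q s * A s + P s * B s \<partial>circ\<bar>"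
      using abs_ge_minus_self[of "\<epsilon> * (\<integral>s. Q s * A s + P s * B s \<partial>circ)"] by (simp only: abs_mult)
    also have "\<dots> \<le> \<bar>\<epsilon>\<bar> * (\<integral>s. \<bar>Q s * A s + P s * B s\<bar> \<partial>circ)"
      by (intro mult_left_mono integral_abs_bound) auto
    also have "(\<integral>s. \<bar>Q s * A s + P s * B s\<bar> \<partial>circ) \<le> S"
      unfolding S_def
    proof (rule integral_mono)
      fix s
      have "\<bar>Q s * A s + P s * B s\<bar> \<le> \<bar>P s\<bar> * \<bar>B s\<bar> + \<bar>Q s\<bar> * \<bar>A s\<bar>"
        using abs_triangle_ineq[of "Q s * A s" "P s * B s"] by (simp add: abs_mult)
      also have "\<dots> \<le> \<bar>P s\<bar> * \<bar>A s\<bar> + \<bar>Q s\<bar> * \<bar>B s\<bar>"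
        unfolding A_def B_def by (rule cutoff_rearrangement)
      finally show "\<bar>Q s * A s + P s * B s\<bar> \<le> \<bar>P s\<bar> * \<bar>A s\<bar> + \<bar>Q s\<bar> * \<bar>B s\<bar>" .
    qed (use prods aprods in auto)
    finally have cross: "- (\<epsilon> * (\<integral>s. Q s * A s + P s * B s \<partial>circ)) \<le> \<bar>\<epsilon>\<bar> * S"
      by (simp add: mult_left_mono)
    have "b * S \<le> C * T + \<bar>\<epsilon>\<bar> * S"
      using 1 2 cross prods unfolding S_eq T_eq by (simp add: algebra_simps)
    moreover have MT: "M * T \<le> S"
    proof -
      have "M * T = (\<integral>s. M * (\<bar>A s\<bar> + \<bar>B s\<bar>) \<partial>circ)" by (simp add: T_def)
      also have "\<dots> \<le> S"
        unfolding S_def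
      proof (rule integral_mono)
        fix s show "M * (\<bar>A s\<bar> + \<bar>B s\<bar>) \<le> \<bar>P s\<bar> * \<bar>A s\<bar> + \<bar>Q s\<bar> * \<bar>B s\<bar>"
          using cutoff_ge[of M "P s"] cutoff_ge[of M "Q s"] by (simp add: A_def B_def algebra_simps)
      qed (use AB aprods in auto)
      finally show ?thesis .
    qed
    then have "(b - \<bar>\<epsilon>\<bar>) * (M * T) \<le> (b - \<bar>\<epsilon>\<bar>) * S"
      using b by (intro mult_left_mono) auto
    ultimately have "((b - \<bar>\<epsilon>\<bar>) * M - C) * T \<le> 0"
      by (simp add: algebra_simps)
    moreover have "(b - \<bar>\<epsilon>\<bar>) * M - C > 0"
      using M b by (simp add: field_simps)
    ultimately have "T \<le> 0" by (simp add: mult_le_0_iff)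
    moreover have "T \<ge> 0" unfolding T_def by (intro integral_nonneg_AE) auto
    ultimately have "T = 0" by simp
    then have "AE s in circ. \<bar>A s\<bar> + \<bar>B s\<bar> = 0"
      unfolding T_def using AB by (subst (asm) integral_nonneg_eq_0_iff_AE) auto
    then show ?thesis
      by (rule eventually_mono) (use M0 in \<open>auto simp: A_def B_def cutoff_def sgn_if split: if_splits\<close>)
  qed
  \<comment> \<open>M decreases to \<open>?c\<close> along a sequence, so only countably many null
    sets are discarded.\<close>
  have "AE s in circ. \<forall>n::nat. \<bar>P s\<bar> \<le> ?c + inverse (of_nat (Suc n)) \<and> \<bar>Q s\<bar> \<le> ?c + inverse (of_nat (Suc n))"
    unfolding AE_all_countable by (intro allI main) simp
  then show ?thesis
  proof (rule eventually_mono)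
    fix s assume *: "\<forall>n::nat. \<bar>P s\<bar> \<le> ?c + inverse (of_nat (Suc n)) \<and> \<bar>Q s\<bar> \<le> ?c + inverse (of_nat (Suc n))"
    have lim: "(\<lambda>n. ?c + inverse (of_nat (Suc n))) \<longlonglongrightarrow> ?c"
      using LIMSEQ_inverse_real_of_nat_add by simp
    show "\<bar>P s\<bar> \<le> ?c \<and> \<bar>Q s\<bar> \<le> ?c"
      using * by (auto intro!: LIMSEQ_le_const[OF lim])
  qed
qed

section \<open>From almost everywhere moduli to continuous representatives\<close>

lemma AE_lborel_shift:
  fixes c :: real
  assumes [measurable]: "Measurable.pred borel P" and P: "AE t in lborel. P t"
  shows "AE t in lborel. P (t + c)"
proof -
  have "AE t in distr lborel borel ((+) c). P t" using P by (simp only: lborel_distr_plus)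
  then show ?thesis by (subst (asm) AE_distr_iff) (auto simp: add.commute)
qed

lemma AE_lborel_reflect:
  assumes [measurable]: "Measurable.pred borel P" and P: "AE t in lborel. P (t::real)"
  shows "AE t in lborel. P (c - t)"
proof -
  have "AE t in distr lborel borel uminus. P (t + c)"
    using AE_lborel_shift[OF assms, of c] by (simp only: lborel_distr_uminus)
  then show ?thesis by (subst (asm) AE_distr_iff) auto
qed

lemma AE_circ_imp_lborel:
  assumes [measurable]: "Measurable.pred borel P" and per: "periodic P" and P: "AE t in circ. P t"
  shows "AE t in lborel. P t"
proof -
  let ?P = "\<lambda>t (n::int). t + of_int n * (2 * pi) \<in> {0<..2*pi} \<longrightarrow> P (t + of_int n * (2 * pi))"
  have [measurable]: "Measurable.pred borel (\<lambda>t::real. t \<in> {0<..2*pi} \<longrightarrow> P t)" by measurable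
  have "AE t in lborel. t \<in> {0<..2*pi} \<longrightarrow> P t" using P by (simp only: AE_seg)
  then have "AE t in lborel. ?P t n" for n :: int
    by (intro AE_lborel_shift[where P="\<lambda>t. t \<in> {0<..2*pi} \<longrightarrow> P t"]) measurable
  then have "AE t in lborel. \<forall>n::int. ?P t n"
    unfolding AE_all_countable by blast
  then show ?thesis
  proof (rule eventually_mono)
    fix t assume *: "\<forall>n::int. ?P t n"
    \<comment> \<open>The ceiling rather than the floor, because the fundamental interval is open at
      0 and closed at \<open>2 * pi\<close>.\<close>
    define n where "n = 1 - \<lceil>t / (2 * pi)\<rceil>"
    have "t \<le> of_int \<lceil>t / (2 * pi)\<rceil> * (2 * pi)" "of_int \<lceil>t / (2 * pi)\<rceil> * (2 * pi) < t + 2 * pi"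
      using ceiling_divide_upper[of "2 * pi" t] ceiling_divide_lower[of "2 * pi" t]
      by (auto simp: algebra_simps)
    then have "t + of_int n * (2 * pi) \<in> {0<..2*pi}" by (auto simp: n_def algebra_simps)
    then show "P t" using * periodic_add_int[OF per, of t n] by blast
  qed
qed

lemma AE_lborel_interval:
  fixes a c :: real
  assumes "AE r in lborel. P r" "a < c"
  obtains r where "a < r" "r < c" "P r"
proof (rule ccontr)
  assume "\<not> thesis"
  then have "AE r in lborel. r \<notin> {a<..<c}" using assms(1) that by (auto elim!: eventually_mono)
  then have "emeasure lborel {a<..<c} = 0" by (subst (asm) AE_iff_measurable[of "{a<..<c}"]) auto
  then show False using assms(2) by simp
qed

text \<open>The null set in the hypothesis depends on \<tau>, so no single s need be good for all
  shifts. Fubini exchanges the quantifiers: almost every s is good for almost every nearby point,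
  and p is uniformly continuous on the set \<open>D\<close> of these s.\<close>

lemma essentially_uniformly_continuous:
  assumes [measurable]: "p \<in> borel_measurable borel" and per: "periodic p"
    and uc: "\<And>\<eta>. \<eta> > 0 \<Longrightarrow> \<exists>\<delta>>0. \<forall>\<tau>. \<bar>\<tau>\<bar> < \<delta> \<longrightarrow> (AE s in circ. \<bar>p (s + \<tau>) - p s\<bar> \<le> \<eta>)"
  shows "\<exists>g. continuous_on UNIV g \<and> (AE s in lborel. p s = (g s :: real))"
proof -
  let ?r = "\<lambda>n. inverse (of_nat (Suc n))"
  have "\<exists>\<delta>>0. \<forall>\<tau>. \<bar>\<tau>\<bar> < \<delta> \<longrightarrow> (AE s in lborel. \<bar>p (s + \<tau>) - p s\<bar> \<le> \<eta>)" if \<eta>: "\<eta> > 0" for \<eta>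
  proof -
    have "periodic (\<lambda>s. \<bar>p (s + \<tau>) - p s\<bar> \<le> \<eta>)" for \<tau>
      using per[unfolded periodic_def, rule_format, of "_ + \<tau>"] per
      by (simp add: periodic_def algebra_simps)
    then have imp: "AE s in lborel. \<bar>p (s + \<tau>) - p s\<bar> \<le> \<eta>" if "AE s in circ. \<bar>p (s + \<tau>) - p s\<bar> \<le> \<eta>" for \<tau>
      using that by (intro AE_circ_imp_lborel[where P="\<lambda>s. \<bar>p (s + \<tau>) - p s\<bar> \<le> \<eta>"]) auto
    show ?thesis using uc[OF \<eta>] imp by blast
  qed
  then have "\<forall>n. \<exists>\<delta>>0. \<forall>\<tau>. \<bar>\<tau>\<bar> < \<delta> \<longrightarrow> (AE s in lborel. \<bar>p (s + \<tau>) - p s\<bar> \<le> ?r n)"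
    by simp
  then obtain \<delta> where \<delta>: "\<And>n. \<delta> n > 0"
    and ae: "\<And>n \<tau>. \<bar>\<tau>\<bar> < \<delta> n \<Longrightarrow> AE s in lborel. \<bar>p (s + \<tau>) - p s\<bar> \<le> ?r n"
    by metis
  define D where "D = {s. \<forall>n. AE r in lborel. \<bar>r - s\<bar> < \<delta> n \<longrightarrow> \<bar>p r - p s\<bar> \<le> ?r n}"
  have aeD: "AE s in lborel. s \<in> D"
  proof -
    have "AE s in lborel. AE \<tau> in lborel. \<bar>\<tau>\<bar> < \<delta> n \<longrightarrow> \<bar>p (s + \<tau>) - p s\<bar> \<le> ?r n" for n
    proof -
      have "AE \<tau> in lborel. AE s in lborel. \<bar>\<tau>\<bar> < \<delta> n \<longrightarrow> \<bar>p (s + \<tau>) - p s\<bar> \<le> ?r n"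
      proof (rule always_eventually, rule allI)
        fix \<tau> show "AE s in lborel. \<bar>\<tau>\<bar> < \<delta> n \<longrightarrow> \<bar>p (s + \<tau>) - p s\<bar> \<le> ?r n"
          using ae[of \<tau> n] by (cases "\<bar>\<tau>\<bar> < \<delta> n") simp_all
      qed
      then show ?thesis
        by (subst (asm) lborel_pair.AE_commute) measurable
    qed
    then have "AE s in lborel. \<forall>n. AE \<tau> in lborel. \<bar>\<tau>\<bar> < \<delta> n \<longrightarrow> \<bar>p (s + \<tau>) - p s\<bar> \<le> ?r n"
      unfolding AE_all_countable by blast
    then show ?thesis
    proof (rule eventually_mono)
      fix s assume *: "\<forall>n. AE \<tau> in lborel. \<bar>\<tau>\<bar> < \<delta> n \<longrightarrow> \<bar>p (s + \<tau>) - p s\<bar> \<le> ?r n"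
      have "AE r in lborel. \<bar>r - s\<bar> < \<delta> n \<longrightarrow> \<bar>p r - p s\<bar> \<le> ?r n" for n
        using AE_lborel_shift[OF _ *[rule_format, of n], of "- s"] by simp
      then show "s \<in> D" by (simp add: D_def)
    qed
  qed
  \<comment> \<open>Two points of \<open>D\<close> closer than \<open>\<delta> n\<close> share an
    interval of neighbours of positive length, hence a neighbour r good for both. Passing through r
    costs the factor 2.\<close>
  have close: "\<bar>p s - p s'\<bar> \<le> 2 * ?r n" if "s \<in> D" "s' \<in> D" "\<bar>s - s'\<bar> < \<delta> n" for s s' n
  proof -
    have "AE r in lborel. (\<bar>r - s\<bar> < \<delta> n \<longrightarrow> \<bar>p r - p s\<bar> \<le> ?r n)
        \<and> (\<bar>r - s'\<bar> < \<delta> n \<longrightarrow> \<bar>p r - p s'\<bar> \<le> ?r n)"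
      using that(1,2) by (simp add: D_def)
    moreover have "max s s' - \<delta> n < min s s' + \<delta> n" using that(3) \<delta>[of n] by linarith
    ultimately obtain r where r: "max s s' - \<delta> n < r" "r < min s s' + \<delta> n"
      "(\<bar>r - s\<bar> < \<delta> n \<longrightarrow> \<bar>p r - p s\<bar> \<le> ?r n)
        \<and> (\<bar>r - s'\<bar> < \<delta> n \<longrightarrow> \<bar>p r - p s'\<bar> \<le> ?r n)"
      by (rule AE_lborel_interval)
    then have "\<bar>r - s\<bar> < \<delta> n" "\<bar>r - s'\<bar> < \<delta> n" by linarith+
    then show ?thesis using r(3) by linarith
  qed
  have "uniformly_continuous_on D p"
    unfolding uniformly_continuous_on_def
  proof (intro allI impI)
    fix e :: real assume "e > 0"
    then obtain n where n: "?r n < e / 2" using reals_Archimedean[of "e / 2"] by auto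
    show "\<exists>d>0. \<forall>x\<in>D. \<forall>x'\<in>D. dist x' x < d \<longrightarrow> dist (p x') (p x) < e"
    proof (intro exI[of _ "\<delta> n"] conjI ballI impI)
      fix x x' assume "x \<in> D" "x' \<in> D" "dist x' x < \<delta> n"
      then show "dist (p x') (p x) < e" using close[of x' x n] n by (auto simp: dist_real_def)
    qed (rule \<delta>)
  qed
  then obtain g where g: "uniformly_continuous_on (closure D) g" "\<And>x. x \<in> D \<Longrightarrow> p x = g x"
    by (rule uniformly_continuous_on_extension_on_closure) blast
  \<comment> \<open>A set of full measure meets every interval, so the extension from
    \<open>closure D\<close> lives on the whole line.\<close>
  have "closure D = UNIV"
  proof (intro set_eqI iffI)
    fix s :: real
    show "s \<in> closure D"
      unfolding closure_approachable
    proof (intro allI impI)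
      fix e :: real assume "e > 0"
      then obtain r where "s - e < r" "r < s + e" "r \<in> D" using AE_lborel_interval[OF aeD, of "s - e" "s + e"] by auto
      then show "\<exists>y\<in>D. dist y s < e" by (intro bexI[of _ r]) (auto simp: dist_real_def)
    qed
  qed simp
  then have "continuous_on UNIV g" using g(1) uniformly_continuous_imp_continuous by auto
  moreover have "AE s in lborel. p s = g s" using aeD by (rule eventually_mono) (use g(2) in auto)
  ultimately show ?thesis by blast
qed

text \<open>For fixed t the maps sending x to t + x and to t - x preserve null sets, so the
  exceptional set is null on every slice.\<close>

lemma AE_wave_cong:
  assumes [measurable]: "p \<in> borel_measurable borel" "g \<in> borel_measurable borel"
    and eq: "AE s in lborel. p s = g s"
  shows "AE z in cyl. wave p z = wave g z"
proof (rule seg_pair.AE_pair_measure)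
  show "AE t in circ. AE x in seg 0 pi. wave p (t, x) = wave g (t, x)"
  proof (rule always_eventually, rule allI)
    fix t
    have "AE x in lborel. p (x + t) = g (x + t)" "AE x in lborel. p (t - x) = g (t - x)"
      using AE_lborel_shift[OF _ eq, of t] AE_lborel_reflect[OF _ eq, of t] by auto
    then show "AE x in seg 0 pi. wave p (t, x) = wave g (t, x)"
      unfolding AE_seg by eventually_elim (simp add: wave_def add.commute)
  qed
qed measurable

section \<open>Uniqueness of Fourier coefficients\<close>

lemma AE_cyl_interior: "AE z in cyl. fst z \<in> {0<..<2*pi} \<and> snd z \<in> {0<..<pi}"
proof (rule seg_pair.AE_pair_measure)
  show "AE t in circ. AE x in seg 0 pi. fst (t, x) \<in> {0<..<2 * pi} \<and> snd (t, x) \<in> {0<..<pi}"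
  proof -
    have t: "AE t in circ. t \<in> {0<..<2*pi}"
      unfolding AE_seg using AE_lborel_singleton[of "2*pi"] by eventually_elim auto
    have x: "AE x in seg 0 pi. x \<in> {0<..<pi}"
      unfolding AE_seg using AE_lborel_singleton[of pi] by eventually_elim auto
    show ?thesis
      by (rule eventually_mono[OF t], rule eventually_mono[OF x]) auto
  qed
qed measurable

text \<open>The coefficient integral without the factor 1 / pi^2. The index j is an integer so that
  product-to-sum formulas need no case distinction; for j <= 0 oddness of the sine determines the
  value.\<close>

definition cf :: "(real \<times> real \<Rightarrow> real) \<Rightarrow> int \<Rightarrow> int \<Rightarrow> complex" where
  "cf F j k = (\<integral>z. of_real (F z * sin (of_int j * snd z)) * cis (- (of_int k * fst z)) \<partial>cyl)"

lemma cis_measurable [measurable]: "cis \<in> borel_measurable borel"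
  by (intro borel_measurable_continuous_onI continuous_intros)

lemma integrable_cf:
  assumes "integrable cyl F"
  shows "integrable cyl (\<lambda>z. of_real (F z * sin (of_int j * snd z)) * cis (- (of_int k * fst z)))"
  by (intro integrable_mult_bounded[where B=1] integrable_of_real assms) (auto simp: norm_mult)

lemma cf_uminus: "cf F (- j) k = - cf F j k"
  by (simp add: cf_def flip: integral_minus)

lemma cf_zero: "cf F 0 k = 0"
  by (simp add: cf_def)

text \<open>Cosines in x, because products of cosines are again sums of cosines, whereas products of
  sines leave the span of the sines.\<close>

inductive_set trig_polys :: "(real \<times> real \<Rightarrow> complex) set" where
  basis: "(\<lambda>z. of_real (cos (of_int j * snd z)) * cis (- (of_int k * fst z))) \<in> trig_polys"
| add: "\<phi> \<in> trig_polys \<Longrightarrow> \<psi> \<in> trig_polys \<Longrightarrow> (\<lambda>z. \<phi> z + \<psi> z) \<in> trig_polys"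
| scale: "\<phi> \<in> trig_polys \<Longrightarrow> (\<lambda>z. c * \<phi> z) \<in> trig_polys"

lemma trig_polys_mult:
  assumes "\<phi> \<in> trig_polys" "\<psi> \<in> trig_polys"
  shows "(\<lambda>z. \<phi> z * \<psi> z) \<in> trig_polys"
  using assms(1)
proof induction
  case (basis j k)
  from assms(2) show ?case
  proof induction
    case (basis j' k')
    have eq: "(\<lambda>z. of_real (cos (of_int j * snd z)) * cis (- (of_int k * fst z)) *
          (of_real (cos (of_int j' * snd z)) * cis (- (of_int k' * fst z))))
      = (\<lambda>z. (1/2) * (of_real (cos (of_int (j - j') * snd z)) * cis (- (of_int (k + k') * fst z))
          + of_real (cos (of_int (j + j') * snd z)) * cis (- (of_int (k + k') * fst z))))"
      (is "?l = ?r")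
    proof
      fix z :: "real \<times> real"
      have c: "cis (- (of_int (k + k') * fst z)) = cis (- (of_int k * fst z)) * cis (- (of_int k' * fst z))"
        by (simp add: cis_mult algebra_simps)
      have "complex_of_real (cos (of_int j * snd z)) * complex_of_real (cos (of_int j' * snd z))
         = (1/2) * (complex_of_real (cos (of_int (j - j') * snd z)) + complex_of_real (cos (of_int (j + j') * snd z)))"
        by (simp add: left_diff_distrib distrib_right cos_diff cos_add)
      then show "?l z = ?r z" unfolding c
        by (simp add: algebra_simps)
    qed
    show ?case unfolding eq by (intro trig_polys.scale trig_polys.add trig_polys.basis)
  next
    case (add \<phi> \<psi>)
    then show ?case by (simp add: distrib_left trig_polys.add)
  next
    case (scale \<phi> c)
    have "(\<lambda>z. of_real (cos (of_int j * snd z)) * cis (- (of_int k * fst z)) * (c * \<phi> z))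
      = (\<lambda>z. c * (of_real (cos (of_int j * snd z)) * cis (- (of_int k * fst z)) * \<phi> z))"
      by (simp add: ac_simps)
    then show ?case using trig_polys.scale[OF scale.IH, of c] by simp
  qed
next
  case (add \<phi> \<phi>')
  then show ?case by (simp add: distrib_right trig_polys.add)
next
  case (scale \<phi> c)
  then show ?case by (simp add: mult.assoc trig_polys.scale)
qed

text \<open>Up to a null set \<open>chart\<close> is injective on \<open>\<Omega>\<close>, and polynomials in its components are trigonometric polynomials.\<close>

definition chart :: "real \<times> real \<Rightarrow> real \<times> real \<times> real" where
  "chart z = (cos (fst z), sin (fst z), cos (snd z))"

lemma trig_polys_chart:
  assumes "real_polynomial_function q"
  shows "(\<lambda>z. complex_of_real (q (chart z))) \<in> trig_polys"
  using assms
proof induction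
  case (linear f)
  interpret bounded_linear f by fact
  have f: "f (a, b, c) = a * f (1, 0, 0) + b * f (0, 1, 0) + c * f (0, 0, 1)" for a b c
    using add[of "(a, 0, 0)" "(0, b, c)"] add[of "(0, b, 0)" "(0, 0, c)"]
      scaleR[of a "(1, 0, 0)"] scaleR[of b "(0, 1, 0)"] scaleR[of c "(0, 0, 1)"] by simp
  have cos_t: "(\<lambda>z::real \<times> real. (1/2) * (of_real (cos (of_int 0 * snd z)) * cis (- (of_int 1 * fst z))
     + of_real (cos (of_int 0 * snd z)) * cis (- (of_int (- 1) * fst z)))) \<in> trig_polys"
    (is "?c \<in> _") by (intro trig_polys.intros)
  have sin_t: "(\<lambda>z::real \<times> real. (\<i>/2) * (of_real (cos (of_int 0 * snd z)) * cis (- (of_int 1 * fst z))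
     + (- 1) * (of_real (cos (of_int 0 * snd z)) * cis (- (of_int (- 1) * fst z))))) \<in> trig_polys"
    (is "?s \<in> _") by (intro trig_polys.intros)
  have cos_x: "(\<lambda>z::real \<times> real. of_real (cos (of_int 1 * snd z)) * cis (- (of_int 0 * fst z))) \<in> trig_polys"
    (is "?x \<in> _") by (intro trig_polys.intros)
  have eq: "?c z = complex_of_real (cos (fst z))" "?s z = complex_of_real (sin (fst z))" "?x z = complex_of_real (cos (snd z))" for z
    by (simp_all add: complex_eq_iff)
  have "(\<lambda>z. complex_of_real (f (1, 0, 0)) * ?c z + (complex_of_real (f (0, 1, 0)) * ?s z + complex_of_real (f (0, 0, 1)) * ?x z)) \<in> trig_polys"
    by (rule trig_polys.add[OF trig_polys.scale[OF cos_t] trig_polys.add[OF trig_polys.scale[OF sin_t] trig_polys.scale[OF cos_x]]])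
  moreover have "f (chart z) = cos (fst z) * f (1, 0, 0) + sin (fst z) * f (0, 1, 0) + cos (snd z) * f (0, 0, 1)" for z
    unfolding chart_def by (rule f)
  ultimately show ?case
    unfolding eq by (simp add: ac_simps)
next
  case (const c)
  have "(\<lambda>z::real \<times> real. complex_of_real c * (of_real (cos (of_int 0 * snd z)) * cis (- (of_int 0 * fst z)))) \<in> trig_polys"
    by (intro trig_polys.intros)
  then show ?case by simp
next
  case (add f g)
  then show ?case by (simp add: trig_polys.add)
next
  case (mult f g)
  then show ?case by (simp add: trig_polys_mult)
qed

context
  fixes F :: "real \<times> real \<Rightarrow> real"
  assumes F: "integrable cyl F" and coeff: "\<And>j k. j \<ge> 1 \<Longrightarrow> cf F j k = 0"
begin

lemma coeff_zero: "cf F j k = 0"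
proof -
  consider "j \<ge> 1" | "j = 0" | "- j \<ge> 1" by linarith
  then show ?thesis
  proof cases
    case 3
    then show ?thesis using coeff[of "- j" k] by (simp add: cf_uminus)
  qed (use coeff cf_zero in auto)
qed

lemma integrable_weighted: "integrable cyl (\<lambda>z. F z * sin (snd z))"
  by (intro integrable_mult_bounded[where B=1] F) auto

text \<open>The factor \<open>sin x\<close> turns the sine coefficients of \<open>F\<close> into cosine coefficients, to which
  the algebra \<open>trig_polys\<close> applies.\<close>

lemma trig_polys_orthogonal:
  assumes "\<phi> \<in> trig_polys"
  shows "integrable cyl (\<lambda>z. complex_of_real (F z * sin (snd z)) * \<phi> z) \<and>
     (\<integral>z. complex_of_real (F z * sin (snd z)) * \<phi> z \<partial>cyl) = 0"
  using assms
proof induction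
  case (basis j k)
  have eq: "(\<lambda>z. of_real (F z * sin (snd z)) * (of_real (cos (of_int j * snd z)) * cis (- (of_int k * fst z))))
    = (\<lambda>z. (of_real (F z * sin (of_int (1 + j) * snd z)) * cis (- (of_int k * fst z)) +
           of_real (F z * sin (of_int (1 - j) * snd z)) * cis (- (of_int k * fst z))) / 2)"
  proof
    fix z :: "real \<times> real"
    have "sin (of_int (1 + j) * snd z) + sin (of_int (1 - j) * snd z) = 2 * sin (snd z) * cos (of_int j * snd z)"
      by (simp add: left_diff_distrib distrib_right sin_add sin_diff)
    then have "F z * sin (of_int (1 + j) * snd z) + F z * sin (of_int (1 - j) * snd z)
       = 2 * (F z * sin (snd z) * cos (of_int j * snd z))"
      by (simp flip: distrib_left)
    from arg_cong[OF this, of complex_of_real]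
    have "complex_of_real (F z * sin (of_int (1 + j) * snd z)) + complex_of_real (F z * sin (of_int (1 - j) * snd z))
       = 2 * (complex_of_real (F z * sin (snd z)) * complex_of_real (cos (of_int j * snd z)))"
      by simp
    then show "of_real (F z * sin (snd z)) * (of_real (cos (of_int j * snd z)) * cis (- (of_int k * fst z)))
       = (of_real (F z * sin (of_int (1 + j) * snd z)) * cis (- (of_int k * fst z)) +
           of_real (F z * sin (of_int (1 - j) * snd z)) * cis (- (of_int k * fst z))) / 2"
      by (simp flip: distrib_right)
  qed
  have "has_bochner_integral cyl (\<lambda>z. of_real (F z * sin (of_int i * snd z)) * cis (- (of_int k * fst z))) 0" for i
    unfolding has_bochner_integral_iff using integrable_cf[OF F] coeff_zero[of i k] unfolding cf_def by blast
  from has_bochner_integral_divide_zero[OF has_bochner_integral_add[OF this[of "1 + j"] this[of "1 - j"]], of 2]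
  show ?case
    unfolding eq has_bochner_integral_iff by simp
next
  case (add \<phi> \<psi>)
  then show ?case by (simp add: distrib_left)
next
  case (scale \<phi> c)
  have eq: "(\<lambda>z. complex_of_real (F z * sin (snd z)) * (c * \<phi> z)) = (\<lambda>z. c * (complex_of_real (F z * sin (snd z)) * \<phi> z))"
    by (simp add: ac_simps)
  show ?case unfolding eq using scale by simp
qed

lemma chart_measurable [measurable]: "chart \<in> borel_measurable borel2"
  unfolding chart_def[abs_def] borel_prod
  by (intro borel_measurable_continuous_onI continuous_intros)

text \<open>Stone-Weierstrass on a cube that contains the range of \<open>chart\<close>. The
  approximation is uniform, which suffices against an integrable F.\<close>

lemma continuous_orthogonal:
  assumes c: "continuous_on UNIV c" and B: "\<And>y. \<bar>c y\<bar> \<le> B"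
  shows "(\<integral>z. F z * sin (snd z) * c (chart z) \<partial>cyl) = 0"
proof -
  let ?F = "\<lambda>z. F z * sin (snd z)"
  have [measurable]: "c \<in> borel_measurable borel"
    using c by (rule borel_measurable_continuous_onI)
  have intc: "integrable cyl (\<lambda>z. ?F z * c (chart z))"
    by (rule integrable_mult_bounded[OF integrable_weighted, of _ B]) (use B in auto)
  define I where "I = (\<integral>z. \<bar>?F z\<bar> \<partial>cyl)"
  have I: "I \<ge> 0" unfolding I_def by (intro integral_nonneg_AE) auto
  have "\<bar>\<integral>z. ?F z * c (chart z) \<partial>cyl\<bar> \<le> 0 + e" if e: "e > 0" for e
  proof -
    have "compact (cbox (-1, -1, -1) (1::real, 1::real, 1::real))" by (rule compact_cbox)
    moreover have "continuous_on (cbox (-1, -1, -1) (1::real, 1::real, 1::real)) c"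
      using c continuous_on_subset by blast
    \<comment> \<open>\<open>I + 1\<close> instead of \<open>I\<close> avoids a division by 0 when
      the weighted function is null.\<close>
    moreover have "e / (I + 1) > 0" using e I by simp
    ultimately obtain q where q: "real_polynomial_function q"
      and close: "\<And>y. y \<in> cbox (-1, -1, -1) (1::real, 1::real, 1::real) \<Longrightarrow> \<bar>c y - q y\<bar> < e / (I + 1)"
      by (rule Stone_Weierstrass_real_polynomial_function) blast
    have near: "\<bar>c (chart z) - q (chart z)\<bar> \<le> e / (I + 1)" for z
      using close[of "chart z"] by (fastforce simp: chart_def cbox_Pair_eq)
    from trig_polys_orthogonal[OF trig_polys_chart[OF q]]
    have "integrable cyl (\<lambda>z. complex_of_real (?F z * q (chart z)))"
      "(\<integral>z. complex_of_real (?F z * q (chart z)) \<partial>cyl) = 0"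
      by simp_all
    then have q0: "integrable cyl (\<lambda>z. ?F z * q (chart z))"
      "(\<integral>z. ?F z * q (chart z) \<partial>cyl) = 0"
      unfolding integral_complex_of_real complex_of_real_integrable_eq by simp_all
    have "(\<integral>z. ?F z * c (chart z) \<partial>cyl)
      = (\<integral>z. ?F z * c (chart z) - ?F z * q (chart z) \<partial>cyl)"
      using q0 intc by simp
    also have "\<bar>\<dots>\<bar> \<le> (\<integral>z. \<bar>?F z * c (chart z) - ?F z * q (chart z)\<bar> \<partial>cyl)"
      by (rule integral_abs_bound)
    also have "\<dots> \<le> (\<integral>z. \<bar>?F z\<bar> * (e / (I + 1)) \<partial>cyl)"
    proof (rule integral_mono)
      fix z
      have "\<bar>?F z * c (chart z) - ?F z * q (chart z)\<bar>
        = \<bar>?F z\<bar> * \<bar>c (chart z) - q (chart z)\<bar>"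
        by (simp flip: abs_mult right_diff_distrib)
      also have "\<dots> \<le> \<bar>?F z\<bar> * (e / (I + 1))"
        by (intro mult_left_mono near) simp
      finally show "\<bar>?F z * c (chart z) - ?F z * q (chart z)\<bar> \<le> \<bar>?F z\<bar> * (e / (I + 1))" .
    qed (use intc q0 integrable_weighted in auto)
    also have "\<dots> = I * (e / (I + 1))" by (simp add: I_def)
    also have "\<dots> \<le> e" using e I by (simp add: field_simps)
    finally show ?thesis by simp
  qed
  then have "\<bar>\<integral>z. ?F z * c (chart z) \<partial>cyl\<bar> \<le> 0" by (rule field_le_epsilon)
  then show ?thesis by simp
qed

text \<open>The indicator of a closed set is the limit of continuous functions of the distance. The
  empty set is excluded because \<open>infdist\<close> to it is 0 by convention, which would make
  every \<open>c n\<close> equal to 1.\<close>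

lemma closed_orthogonal:
  assumes A: "closed A" "A \<noteq> {}"
  shows "(\<integral>z. F z * sin (snd z) * indicator A (chart z) \<partial>cyl) = 0"
proof -
  let ?F = "\<lambda>z. F z * sin (snd z)"
  define c where "c = (\<lambda>n y. max 0 (1 - of_nat n * infdist y A))"
  have cont: "continuous_on UNIV (c n)" for n
    unfolding c_def by (intro continuous_intros)
  have [measurable]: "c n \<in> borel_measurable borel" for n
    using cont by (rule borel_measurable_continuous_onI)
  have [measurable]: "A \<in> sets borel" using A by simp
  have bd: "\<bar>c n y\<bar> \<le> 1" for n y by (simp add: c_def infdist_nonneg)
  have lim: "(\<lambda>n. c n y) \<longlonglongrightarrow> indicator A y" for y
  proof (cases "y \<in> A")
    case True
    then show ?thesis by (simp add: c_def)
  next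
    case False
    then have d: "infdist y A > 0"
      using A infdist_pos_not_in_closed by blast
    obtain N where N: "1 / infdist y A < of_nat N" using reals_Archimedean2 by blast
    have "c n y = 0" if "n \<ge> N" for n
    proof -
      have "1 / infdist y A < of_nat n" using N that by (meson of_nat_le_iff order_less_le_trans)
      then have "1 < of_nat n * infdist y A" using d by (simp add: field_simps)
      then show ?thesis by (simp add: c_def)
    qed
    then have "eventually (\<lambda>n. c n y = 0) sequentially"
      by (auto simp: eventually_sequentially)
    then show ?thesis using False by (simp add: tendsto_eventually)
  qed
  have "(\<lambda>n. \<integral>z. ?F z * c n (chart z) \<partial>cyl) \<longlonglongrightarrow> (\<integral>z. ?F z * indicator A (chart z) \<partial>cyl)"
  proof (rule integral_dominated_convergence[where w="\<lambda>z. \<bar>?F z\<bar>"])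
    show "AE z in cyl. (\<lambda>n. ?F z * c n (chart z)) \<longlonglongrightarrow> ?F z * indicator A (chart z)"
      by (intro always_eventually allI tendsto_mult lim tendsto_const)
    show "AE z in cyl. norm (?F z * c n (chart z)) \<le> \<bar>?F z\<bar>" for n
      using mult_left_mono[OF bd, of "\<bar>?F z\<bar>" for z] by (intro always_eventually allI) (simp add: abs_mult)
    show "(\<lambda>z. ?F z * c n (chart z)) \<in> borel_measurable cyl" for n
      using borel_measurable_integrable[OF integrable_weighted] by measurable
    show "(\<lambda>z. ?F z * indicator A (chart z)) \<in> borel_measurable cyl"
      using borel_measurable_integrable[OF integrable_weighted] by measurable
  qed (use integrable_weighted in auto)
  then have "(\<lambda>n. 0) \<longlonglongrightarrow> (\<integral>z. ?F z * indicator A (chart z) \<partial>cyl)"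
    using continuous_orthogonal[OF cont bd] by simp
  then show ?thesis by (simp add: LIMSEQ_const_iff)
qed

text \<open>\<open>chart\<close> maps the compact set \<open>C \<inter> Omega\<close> to a closed
  set and identifies only the edges t = 0 and t = 2 pi, so for interior points membership in C can
  be read off in the image.\<close>

lemma closed_set_integral:
  assumes C: "closed C"
  shows "(\<integral>z. indicator C z * (F z * sin (snd z)) \<partial>cyl) = 0"
proof -
  let ?F = "\<lambda>z. F z * sin (snd z)"
  define A where "A = chart ` (C \<inter> Omega)"
  have "compact Omega" unfolding Omega_def by (intro compact_Times) auto
  then have "compact (C \<inter> Omega)" by (rule closed_Int_compact[OF C])
  then have A: "closed A"
    unfolding A_def chart_def by (intro compact_imp_closed compact_continuous_image continuous_intros)
  have mem: "z \<in> C \<longleftrightarrow> chart z \<in> A" if "fst z \<in> {0<..<2*pi}" "snd z \<in> {0<..<pi}" for z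
  proof
    assume "z \<in> C"
    then show "chart z \<in> A" using that by (auto simp: A_def Omega_def mem_Times_iff)
  next
    assume "chart z \<in> A"
    then obtain z' where z': "z' \<in> C" "z' \<in> Omega" "chart z = chart z'" by (auto simp: A_def)
    then have "snd z = snd z'"
      using that cos_inj_pi[of "snd z" "snd z'"] by (auto simp: chart_def Omega_def mem_Times_iff)
    moreover have "fst z = fst z'"
    proof -
      have "cos (fst z) = cos (fst z')" "sin (fst z) = sin (fst z')" using z' by (auto simp: chart_def)
      then obtain n :: int where n: "fst z = fst z' + 2 * pi * of_int n"
        using sin_cos_eq_iff by metis
      have "fst z' \<in> {0..2*pi}" using z'(2) by (auto simp: Omega_def mem_Times_iff)
      \<comment> \<open>An interior time and a time in the closed period differ by less than one
        period, which leaves only n = 0.\<close>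
      then have "of_int n * (2 * pi) < 1 * (2 * pi)" "(-1) * (2 * pi) < of_int n * (2 * pi)"
        using that(1) n unfolding greaterThanLessThan_iff atLeastAtMost_iff mult.commute[of "of_int n"] by linarith+
      then have "of_int n < (1::real)" "(-1::real) < of_int n"
        using mult_right_less_imp_less pi_ge_zero by (metis mult_nonneg_nonneg zero_le_numeral)+
      then have "n = 0" by linarith
      then show ?thesis using n by simp
    qed
    ultimately have "z = z'" by (simp add: prod_eq_iff)
    then show "z \<in> C" using z'(1) by simp
  qed
  have [measurable]: "C \<in> sets borel2" "A \<in> sets borel"
    using C A unfolding borel_prod by auto
  have "(\<integral>z. indicator C z * ?F z \<partial>cyl) = (\<integral>z. ?F z * indicator A (chart z) \<partial>cyl)"
  proof (rule integral_cong_AE)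
    show "AE z in cyl. indicator C z * ?F z = ?F z * indicator A (chart z)"
      using AE_cyl_interior by eventually_elim (use mem in \<open>auto simp: indicator_def\<close>)
    show "(\<lambda>z. indicator C z * ?F z) \<in> borel_measurable cyl"
      "(\<lambda>z. ?F z * indicator A (chart z)) \<in> borel_measurable cyl"
      using borel_measurable_integrable[OF integrable_weighted] by measurable
  qed
  also have "\<dots> = 0" using closed_orthogonal[OF A] by (cases "A = {}") auto
  finally show ?thesis .
qed

text \<open>Dynkin's argument: closed sets are stable under intersection and generate the Borel
  sets, and the sets with vanishing integral are closed under complements and countable disjoint
  unions.\<close>

lemma borel_set_integral:
  assumes "S \<in> sets borel"
  shows "(\<integral>z. indicator S z * (F z * sin (snd z)) \<partial>cyl) = 0"
proof -
  let ?F = "\<lambda>z. F z * sin (snd z)"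
  have int: "integrable cyl (\<lambda>z. indicator S z * ?F z)" if "S \<in> sets borel" for S
  proof -
    have "S \<in> sets cyl" using that by (simp only: sets_cyl)
    from integrable_mult_indicator[OF this integrable_weighted] show ?thesis by simp
  qed
  have borel: "sets borel = sigma_sets UNIV (Collect (closed :: (real \<times> real) set \<Rightarrow> bool))"
    using borel_eq_closed by (metis sets_measure_of subset_UNIV Pow_UNIV)
  have stable: "Int_stable (Collect (closed :: (real \<times> real) set \<Rightarrow> bool))"
    by (auto simp: Int_stable_def)
  have "Collect (closed :: (real \<times> real) set \<Rightarrow> bool) \<subseteq> Pow UNIV" by simp
  from stable this assms[unfolded borel] show ?thesis
  proof (induction rule: sigma_sets_induct_disjoint)
    case (basic A)
    then show ?case using closed_set_integral by simp
  next
    case empty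
    then show ?case by simp
  next
    case (compl A)
    then have A: "A \<in> sets borel" by (simp add: borel)
    have "(\<integral>z. indicator (UNIV - A) z * ?F z \<partial>cyl)
      = (\<integral>z. indicator UNIV z * ?F z - indicator A z * ?F z \<partial>cyl)"
      by (intro Bochner_Integration.integral_cong) (auto simp: indicator_def)
    also have "\<dots> = 0"
      using int[OF A] int[of UNIV] closed_set_integral[of UNIV] compl by (subst Bochner_Integration.integral_diff) auto
    finally show ?case .
  next
    case (union A)
    then have A: "A i \<in> sets borel" for i by (auto simp: borel)
    have "(\<integral>z. indicator (\<Union>i. A i) z * ?F z \<partial>cyl) = (\<Sum>i. \<integral>z. indicator (A i) z * ?F z \<partial>cyl)"
    proof -
      have "A i \<in> sets cyl" for i using A by (simp only: sets_cyl)
      then show ?thesis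
        using lebesgue_integral_countable_add[of A cyl "\<lambda>z. F z * sin (snd z)"] A union(1) int[of "\<Union>i. A i"]
        by (auto simp: set_lebesgue_integral_def set_integrable_def disjoint_family_on_def)
    qed
    then show ?case using union by simp
  qed
qed

text \<open>All set integrals of F sin x vanish, so F sin x is null, and sin x is positive in the
  interior.\<close>

lemma uniqueness: "AE z in cyl. F z = 0"
proof -
  have "AE z in cyl. F z * sin (snd z) = 0"
  proof (rule density_unique_real[OF integrable_weighted])
    fix A assume "A \<in> sets cyl"
    then have "A \<in> sets borel" by (simp only: sets_cyl)
    from borel_set_integral[OF this]
    show "(\<integral>z\<in>A. F z * sin (snd z) \<partial>cyl) = (\<integral>z\<in>A. 0 \<partial>cyl)"
      by (simp add: set_lebesgue_integral_def)
  qed simp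
  then show ?thesis using AE_cyl_interior
    by eventually_elim (use sin_gt_zero in force)
qed

end

section \<open>The inhomogeneous wave equation with integrable right-hand side\<close>

interpretation cyl: finite_measure cyl
  by (rule finite_measure_pair_measure) (rule finite_measure_seg)+

interpretation cyl_pair: pair_sigma_finite cyl cyl
  by unfold_locales

section \<open>Resonant modes and orthogonality to the kernel\<close>

text \<open>The products of sin(k x) with cos(k t) and sin(k t) are differences of functions of t +
  x and t - x, so resonant modes are images under \<open>wave\<close> of sin(k s) and cos(k s), up
  to constants.\<close>

lemma cf_diag:
  assumes G: "integrable cyl G"
  shows "cf G k k = complex_of_real ((\<integral>z. G z * wave (\<lambda>s. sin (of_int k * s)) z \<partial>cyl) / 2)
     + \<i> * complex_of_real ((\<integral>z. G z * wave (\<lambda>s. cos (of_int k * s)) z \<partial>cyl) / 2)"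
proof -
  note [measurable] = borel_measurable_cyl[OF G]
  have bd: "norm (wave (\<lambda>s. sin (of_int k * s)) z) \<le> 2" "norm (wave (\<lambda>s. cos (of_int k * s)) z) \<le> 2" for z
    using abs_triangle_ineq4[of "sin (of_int k * (fst z + snd z))" "sin (of_int k * (fst z - snd z))"]
      abs_triangle_ineq4[of "cos (of_int k * (fst z + snd z))" "cos (of_int k * (fst z - snd z))"]
      abs_sin_le_one[of "of_int k * (fst z + snd z)"] abs_sin_le_one[of "of_int k * (fst z - snd z)"]
      abs_cos_le_one[of "of_int k * (fst z + snd z)"] abs_cos_le_one[of "of_int k * (fst z - snd z)"]
    unfolding wave_def split_beta' real_norm_def by linarith+
  have int: "integrable cyl (\<lambda>z. G z * wave (\<lambda>s. sin (of_int k * s)) z)"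
    "integrable cyl (\<lambda>z. G z * wave (\<lambda>s. cos (of_int k * s)) z)"
    by (rule integrable_mult_bounded[OF G _ bd(1)], measurable) (rule integrable_mult_bounded[OF G _ bd(2)], measurable)
  have "cf G k k = (\<integral>z. complex_of_real (G z * wave (\<lambda>s. sin (of_int k * s)) z / 2)
     + \<i> * complex_of_real (G z * wave (\<lambda>s. cos (of_int k * s)) z / 2) \<partial>cyl)"
    unfolding cf_def
    by (intro Bochner_Integration.integral_cong refl)
      (simp add: complex_eq_iff wave_def split_beta' distrib_left right_diff_distrib
        sin_add sin_diff cos_add cos_diff)
  also have "\<dots> = complex_of_real ((\<integral>z. G z * wave (\<lambda>s. sin (of_int k * s)) z \<partial>cyl) / 2)
     + \<i> * complex_of_real ((\<integral>z. G z * wave (\<lambda>s. cos (of_int k * s)) z \<partial>cyl) / 2)"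
    using int by (subst Bochner_Integration.integral_add) (auto simp del: of_real_mult)
  finally show ?thesis .
qed

lemma periodic_trig: "periodic (\<lambda>s. sin (of_int k * s))" "periodic (\<lambda>s. cos (of_int k * s))"
  "periodic (\<lambda>s. cis (of_int k * s))"
proof -
  have "of_int k * (t + 2 * pi) = of_int k * t + 2 * pi * of_int k" for t :: real
    by (simp add: algebra_simps)
  then show "periodic (\<lambda>s. sin (of_int k * s))" "periodic (\<lambda>s. cos (of_int k * s))" "periodic (\<lambda>s. cis (of_int k * s))"
    by (simp_all add: periodic_def sin_add cos_add complex_eq_iff)
qed

lemma resonant_diagonal:
  assumes res: "\<And>j k. j \<ge> 1 \<Longrightarrow> j = \<bar>k\<bar> \<Longrightarrow> cf h j k = 0"
  shows "cf h k k = 0"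
proof -
  consider "k \<ge> 1" | "k = 0" | "- k \<ge> 1" by linarith
  then show ?thesis
  proof cases
    case 1
    then show ?thesis by (intro res) linarith+
  next
    case 2
    then show ?thesis by (simp add: cf_zero)
  next
    case 3
    then have "cf h (- k) k = 0" by (intro res) linarith+
    then show ?thesis by (simp only: cf_uminus neg_equal_0_iff_equal)
  qed
qed

text \<open>The Fourier coefficients of \<open>char_mean h\<close> are the resonant coefficients of \<open>h\<close>, hence \<open>char_mean h = 0\<close>.\<close>

lemma resonance_orthogonal:
  assumes h: "integrable cyl h" and per: "\<And>x. periodic (\<lambda>t. h (t, x))"
    and res: "\<And>j k. j \<ge> 1 \<Longrightarrow> j = \<bar>k\<bar> \<Longrightarrow> cf h j k = 0"
  shows "kernel_orthogonal h"
proof (rule kernel_orthogonalI)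
  fix \<Theta> :: "real \<Rightarrow> real" assume \<Theta>: "\<Theta> \<in> borel_measurable borel" "periodic \<Theta>" "\<And>s. \<bar>\<Theta> s\<bar> \<le> 1"
  define m where "m = char_mean h"
  have diag: "cf h k k = 0" for k
    using res by (rule resonant_diagonal)
  note dual = char_mean_dual[OF h per]
  have m: "integrable circ m" unfolding m_def using dual(1)[OF \<Theta>] .
  have zero: "(\<integral>s. m s * sin (of_int k * s) \<partial>circ) = 0" "(\<integral>s. m s * cos (of_int k * s) \<partial>circ) = 0" for k :: int
    using diag[of k] dual(3)[of "\<lambda>s. sin (of_int k * s)" 1] dual(3)[of "\<lambda>s. cos (of_int k * s)" 1]
    unfolding cf_diag[OF h] m_def by (simp_all add: periodic_trig complex_eq_iff)
  have mint: "integrable circ (\<lambda>s. m s * sin (of_int k * s))" "integrable circ (\<lambda>s. m s * cos (of_int k * s))" for k :: int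
    by (intro integrable_mult_bounded[OF m, of _ 1]; simp)+
  have mk: "(\<integral>s. of_real (m s) * cis (- (of_int k * s)) \<partial>circ) = 0" for k
  proof -
    have "(\<integral>s. of_real (m s) * cis (- (of_int k * s)) \<partial>circ)
      = (\<integral>s. complex_of_real (m s * cos (of_int k * s)) + (- \<i>) * complex_of_real (m s * sin (of_int k * s)) \<partial>circ)"
      by (intro Bochner_Integration.integral_cong refl) (simp add: complex_eq_iff)
    also have "\<dots> = 0"
      using mint[of k] zero[of k] by (subst Bochner_Integration.integral_add) (auto simp del: of_real_mult)
    finally show ?thesis .
  qed
  \<comment> \<open>m is viewed as a function on the cylinder that is constant in x, so that
    \<open>uniqueness\<close> applies; the integral over t makes all its coefficients
    vanish.\<close>
  have "integrable cyl (\<lambda>z. m (fst z))"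
    using cyl_product(1)[OF m, of "\<lambda>_. 1"] by (simp add: split_beta')
  moreover have "cf (\<lambda>z. m (fst z)) j k = 0" for j k
  proof -
    have mc: "integrable circ (\<lambda>t. of_real (m t) * cis (- (of_int k * t)))"
      by (rule integrable_mult_bounded[where B=1]) (use m in auto)
    have sc: "integrable (seg 0 pi) (\<lambda>x. complex_of_real (sin (of_int j * x)))"
      by (rule seg.integrable_const_bound[of _ 1]) auto
    have "cf (\<lambda>z. m (fst z)) j k = (\<integral>(t, x). (of_real (m t) * cis (- (of_int k * t))) * of_real (sin (of_int j * x)) \<partial>cyl)"
      unfolding cf_def by (intro Bochner_Integration.integral_cong refl) (simp add: split_beta')
    also have "\<dots> = 0" unfolding cyl_product(2)[OF mc sc] mk by simp
    finally show ?thesis .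
  qed
  ultimately have "AE z in cyl. m (fst z) = 0" by (rule uniqueness)
  have [measurable]: "m \<in> borel_measurable borel" "\<Theta> \<in> borel_measurable borel"
    using borel_measurable_integrable[OF m] \<Theta> by simp_all
  have m\<Theta>: "integrable circ (\<lambda>s. m s * \<Theta> s)"
    by (rule integrable_mult_bounded[OF m, of _ 1]) (use \<Theta> in auto)
  have "(\<integral>(t, x). (m t * \<Theta> t) * 1 \<partial>cyl) = (\<integral>z. 0 \<partial>cyl)"
    by (rule integral_cong_AE) (use \<open>AE z in cyl. m (fst z) = 0\<close> in \<open>auto simp: split_beta' elim!: eventually_mono\<close>)
  then have "(\<integral>s. m s * \<Theta> s \<partial>circ) * pi = 0"
    using cyl_product(2)[OF m\<Theta>, of "\<lambda>_. 1"] by (simp add: measure_seg)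
  then show "(\<integral>z. h z * wave \<Theta> z \<partial>cyl) = 0" using dual(3)[OF \<Theta>] by (simp add: m_def)
qed

section \<open>The Duhamel integral and its continuity\<close>

text \<open>For \<open>0 \<le> r \<le> \<pi>\<close> the condition \<open>cos r \<le> cos s\<close> says that \<open>s\<close> has distance at most \<open>r\<close> to \<open>2\<pi>\<int>\<close>, so
  \<open>cone z\<close> is the indicator of the characteristic triangle between \<open>z\<close> and the line \<open>x = 0\<close>, wrapped
  around the cylinder.\<close>

definition cone :: "real \<times> real \<Rightarrow> real \<times> real \<Rightarrow> real" where
  "cone z w = (if snd w \<le> snd z \<and> cos (snd z - snd w) \<le> cos (fst w - fst z) then 1 else 0)"

text \<open>Here x plays the role of time: with zero Cauchy data on x = 0, half of this integral
  formally solves U_xx - U_tt = h.\<close>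

definition duhamel :: "(real \<times> real \<Rightarrow> real) \<Rightarrow> real \<times> real \<Rightarrow> real" where
  "duhamel h z = (\<integral>w. h w * cone z w \<partial>cyl)"

text \<open>On a slice of fixed t the boundary consists of countably many x, since cos a = cos b
  forces a = b or a = - b modulo 2 pi.\<close>

lemma AE_cone_boundary: "AE w in cyl. snd w \<noteq> snd z \<and> cos (snd z - snd w) \<noteq> cos (fst w - fst z)"
proof (rule seg_pair.AE_pair_measure)
  show "AE t in circ. AE x in seg 0 pi. snd (t, x) \<noteq> snd z \<and> cos (snd z - snd (t, x)) \<noteq> cos (fst (t, x) - fst z)"
  proof (rule always_eventually, rule allI)
    fix t
    define N where "N = range (\<lambda>n::int. snd z - ((t - fst z) + 2 * of_int n * pi)) \<union> range (\<lambda>n::int. snd z - (- (t - fst z) + 2 * of_int n * pi)) \<union> {snd z}"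
    have "countable N" unfolding N_def by auto
    then have "AE x in lborel. x \<notin> N" by (intro AE_not_in countable_imp_null_set_lborel)
    then show "AE x in seg 0 pi. snd (t, x) \<noteq> snd z \<and> cos (snd z - snd (t, x)) \<noteq> cos (fst (t, x) - fst z)"
      unfolding AE_seg
    proof (rule eventually_mono, intro impI)
      fix x assume x: "x \<notin> N"
      have "cos (snd z - x) \<noteq> cos (t - fst z)"
      proof
        assume "cos (snd z - x) = cos (t - fst z)"
        then obtain n where "n \<in> \<int>" "snd z - x = (t - fst z) + 2 * n * pi \<or> snd z - x = - (t - fst z) + 2 * n * pi"
          unfolding cos_eq by blast
        then obtain i :: int where i: "snd z - x = (t - fst z) + 2 * of_int i * pi \<or> snd z - x = - (t - fst z) + 2 * of_int i * pi"
          by (auto elim: Ints_cases)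
        then have "x = snd z - ((t - fst z) + 2 * of_int i * pi) \<or> x = snd z - (- (t - fst z) + 2 * of_int i * pi)"
          by (auto simp: algebra_simps)
        then show False using x unfolding N_def by blast
      qed
      then show "snd (t, x) \<noteq> snd z \<and> cos (snd z - snd (t, x)) \<noteq> cos (fst (t, x) - fst z)"
        using x by (auto simp: N_def)
    qed
  qed
qed measurable

lemma cone_measurable [measurable]:
  "(\<lambda>p. cone (fst p) (snd p)) \<in> borel_measurable (borel2 \<Otimes>\<^sub>M borel2)"
  "(\<lambda>p. cone (snd p) (fst p)) \<in> borel_measurable (borel2 \<Otimes>\<^sub>M borel2)"
  unfolding cone_def by measurable

lemma cone_measurable' [measurable]: "cone z \<in> borel_measurable borel2"
  unfolding cone_def by measurable

text \<open>For w off the boundary of the cone, \<open>cone (zs n) w\<close> is eventually constant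
  in n, and |h| dominates.\<close>

lemma duhamel_continuous:
  assumes h: "integrable cyl h"
  shows "continuous_on UNIV (duhamel h)"
proof (rule continuous_at_imp_continuous_on, rule ballI, unfold continuous_at_sequentially, intro allI impI)
  fix z :: "real \<times> real" and zs assume zs: "zs \<longlonglongrightarrow> z"
  note [measurable] = borel_measurable_cyl[OF h]
  show "(duhamel h \<circ> zs) \<longlonglongrightarrow> duhamel h z"
    unfolding duhamel_def comp_def
  proof (rule integral_dominated_convergence[where w="\<lambda>w. \<bar>h w\<bar>"])
    show "AE w in cyl. (\<lambda>n. h w * cone (zs n) w) \<longlonglongrightarrow> h w * cone z w"
      using AE_cone_boundary[of z]
    proof eventually_elim
      case (elim w)
      have l1: "(\<lambda>n. snd (zs n) - snd w) \<longlonglongrightarrow> snd z - snd w"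
        by (intro tendsto_intros zs)
      have l2: "(\<lambda>n. cos (fst w - fst (zs n)) - cos (snd (zs n) - snd w)) \<longlonglongrightarrow> cos (fst w - fst z) - cos (snd z - snd w)"
        by (intro tendsto_intros zs)
      have e1: "eventually (\<lambda>n. (snd w \<le> snd (zs n)) = (snd w \<le> snd z)) sequentially"
      proof (cases "snd z - snd w > 0")
        case True
        from order_tendstoD(1)[OF l1 True] show ?thesis by (rule eventually_mono) (use True in auto)
      next
        case False
        then have "snd z - snd w < 0" using elim by auto
        from order_tendstoD(2)[OF l1 this] show ?thesis by (rule eventually_mono) (use False elim in auto)
      qed
      have e2: "eventually (\<lambda>n. (cos (snd (zs n) - snd w) \<le> cos (fst w - fst (zs n))) = (cos (snd z - snd w) \<le> cos (fst w - fst z))) sequentially"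
      proof (cases "cos (fst w - fst z) - cos (snd z - snd w) > 0")
        case True
        from order_tendstoD(1)[OF l2 True] show ?thesis by (rule eventually_mono) (use True in auto)
      next
        case False
        then have "cos (fst w - fst z) - cos (snd z - snd w) < 0" using elim by auto
        from order_tendstoD(2)[OF l2 this] show ?thesis by (rule eventually_mono) (use False elim in auto)
      qed
      from e1 e2 have "eventually (\<lambda>n. h w * cone (zs n) w = h w * cone z w) sequentially"
        by eventually_elim (simp add: cone_def)
      then show ?case by (rule tendsto_eventually)
    qed
    show "AE w in cyl. norm (h w * cone (zs n) w) \<le> \<bar>h w\<bar>" for n
      by (auto simp: cone_def)
  qed (use h in auto)
qed

lemma periodic_duhamel: "periodic (\<lambda>t. duhamel h (t, x))"
proof -
  have "cos (s - (t + 2 * pi)) = cos (s - t)" for s t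
    by (simp add: cos_diff sin_diff cos_add sin_add)
  then show ?thesis by (simp add: periodic_def duhamel_def cone_def)
qed

section \<open>Fourier coefficients of the Duhamel integral\<close>

lemma arc_integral:
  assumes r: "0 \<le> r" "r \<le> pi"
  shows "(\<integral>t. of_real (if cos r \<le> cos t then 1 else 0) * cis (- (of_int k * t)) \<partial>circ)
    = complex_of_real (if k = 0 then 2 * r else 2 * sin (of_int k * r) / of_int k)"
proof -
  let ?e = "\<lambda>t. cis (- (of_int k * t))"
  \<comment> \<open>The arc of half-width r around 0 appears in one period as two intervals at its
    ends. The point pi is removed because for r = pi both intervals contain it.\<close>
  have ind: "AE t in lborel. indicator {0..2*pi} t *\<^sub>R (of_real (if cos r \<le> cos t then 1 else 0) * ?e t)
    = indicator {0..r} t *\<^sub>R ?e t + indicator {2*pi-r..2*pi} t *\<^sub>R ?e t"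
    using AE_lborel_singleton[of pi]
  proof (rule eventually_mono)
    fix t :: real assume t: "t \<noteq> pi"
    have "cos r \<le> cos t \<longleftrightarrow> t \<le> r" if "0 \<le> t" "t \<le> pi"
      using cos_mono_le_eq[of r t] r that by simp
    moreover have "cos r \<le> cos t \<longleftrightarrow> 2 * pi - r \<le> t" if "pi \<le> t" "t \<le> 2 * pi"
    proof -
      have "cos t = cos (2 * pi - t)" by simp
      then show ?thesis using cos_mono_le_eq[of r "2 * pi - t"] r that by auto
    qed
    ultimately show "indicator {0..2*pi} t *\<^sub>R (of_real (if cos r \<le> cos t then 1 else 0) * ?e t)
    = indicator {0..r} t *\<^sub>R ?e t + indicator {2*pi-r..2*pi} t *\<^sub>R ?e t"
      using r t by (cases "t < pi") (auto simp: indicator_def)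
  qed
  have int: "integrable lborel (\<lambda>t. indicator {a..c} t *\<^sub>R ?e t)" for a c :: real
  proof -
    have "continuous_on {a..c} (\<lambda>t. ?e t)" by (intro continuous_intros)
    from borel_integrable_atLeastAtMost'[OF this] show ?thesis by (simp add: set_integrable_def)
  qed
  have "(\<integral>t. of_real (if cos r \<le> cos t then 1 else 0) * ?e t \<partial>circ)
    = (\<integral>t. indicator {0..2*pi} t *\<^sub>R (of_real (if cos r \<le> cos t then 1 else 0) * ?e t) \<partial>lborel)"
    by (subst integral_seg) (auto simp: set_lebesgue_integral_def)
  also have "\<dots> = (\<integral>t. indicator {0..r} t *\<^sub>R ?e t + indicator {2*pi-r..2*pi} t *\<^sub>R ?e t \<partial>lborel)"
    by (rule integral_cong_AE[OF _ _ ind]) measurable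
  also have "\<dots> = (\<integral>t. indicator {0..r} t *\<^sub>R ?e t \<partial>lborel) + (\<integral>t. indicator {2*pi-r..2*pi} t *\<^sub>R ?e t \<partial>lborel)"
    by (intro Bochner_Integration.integral_add int)
  also have "\<dots> = complex_of_real (if k = 0 then 2 * r else 2 * sin (of_int k * r) / of_int k)"
  proof (cases "k = 0")
    case True
    have ftc: "(\<integral>t. indicator {a..c} t *\<^sub>R ?e t \<partial>lborel) = complex_of_real c - complex_of_real a"
      if "a \<le> c" for a c
    proof (rule integral_FTC_atLeastAtMost[OF that])
      fix x :: real
      show "(complex_of_real has_vector_derivative cis (- (of_int k * x))) (at x within {a..c})"
        unfolding has_vector_derivative_complex_iff
        using True by (auto intro!: derivative_eq_intros)
    qed (intro continuous_intros)
    show ?thesis using r True by (simp only: ftc) (simp add: scaleR_conv_of_real mult.commute)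
  next
    case False
    have ftc: "(\<integral>t. indicator {a..c} t *\<^sub>R ?e t \<partial>lborel)
       = (\<i> / of_int k) * cis (- (of_int k * c)) - (\<i> / of_int k) * cis (- (of_int k * a))" if "a \<le> c" for a c
    proof (rule integral_FTC_atLeastAtMost[OF that])
      fix x :: real
      show "((\<lambda>t. (\<i> / of_int k) * ?e t) has_vector_derivative cis (- (of_int k * x))) (at x within {a..c})"
        unfolding has_vector_derivative_complex_iff
        using False by (auto intro!: derivative_eq_intros)
    qed (intro continuous_intros)
    have c2: "cis (- (of_int k * (2 * pi))) = 1" "cis (- (of_int k * (2 * pi - r))) = cis (of_int k * r)"
      using periodic_trig(3)[of "- k", unfolded periodic_def, rule_format, of 0]
        periodic_trig(3)[of "- k", unfolded periodic_def, rule_format, of "- r"] by (simp_all add: algebra_simps)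
    have "2 * pi - r \<le> 2 * pi" using r by simp
    from ftc[OF this] show ?thesis
      using False unfolding ftc[OF r(1)] c2 by (simp add: complex_eq_iff field_simps)
  qed
  finally show ?thesis .
qed

lemma square_diff_nonzero:
  fixes j k :: int
  assumes "j \<ge> 1" "j \<noteq> \<bar>k\<bar>"
  shows "j\<^sup>2 - k\<^sup>2 \<noteq> 0"
  using assms by (auto simp: power2_eq_iff)

text \<open>The sine coefficient in x of the response at frequency k to a point source at height
  \<xi>; the inner factor is the mode integrated over the arc of half-width x - \<xi>. The case k =
  0 is the limit of the other one.\<close>

definition green :: "int \<Rightarrow> int \<Rightarrow> real \<Rightarrow> real" where
  "green j k \<xi> = (\<integral>x. (if \<xi> \<le> x then sin (of_int j * x) *
      (if k = 0 then 2 * (x - \<xi>) else 2 * sin (of_int k * (x - \<xi>)) / of_int k) else 0) \<partial>seg 0 pi)"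

lemma sin_int_pi: "sin (of_int k * pi) = 0"
  by (simp add: sin_times_pi_eq_0)

lemma sin_int_minus_pi: "sin (of_int k * (pi - \<xi>)) = - cos (of_int k * pi) * sin (of_int k * \<xi>)"
  by (simp add: right_diff_distrib sin_diff sin_times_pi_eq_0)

text \<open>Lagrange's identity: for u = sin(J x) and v = sin(K (x - \<xi>)) the Wronskian u v' - u'
  v has derivative (J^2 - K^2) u v.\<close>

lemma green_antiderivative:
  fixes J K \<xi> x :: real
  assumes ne: "K \<noteq> 0" "J\<^sup>2 - K\<^sup>2 \<noteq> 0"
  shows "((\<lambda>x. 2 / K * (K * sin (J * x) * cos (K * (x - \<xi>)) - J * cos (J * x) * sin (K * (x - \<xi>))) / (J\<^sup>2 - K\<^sup>2))
    has_real_derivative sin (J * x) * (2 * sin (K * (x - \<xi>)) / K)) (at x within S)"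
proof -
  have "((\<lambda>x. K * sin (J * x) * cos (K * (x - \<xi>)) - J * cos (J * x) * sin (K * (x - \<xi>)))
    has_real_derivative (J\<^sup>2 - K\<^sup>2) * (sin (J * x) * sin (K * (x - \<xi>)))) (at x within S)"
    by (auto intro!: derivative_eq_intros simp: algebra_simps power2_eq_square)
  from DERIV_cdivide[OF DERIV_cmult[OF this, of "2 / K"], of "J\<^sup>2 - K\<^sup>2"]
  have "((\<lambda>x. 2 / K * (K * sin (J * x) * cos (K * (x - \<xi>)) - J * cos (J * x) * sin (K * (x - \<xi>))) / (J\<^sup>2 - K\<^sup>2))
    has_real_derivative 2 / K * ((J\<^sup>2 - K\<^sup>2) * (sin (J * x) * sin (K * (x - \<xi>)))) / (J\<^sup>2 - K\<^sup>2)) (at x within S)" .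
  also have "2 / K * ((J\<^sup>2 - K\<^sup>2) * (sin (J * x) * sin (K * (x - \<xi>)))) / (J\<^sup>2 - K\<^sup>2) = sin (J * x) * (2 * sin (K * (x - \<xi>)) / K)"
    using ne(2) by simp
  finally show ?thesis .
qed

text \<open>The endpoint x = \<xi> yields the term in sin(j \<xi>), which inverts the wave operator
  up to the factor - 2. The endpoint x = pi yields the rest: for k \<noteq> 0 a multiple of the
  resonant sin(k \<xi>), which will pair to 0 with h, and for k = 0 a multiple of pi - \<xi>, to be
  cancelled by a linear correction.\<close>

lemma green_eq:
  assumes \<xi>: "0 \<le> \<xi>" "\<xi> \<le> pi" and j: "j \<ge> 1" and jk: "j \<noteq> \<bar>k\<bar>"
  shows "green j k \<xi> = (if k = 0 then - 2 * cos (of_int j * pi) / of_int j * (pi - \<xi>)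
       else 2 * of_int j / of_int k * cos (of_int j * pi) * cos (of_int k * pi) / of_int (j\<^sup>2 - k\<^sup>2) * sin (of_int k * \<xi>))
     - 2 * sin (of_int j * \<xi>) / of_int (j\<^sup>2 - k\<^sup>2)"
proof -
  have ne: "real_of_int (j\<^sup>2 - k\<^sup>2) \<noteq> 0"
    using square_diff_nonzero[OF j jk] by (simp only: of_int_eq_0_iff not_False_eq_True)
  define f where "f = (\<lambda>x. sin (of_int j * x) * (if k = 0 then 2 * (x - \<xi>) else 2 * sin (of_int k * (x - \<xi>)) / of_int k))"
  have "green j k \<xi> = (\<integral>x\<in>{0..pi}. (if \<xi> \<le> x then f x else 0) \<partial>lborel)"
    unfolding green_def f_def by (subst integral_seg) auto
  also have "\<dots> = (\<integral>x. indicator {\<xi>..pi} x *\<^sub>R f x \<partial>lborel)"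
    unfolding set_lebesgue_integral_def
    by (intro Bochner_Integration.integral_cong) (use \<xi> in \<open>auto simp: indicator_def\<close>)
  finally have g: "green j k \<xi> = (\<integral>x. indicator {\<xi>..pi} x *\<^sub>R f x \<partial>lborel)" .
  show ?thesis
  proof (cases "k = 0")
    case True
    have "(\<integral>x. indicator {\<xi>..pi} x *\<^sub>R f x \<partial>lborel)
      = 2 * (sin (of_int j * pi) / (of_int j)\<^sup>2 - (pi - \<xi>) * cos (of_int j * pi) / of_int j)
      - 2 * (sin (of_int j * \<xi>) / (of_int j)\<^sup>2 - (\<xi> - \<xi>) * cos (of_int j * \<xi>) / of_int j)"
    proof (rule integral_FTC_atLeastAtMost[OF \<xi>(2)])
      fix x
      show "((\<lambda>x. 2 * (sin (of_int j * x) / (of_int j)\<^sup>2 - (x - \<xi>) * cos (of_int j * x) / of_int j)) has_vector_derivative f x) (at x within {\<xi>..pi})"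
        using True j unfolding f_def has_real_derivative_iff_has_vector_derivative[symmetric]
        by (auto intro!: derivative_eq_intros simp: field_simps power2_eq_square)
    qed (use True in \<open>auto simp: f_def intro!: continuous_intros\<close>)
    then show ?thesis unfolding g using True by (simp add: field_simps sin_times_pi_eq_0)
  next
    case False
    define D where "D = real_of_int (j\<^sup>2 - k\<^sup>2)"
    have I: "(\<integral>x. indicator {\<xi>..pi} x *\<^sub>R f x \<partial>lborel)
      = 2 / of_int k * (of_int k * sin (of_int j * pi) * cos (of_int k * (pi - \<xi>)) - of_int j * cos (of_int j * pi) * sin (of_int k * (pi - \<xi>))) / of_int (j\<^sup>2 - k\<^sup>2)
      - 2 / of_int k * (of_int k * sin (of_int j * \<xi>) * cos (of_int k * (\<xi> - \<xi>)) - of_int j * cos (of_int j * \<xi>) * sin (of_int k * (\<xi> - \<xi>))) / of_int (j\<^sup>2 - k\<^sup>2)"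
    proof (rule integral_FTC_atLeastAtMost[OF \<xi>(2)])
      fix x
      show "((\<lambda>x. 2 / of_int k * (of_int k * sin (of_int j * x) * cos (of_int k * (x - \<xi>)) - of_int j * cos (of_int j * x) * sin (of_int k * (x - \<xi>))) / of_int (j\<^sup>2 - k\<^sup>2)) has_vector_derivative f x) (at x within {\<xi>..pi})"
        unfolding has_real_derivative_iff_has_vector_derivative[symmetric]
        using green_antiderivative[of "of_int k" "of_int j" \<xi> x] False ne by (simp add: f_def)
    qed (use False in \<open>auto simp: f_def intro!: continuous_intros\<close>)
    show ?thesis using False ne unfolding g I sin_int_minus_pi D_def[symmetric] sin_int_pi by (simp add: field_simps)
  qed
qed

text \<open>Translation by \<open>fst w\<close> leaves only a phase; integrating over t first then
  gives the arc integral, and the x-integral is \<open>green\<close>.\<close>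

lemma cone_coefficient:
  assumes w: "fst w \<in> {0<..<2*pi}" "snd w \<in> {0<..<pi}"
  shows "(\<integral>z. of_real (cone z w * sin (of_int j * snd z)) * cis (- (of_int k * fst z)) \<partial>cyl)
     = of_real (green j k (snd w)) * cis (- (of_int k * fst w))"
proof -
  let ?a = "\<lambda>x. if k = 0 then 2 * (x - snd w) else 2 * sin (of_int k * (x - snd w)) / of_int k"
  define G where "G = (\<lambda>(t, x). of_real ((if snd w \<le> x \<and> cos (x - snd w) \<le> cos t then 1 else 0) * sin (of_int j * x)) * cis (- (of_int k * t)))"
  have mG [measurable]: "G \<in> borel_measurable borel2" unfolding G_def by measurable
  have intG: "integrable cyl G"
    by (rule cyl.integrable_const_bound[of _ 1]) (auto simp: G_def norm_mult)
  have per: "periodic (\<lambda>t. G (t, x))" for x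
    using periodic_trig(3)[of "- k"] by (auto simp: periodic_def G_def)
  have "of_real (cone z w * sin (of_int j * snd z)) * cis (- (of_int k * fst z))
      = G (fst z + - fst w, snd z) * cis (- (of_int k * fst w))" for z
  proof -
    have "cos (fst w - fst z) = cos (fst z - fst w)" using cos_minus[of "fst w - fst z"] by simp
    then show ?thesis by (simp add: G_def cone_def cis_mult algebra_simps)
  qed
  then have "(\<integral>z. of_real (cone z w * sin (of_int j * snd z)) * cis (- (of_int k * fst z)) \<partial>cyl)
     = (\<integral>z. G (fst z + - fst w, snd z) * cis (- (of_int k * fst w)) \<partial>cyl)" by simp
  also have "\<dots> = (\<integral>z. G (fst z + - fst w, snd z) \<partial>cyl) * cis (- (of_int k * fst w))"
    by simp
  also have "(\<integral>z. G (fst z + - fst w, snd z) \<partial>cyl) = integral\<^sup>L cyl G"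
    using shear_integral[OF mG per, of "\<lambda>_. - fst w"] by (simp add: split_beta')
  also have "\<dots> = (\<integral>x. (\<integral>t. G (t, x) \<partial>circ) \<partial>seg 0 pi)"
    using seg_pair.integral_snd[where f="\<lambda>t x. G (t, x)"] intG by simp
  also have "\<dots> = (\<integral>x. complex_of_real (if snd w \<le> x then sin (of_int j * x) *
      (?a x) else 0) \<partial>seg 0 pi)"
  proof (rule integral_cong_AE)
    show "AE x in seg 0 pi. (\<integral>t. G (t, x) \<partial>circ) = complex_of_real (if snd w \<le> x then sin (of_int j * x) *
      (?a x) else 0)"
      using AE_seg_mem
    proof (rule eventually_mono)
      fix x assume x: "x \<in> {0<..pi}"
      show "(\<integral>t. G (t, x) \<partial>circ) = complex_of_real (if snd w \<le> x then sin (of_int j * x) *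
      (?a x) else 0)"
      proof (cases "snd w \<le> x")
        case True
        then have "(\<integral>t. G (t, x) \<partial>circ) = (\<integral>t. of_real (sin (of_int j * x)) * (of_real (if cos (x - snd w) \<le> cos t then 1 else 0) * cis (- (of_int k * t))) \<partial>circ)"
          by (intro Bochner_Integration.integral_cong) (auto simp: G_def)
        also have "\<dots> = complex_of_real (sin (of_int j * x)) * complex_of_real (?a x)"
          using arc_integral[of "x - snd w" k] True x w by simp
        finally show ?thesis using True by (simp only: if_True of_real_mult)
      next
        case False
        then show ?thesis by (simp add: G_def)
      qed
    qed
  qed measurable
  also have "\<dots> = complex_of_real (green j k (snd w))"
    unfolding green_def by (rule integral_complex_of_real)
  finally show ?thesis .
qed


lemma integrable_pair_snd:
  fixes h :: "real \<times> real \<Rightarrow> 'b::{banach, second_countable_topology}"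
  assumes h: "integrable cyl h"
  shows "integrable (cyl \<Otimes>\<^sub>M cyl) (\<lambda>p. h (snd p))"
proof (rule cyl_pair.Fubini_integrable)
  show "(\<lambda>p. h (snd p)) \<in> borel_measurable (cyl \<Otimes>\<^sub>M cyl)"
    using borel_measurable_integrable[OF h] by measurable
qed (use h in auto)

text \<open>By Fubini, h is integrated against the coefficients of the cone. The resonant part of
  \<open>green\<close> meets \<open>cf h k k\<close>, which is 0, so only the multiplier - 2 / (j^2
  - k^2) and one term at k = 0 survive.\<close>

lemma cf_duhamel:
  assumes h: "integrable cyl h" and j: "j \<ge> 1" and jk: "j \<noteq> \<bar>k\<bar>" and diag: "cf h k k = 0"
  shows "cf (duhamel h) j k = complex_of_real (if k = 0 then - 2 * cos (of_int j * pi) / of_int j * (\<integral>w. h w * (pi - snd w) \<partial>cyl) else 0)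
    - complex_of_real (2 / of_int (j\<^sup>2 - k\<^sup>2)) * cf h j k"
proof -
  note [measurable] = borel_measurable_cyl[OF h]
  define \<alpha> where "\<alpha> = (if k = 0 then 0 else 2 * of_int j / of_int k * cos (of_int j * pi) * cos (of_int k * pi) / of_int (j\<^sup>2 - k\<^sup>2))"
  define \<beta> where "\<beta> = (if k = 0 then - 2 * cos (of_int j * pi) / of_int j else 0)"
  define \<gamma> where "\<gamma> = 2 / real_of_int (j\<^sup>2 - k\<^sup>2)"
  define mode where "mode = (\<lambda>i w. of_real (h w * sin (of_int i * snd w)) * cis (- (of_int k * fst w)))"
  define e where "e = (\<lambda>z w. of_real (cone z w * sin (of_int j * snd z)) * cis (- (of_int k * fst z)))"
  have [measurable]: "(\<lambda>p. e (fst p) (snd p)) \<in> borel_measurable (borel2 \<Otimes>\<^sub>M borel2)"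
    "(\<lambda>p. e (snd p) (fst p)) \<in> borel_measurable (borel2 \<Otimes>\<^sub>M borel2)"
    unfolding e_def by measurable
  let ?L = "\<lambda>w. \<integral>z. complex_of_real (h w) * e z w \<partial>cyl"
  let ?R = "\<lambda>w. complex_of_real (\<beta> * (h w * (pi - snd w))) + complex_of_real \<alpha> * mode k w - complex_of_real \<gamma> * mode j w"
  have int: "integrable (cyl \<Otimes>\<^sub>M cyl) (\<lambda>(z, w). complex_of_real (h w) * e z w)"
    unfolding split_beta'
  proof (rule integrable_mult_bounded[where B=1])
    show "integrable (cyl \<Otimes>\<^sub>M cyl) (\<lambda>p. complex_of_real (h (snd p)))"
      using h by (intro integrable_pair_snd) simp
    show "norm (e (fst p) (snd p)) \<le> 1" for p
      by (simp add: e_def norm_mult cone_def)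
  qed measurable
  \<comment> \<open>pi - x is unbounded on the plane, so integrability is shown for a truncation
    that agrees with it almost everywhere.\<close>
  have "integrable cyl (\<lambda>w. h w * (if snd w \<in> {0..pi} then pi - snd w else 0))"
    by (rule integrable_mult_bounded[OF h, of _ pi]) auto
  then have "integrable cyl (\<lambda>w. h w * (pi - snd w))"
    by (rule integrable_cong_AE_imp) (auto intro!: eventually_mono[OF AE_cyl_interior])
  then have "has_bochner_integral cyl (\<lambda>w. \<beta> * (h w * (pi - snd w))) (\<beta> * (\<integral>w. h w * (pi - snd w) \<partial>cyl))"
    by (intro has_bochner_integral_mult_right) (auto simp: has_bochner_integral_iff)
  note mean = has_bochner_integral_of_real[OF this]
  have modes: "has_bochner_integral cyl (mode i) (cf h i k)" for i
    unfolding has_bochner_integral_iff cf_def mode_def using integrable_cf[OF h] by blast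
  note total = has_bochner_integral_diff[OF has_bochner_integral_add[OF mean has_bochner_integral_mult_right[OF modes]]
      has_bochner_integral_mult_right[OF modes]]
  have "cf (duhamel h) j k = (\<integral>z. (\<integral>w. complex_of_real (h w) * e z w \<partial>cyl) \<partial>cyl)"
    unfolding cf_def duhamel_def
  proof (intro Bochner_Integration.integral_cong refl)
    fix z
    have "(\<integral>w. complex_of_real (h w) * e z w \<partial>cyl)
      = (\<integral>w. of_real (h w * cone z w) * (of_real (sin (of_int j * snd z)) * cis (- (of_int k * fst z))) \<partial>cyl)"
      by (intro Bochner_Integration.integral_cong) (auto simp: e_def)
    also have "\<dots> = of_real (\<integral>w. h w * cone z w \<partial>cyl) * (of_real (sin (of_int j * snd z)) * cis (- (of_int k * fst z)))"
      by (simp only: integral_mult_left_zero integral_complex_of_real)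
    finally show "of_real ((\<integral>w. h w * cone z w \<partial>cyl) * sin (of_int j * snd z)) * cis (- (of_int k * fst z))
      = (\<integral>w. complex_of_real (h w) * e z w \<partial>cyl)" by simp
  qed
  also have "\<dots> = (\<integral>w. ?L w \<partial>cyl)"
    using cyl_pair.Fubini_integral[OF int] by simp
  also have "\<dots> = (\<integral>w. ?R w \<partial>cyl)"
  proof (rule integral_cong_AE)
    show "AE w in cyl. ?L w
      = ?R w"
      using AE_cyl_interior
    proof (rule eventually_mono)
      fix w :: "real \<times> real" assume w: "fst w \<in> {0<..<2*pi} \<and> snd w \<in> {0<..<pi}"
      have green: "green j k (snd w) = \<beta> * (pi - snd w) + \<alpha> * sin (of_int k * snd w) - \<gamma> * sin (of_int j * snd w)"
        using green_eq[of "snd w" j k] w j jk by (simp add: \<alpha>_def \<beta>_def \<gamma>_def)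
      have "(\<integral>z. of_real (h w) * e z w \<partial>cyl) = of_real (h w) * (of_real (green j k (snd w)) * cis (- (of_int k * fst w)))"
        using cone_coefficient[of w j k] w by (simp add: e_def)
      also have "\<dots> = ?R w"
        unfolding green mode_def by (cases "k = 0") (simp_all add: \<beta>_def algebra_simps)
      finally show "?L w
        = ?R w" .
    qed
    show "(\<lambda>w. \<integral>z. complex_of_real (h w) * e z w \<partial>cyl) \<in> borel_measurable cyl" by measurable
  qed (rule borel_measurable_has_bochner_integral[OF total])
  also have "\<dots> = complex_of_real (\<beta> * (\<integral>w. h w * (pi - snd w) \<partial>cyl)) + complex_of_real \<alpha> * cf h k k - complex_of_real \<gamma> * cf h j k"
    by (rule has_bochner_integral_integral_eq[OF total])
  finally show ?thesis by (simp add: diag \<beta>_def \<gamma>_def)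
qed

section \<open>Coefficients of the linear correction and of kernel functions\<close>

lemma integral_cis: "(\<integral>t. cis (- (of_int k * t)) \<partial>circ) = (if k = 0 then 2 * complex_of_real pi else 0)"
  using arc_integral[of pi k] by (simp add: sin_times_pi_eq_0 cos_ge_minus_one)

lemma integrable_seg_bounded:
  fixes B :: "real \<Rightarrow> 'b::{banach, second_countable_topology}"
  assumes "continuous_on {a..b} B" and [measurable]: "B \<in> borel_measurable borel"
  shows "integrable (seg a b) B"
proof -
  have "bounded (B ` {a..b})"
    using assms(1) by (intro compact_imp_bounded compact_continuous_image) auto
  then obtain M where M: "\<And>x. x \<in> {a..b} \<Longrightarrow> norm (B x) \<le> M" unfolding bounded_iff by blast
  show ?thesis
    by (rule seg.integrable_const_bound[of _ M])
      (auto intro!: eventually_mono[OF AE_seg_mem[of a b]] M)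
qed

text \<open>The function x is what cancels the extra k = 0 term of \<open>cf_duhamel\<close>: both
  have coefficients proportional to cos(j pi) / j.\<close>

lemma cf_snd:
  assumes "j \<ge> 1"
  shows "cf snd j k = (if k = 0 then complex_of_real (- 2 * pi\<^sup>2 * cos (of_int j * pi) / of_int j) else 0)"
proof -
  have A: "integrable circ (\<lambda>t. cis (- (of_int k * t)))"
    by (rule seg.integrable_const_bound[of _ 1]) auto
  have B: "integrable (seg 0 pi) (\<lambda>x. complex_of_real (x * sin (of_int j * x)))"
    by (intro integrable_seg_bounded continuous_intros) measurable
  have "cf snd j k = (\<integral>(t, x). cis (- (of_int k * t)) * of_real (x * sin (of_int j * x)) \<partial>cyl)"
    unfolding cf_def by (intro Bochner_Integration.integral_cong) auto
  also have "\<dots> = (if k = 0 then 2 * complex_of_real pi else 0) * (\<integral>x. complex_of_real (x * sin (of_int j * x)) \<partial>seg 0 pi)"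
    unfolding cyl_product(2)[OF A B] integral_cis ..
  also have "(\<integral>x. complex_of_real (x * sin (of_int j * x)) \<partial>seg 0 pi) = complex_of_real (\<integral>x. x * sin (of_int j * x) \<partial>seg 0 pi)"
    by (rule integral_complex_of_real)
  also have "(\<integral>x. x * sin (of_int j * x) \<partial>seg 0 pi) = (\<integral>x. indicator {0..pi} x *\<^sub>R (x * sin (of_int j * x)) \<partial>lborel)"
    by (subst integral_seg) (auto simp: set_lebesgue_integral_def)
  also have "\<dots> = (sin (of_int j * pi) / (of_int j)\<^sup>2 - pi * cos (of_int j * pi) / of_int j)
      - (sin (of_int j * 0) / (of_int j)\<^sup>2 - 0 * cos (of_int j * 0) / of_int j)"
  proof (rule integral_FTC_atLeastAtMost)
    fix x
    show "((\<lambda>x. sin (of_int j * x) / (of_int j)\<^sup>2 - x * cos (of_int j * x) / of_int j) has_vector_derivative x * sin (of_int j * x)) (at x within {0..pi})"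
      using assms unfolding has_real_derivative_iff_has_vector_derivative[symmetric]
      by (auto intro!: derivative_eq_intros simp: field_simps power2_eq_square)
  qed (auto intro!: continuous_intros)
  finally show ?thesis
    using sin_int_pi[of j] by (simp add: power2_eq_square)
qed

text \<open>A by-product of \<open>green_eq\<close>: for k \<noteq> 0 both sine terms vanish at
  \<xi> = 0.\<close>

lemma sin_orthogonal:
  assumes "j \<ge> 1" "j \<noteq> \<bar>k\<bar>"
  shows "(\<integral>x. sin (of_int j * x) * sin (of_int k * x) \<partial>seg 0 pi) = 0"
proof (cases "k = 0")
  case False
  have "green j k 0 = 0" using green_eq[of 0 j k] assms False by simp
  moreover have "green j k 0 = (\<integral>x. (sin (of_int j * x) * sin (of_int k * x)) * (2 / of_int k) \<partial>seg 0 pi)"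
    unfolding green_def
    by (rule integral_cong_AE) (use False in \<open>auto intro!: eventually_mono[OF AE_seg_mem]\<close>)
  ultimately show ?thesis using False by simp
qed simp

text \<open>After a shear, p(t + x) and p(t - x) each contribute the same coefficient of p times an
  integral over x. The two x-integrals differ by 2 i times the integral of sin(j x) sin(k x), which
  is 0 off resonance.\<close>

lemma cf_wave:
  assumes p: "integrable circ p" "periodic p" and j: "j \<ge> 1" "j \<noteq> \<bar>k\<bar>"
  shows "cf (wave p) j k = 0"
proof -
  note [measurable] = borel_measurable_seg[OF p(1)]
  define G where "G = (\<lambda>\<sigma> (t, x). of_real (p (t + \<sigma> * x) * sin (of_int j * x)) * cis (- (of_int k * t)))"
  have mG [measurable]: "G \<sigma> \<in> borel_measurable borel2" for \<sigma> unfolding G_def by measurable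
  have perG: "periodic (\<lambda>t. G \<sigma> (t, x))" for \<sigma> x
    using periodic_trig(3)[of "- k"] p(2)[unfolded periodic_def, rule_format, of "_ + \<sigma> * x"]
    by (simp add: periodic_def G_def algebra_simps)
  have intG: "integrable cyl (G \<sigma>)" for \<sigma>
  proof -
    have "integrable cyl (\<lambda>z. of_real ((\<lambda>(t, x). p (t + \<sigma> * x)) z * sin (of_int j * snd z)) * cis (- (of_int k * fst z)))"
      by (intro integrable_cf cyl_of_circ p) measurable
    then show ?thesis by (simp add: G_def split_beta')
  qed
  define P where "P = (\<lambda>t. of_real (p t) * cis (- (of_int k * t)))"
  define S where "S = (\<lambda>\<sigma> x. of_real (sin (of_int j * x)) * cis (\<sigma> * of_int k * x))"
  have P: "integrable circ P" unfolding P_def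
    by (rule integrable_mult_bounded[where B=1]) (use p in auto)
  have S: "integrable (seg 0 pi) (S \<sigma>)" for \<sigma> unfolding S_def
    by (intro integrable_seg_bounded continuous_intros) measurable
  have "integral\<^sup>L cyl (G \<sigma>) = integral\<^sup>L circ P * integral\<^sup>L (seg 0 pi) (S \<sigma>)" for \<sigma>
  proof -
    have "integral\<^sup>L cyl (G \<sigma>) = (\<integral>(t, x). G \<sigma> (t + (- \<sigma> * x), x) \<partial>cyl)"
      by (intro shear_integral[symmetric] perG) measurable
    also have "\<dots> = (\<integral>(t, x). P t * S \<sigma> x \<partial>cyl)"
    proof -
      have "cis (- (of_int k * (t - \<sigma> * x))) = cis (- (of_int k * t)) * cis (\<sigma> * of_int k * x)" for t x
        by (simp add: cis_mult algebra_simps)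
      then show ?thesis
        by (intro Bochner_Integration.integral_cong refl) (auto simp: G_def P_def S_def)
    qed
    also have "\<dots> = integral\<^sup>L circ P * integral\<^sup>L (seg 0 pi) (S \<sigma>)"
      by (rule cyl_product(2)[OF P S])
    finally show ?thesis .
  qed
  note split = this
  have "cf (wave p) j k = (\<integral>z. G 1 z - G (- 1) z \<partial>cyl)"
    unfolding cf_def by (intro Bochner_Integration.integral_cong) (auto simp: G_def wave_def algebra_simps)
  also have "\<dots> = integral\<^sup>L circ P * (integral\<^sup>L (seg 0 pi) (S 1) - integral\<^sup>L (seg 0 pi) (S (- 1)))"
    by (simp only: Bochner_Integration.integral_diff[OF intG intG] split right_diff_distrib)
  also have "integral\<^sup>L (seg 0 pi) (S 1) - integral\<^sup>L (seg 0 pi) (S (- 1)) = (\<integral>x. S 1 x - S (- 1) x \<partial>seg 0 pi)"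
    using S by (intro Bochner_Integration.integral_diff[symmetric])
  also have "\<dots> = (\<integral>x. 2 * \<i> * complex_of_real (sin (of_int j * x) * sin (of_int k * x)) \<partial>seg 0 pi)"
    by (intro Bochner_Integration.integral_cong) (auto simp: S_def complex_eq_iff)
  also have "\<dots> = 2 * \<i> * complex_of_real (\<integral>x. sin (of_int j * x) * sin (of_int k * x) \<partial>seg 0 pi)"
    by (simp only: integral_mult_right_zero integral_complex_of_real)
  finally show ?thesis using sin_orthogonal[OF j] by simp
qed

lemma continuous_integrable_cyl:
  fixes U :: "real \<times> real \<Rightarrow> real"
  assumes U: "continuous_on UNIV U"
  shows "integrable cyl U"
proof -
  have "compact Omega" unfolding Omega_def by (intro compact_Times) auto
  then have "bounded (U ` Omega)"
    using U continuous_on_subset by (intro compact_imp_bounded compact_continuous_image) auto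
  then obtain M where M: "\<And>x. x \<in> Omega \<Longrightarrow> norm (U x) \<le> M" unfolding bounded_iff by blast
  have "U \<in> borel_measurable cyl"
    using borel_measurable_continuous_onI[OF U] by (simp add: measurable_cong_sets[OF sets_cyl refl])
  then show ?thesis
    by (intro cyl.integrable_const_bound[of _ M] eventually_mono[OF AE_cyl_interior] M)
      (auto simp: Omega_def mem_Times_iff)
qed

section \<open>Splitting into a continuous part and a kernel part\<close>

text \<open>U is built to match the nonresonant coefficients of u, and \<open>wave p\<close>
  accounts for the resonant ones of u - U without disturbing the others. The remainder has no
  coefficients left and is null.\<close>

lemma wave_decomposition:
  assumes u: "integrable cyl u" "\<And>x. periodic (\<lambda>t. u (t, x))"
    and h: "integrable cyl h" "\<And>x. periodic (\<lambda>t. h (t, x))"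
    and rel: "\<And>j k. j \<ge> 1 \<Longrightarrow> of_int (j\<^sup>2 - k\<^sup>2) * cf u j k + cf h j k = 0"
  obtains U p where "continuous_on UNIV U" "\<And>x. periodic (\<lambda>t. U (t, x))"
    "integrable circ p" "periodic p" "integral\<^sup>L circ p = 0"
    "AE z in cyl. u z = U z + wave p z"
proof -
  have res: "cf h j k = 0" if "j \<ge> 1" "j = \<bar>k\<bar>" for j k
    using rel[of j k] that by simp
  have diag: "cf h k k = 0" for k
    using res by (rule resonant_diagonal)
  define I where "I = (\<integral>w. h w * (pi - snd w) \<partial>cyl)"
  \<comment> \<open>For \<open>h\<close> orthogonal to the kernel, \<open>duhamel h / 2\<close> is constant in time on \<open>x = \<pi>\<close>; the linear term restores
    the boundary condition there.\<close>
  define U where "U = (\<lambda>z. duhamel h z / 2 - I / (2 * pi\<^sup>2) * snd z)"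
  have contU: "continuous_on UNIV U"
    unfolding U_def by (intro continuous_intros duhamel_continuous h) auto
  have perU: "periodic (\<lambda>t. U (t, x))" for x
    using periodic_duhamel[of h x] by (simp add: U_def periodic_def)
  have intU: "integrable cyl U" by (rule continuous_integrable_cyl[OF contU])
  have cfU: "of_int (j\<^sup>2 - k\<^sup>2) * cf U j k = - cf h j k" if j: "j \<ge> 1" "j \<noteq> \<bar>k\<bar>" for j k
  proof -
    have ne: "complex_of_int (j\<^sup>2 - k\<^sup>2) \<noteq> 0"
      using square_diff_nonzero[OF j] by (simp only: of_int_eq_0_iff not_False_eq_True)
    have "integrable cyl (duhamel h)" "integrable cyl snd"
      by (intro continuous_integrable_cyl duhamel_continuous h continuous_intros)+
    note ints = integrable_cf[OF this(1)] integrable_cf[OF this(2)]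
    have "cf U j k = (\<integral>z. 1 / 2 * (of_real (duhamel h z * sin (of_int j * snd z)) * cis (- (of_int k * fst z)))
       - of_real (I / (2 * pi\<^sup>2)) * (of_real (snd z * sin (of_int j * snd z)) * cis (- (of_int k * fst z))) \<partial>cyl)"
      unfolding cf_def by (intro Bochner_Integration.integral_cong) (auto simp: U_def algebra_simps)
    also have "\<dots> = 1 / 2 * cf (duhamel h) j k - complex_of_real (I / (2 * pi\<^sup>2)) * cf snd j k"
      unfolding cf_def using ints
      by (subst Bochner_Integration.integral_diff) (simp_all only: integrable_mult_right integral_mult_right_zero)
    also have "\<dots> = - cf h j k / of_int (j\<^sup>2 - k\<^sup>2)"
      unfolding cf_duhamel[OF h(1) j diag] cf_snd[OF j(1)] I_def[symmetric]
      by (simp add: field_simps)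
    finally show ?thesis using ne by simp
  qed
  define w where "w = (\<lambda>z. u z - U z)"
  have w: "integrable cyl w" "periodic (\<lambda>t. w (t, x))" for x
    using u intU perU[of x] u(2)[of x] by (auto simp: w_def periodic_def)
  have cfw: "cf w j k = 0" if j: "j \<ge> 1" "j \<noteq> \<bar>k\<bar>" for j k
  proof -
    have "cf w j k = cf u j k - cf U j k"
      unfolding cf_def using integrable_cf[OF u(1)] integrable_cf[OF intU]
      by (subst Bochner_Integration.integral_diff[symmetric])
        (auto intro!: Bochner_Integration.integral_cong simp: w_def algebra_simps)
    moreover have "of_int (j\<^sup>2 - k\<^sup>2) * cf u j k = - cf h j k"
      using rel[OF j(1), of k] by (simp only: eq_neg_iff_add_eq_0)
    then have "of_int (j\<^sup>2 - k\<^sup>2) * (cf u j k - cf U j k) = 0"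
      by (simp only: right_diff_distrib cfU[OF j] diff_self)
    moreover have "complex_of_int (j\<^sup>2 - k\<^sup>2) \<noteq> 0"
      using square_diff_nonzero[OF j] by (simp only: of_int_eq_0_iff not_False_eq_True)
    ultimately show ?thesis by simp
  qed
  note dual = char_mean_dual[OF w]
  \<comment> \<open>For the constant \<open>\<Theta> = 1\<close> the function
    \<open>wave \<Theta>\<close> is 0, so duality gives mean zero.\<close>
  have one: "integrable circ (char_mean w)" "integral\<^sup>L circ (char_mean w) = 0"
    using dual[of "\<lambda>_. 1" 1] by (auto simp: periodic_def wave_def split_beta')
  \<comment> \<open>Dictated by \<open>char_mean_wave\<close>: on mean-zero p it reads
    \<open>char_mean (wave p) = 2 pi p\<close>.\<close>
  define p where "p = (\<lambda>s. char_mean w s / (2 * pi))"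
  have p: "integrable circ p" "periodic p" "integral\<^sup>L circ p = 0"
    using one periodic_char_mean[of w] w(2) by (auto simp: p_def periodic_def)
  define D where "D = (\<lambda>z. w z - wave p z)"
  have D: "integrable cyl D"
    unfolding D_def by (intro Bochner_Integration.integrable_diff w integrable_wave p)
  have "(\<integral>z. D z * wave \<Theta> z \<partial>cyl) = 0"
    if \<Theta>: "\<Theta> \<in> borel_measurable borel" "periodic \<Theta>" "\<And>s. \<bar>\<Theta> s\<bar> \<le> 1" for \<Theta>
  proof -
    have "(\<integral>z. D z * wave \<Theta> z \<partial>cyl) = (\<integral>z. w z * wave \<Theta> z \<partial>cyl) - (\<integral>z. wave p z * wave \<Theta> z \<partial>cyl)"
      using dual(2)[OF \<Theta>] char_mean_dual(2)[OF integrable_wave[OF p(1,2)] periodic_wave[OF p(2)] \<Theta>]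
      by (simp add: D_def left_diff_distrib)
    also have "\<dots> = 0"
      unfolding dual(3)[OF \<Theta>] wave_dual[OF p \<Theta>] by (simp add: p_def)
    finally show ?thesis .
  qed
  then have cfDdiag: "cf D k k = 0" for k
    unfolding cf_diag[OF D] by (simp add: periodic_trig)
  have "cf D j k = 0" if "j \<ge> 1" for j k
  proof (cases "j = \<bar>k\<bar>")
    case True
    then consider "j = k" | "j = - k" by linarith
    then show ?thesis
    proof cases
      case 2
      then show ?thesis using cfDdiag[of k] by (simp only: cf_uminus neg_equal_0_iff_equal)
    qed (use cfDdiag in simp)
  next
    case False
    have "cf D j k = cf w j k - cf (wave p) j k"
      unfolding cf_def using integrable_cf[OF w(1)] integrable_cf[OF integrable_wave[OF p(1,2)]]
      by (subst Bochner_Integration.integral_diff[symmetric])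
        (auto intro!: Bochner_Integration.integral_cong simp: D_def algebra_simps)
    then show ?thesis using cfw[OF that False] cf_wave[OF p(1,2) that False] by simp
  qed
  with D have "AE z in cyl. D z = 0" by (rule uniqueness)
  then have "AE z in cyl. u z = U z + wave p z"
    by (rule eventually_mono) (simp add: D_def w_def)
  with contU perU p show thesis by (rule that)
qed

section \<open>Regularity of periodic solutions\<close>

lemma AE_cyl_Omega: "AE z in cyl. z \<in> Omega"
  using AE_cyl_interior by (rule eventually_mono) (auto simp: Omega_def mem_Times_iff)

lemma compact_Omega: "compact Omega"
  unfolding Omega_def by (intro compact_Times) auto

lemma continuous_bounded_Omega:
  fixes U :: "real \<times> real \<Rightarrow> real"
  assumes "continuous_on UNIV U"
  obtains M where "M \<ge> 0" "\<And>z. z \<in> Omega \<Longrightarrow> \<bar>U z\<bar> \<le> M"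
proof -
  have "bounded (U ` Omega)"
    using assms continuous_on_subset compact_Omega
    by (intro compact_imp_bounded compact_continuous_image) auto
  then obtain M where "\<And>x. x \<in> Omega \<Longrightarrow> norm (U x) \<le> M" unfolding bounded_iff by blast
  then show thesis by (intro that[of "\<bar>M\<bar>"]) (auto intro: order_trans[OF _ abs_ge_self])
qed

lemma measurable_borel_prod: "X \<in> borel_measurable (borel :: (real \<times> real) measure) \<longleftrightarrow> X \<in> borel_measurable borel2"
  by (simp add: borel_prod)

lemma continuous_measurable_pair:
  fixes U :: "real \<times> real \<Rightarrow> real"
  assumes "continuous_on UNIV U"
  shows "U \<in> borel_measurable borel2"
  using borel_measurable_continuous_onI[OF assms] unfolding measurable_borel_prod .

lemma superposition_measurable:
  fixes F :: "real \<times> real \<Rightarrow> real \<Rightarrow> real"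
  assumes F: "continuous_on UNIV (\<lambda>(z, \<xi>). F z \<xi>)" and u: "u \<in> borel_measurable borel2"
  shows "(\<lambda>z. F z (u z)) \<in> borel_measurable borel2"
proof -
  have "(\<lambda>(z, \<xi>). F z \<xi>) \<in> borel_measurable borel" by (rule borel_measurable_continuous_onI[OF F])
  moreover have "(\<lambda>z. (z, u z)) \<in> borel_measurable (borel :: (real \<times> real) measure)"
    using u unfolding measurable_borel_prod[symmetric] by measurable
  ultimately have "(\<lambda>z. (\<lambda>(z, \<xi>). F z \<xi>) (z, u z)) \<in> borel_measurable borel"
    by (rule measurable_compose[rotated])
  then show ?thesis unfolding measurable_borel_prod by simp
qed

text \<open>Turns an almost everywhere bound into one valid at every point, which is safe to use at
  translated arguments.\<close>

lemma clamp_wave: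
  assumes p: "integrable circ p" "periodic p" "integral\<^sup>L circ p = 0"
    and bd: "AE s in circ. \<bar>p s\<bar> \<le> R" and R: "R \<ge> 0"
  obtains p' where "integrable circ p'" "periodic p'" "integral\<^sup>L circ p' = 0" "\<And>s. \<bar>p' s\<bar> \<le> R"
    "AE z in cyl. wave p z = wave p' z"
proof -
  define p' where "p' = (\<lambda>s. max (- R) (min R (p s)))"
  have mp [measurable]: "p \<in> borel_measurable borel"
    using borel_measurable_integrable[OF p(1)] by simp
  have mp' [measurable]: "p' \<in> borel_measurable borel" unfolding p'_def by measurable
  have ae: "AE s in circ. p s = p' s"
    using bd by (rule eventually_mono) (auto simp: p'_def)
  have "integrable circ p'"
    by (rule integrable_cong_AE_imp[OF p(1) _ ae]) measurable
  moreover have "periodic p'" using p(2) by (simp add: p'_def periodic_def)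
  moreover have "integral\<^sup>L circ p' = 0"
    using integral_cong_AE[of p circ p'] ae p(3) by simp
  moreover have "\<bar>p' s\<bar> \<le> R" for s using R by (auto simp: p'_def)
  moreover have "AE z in cyl. wave p z = wave p' z"
  proof (rule AE_wave_cong[OF mp mp'])
    show "AE s in lborel. p s = p' s"
      using p(2) by (intro AE_circ_imp_lborel ae) (auto simp: p'_def periodic_def)
  qed
  ultimately show thesis by (rule that)
qed

section \<open>Sign conditions from monotonicity\<close>

lemma superposition_continuous:
  fixes F :: "real \<times> real \<Rightarrow> real \<Rightarrow> real"
  assumes "continuous_on UNIV (\<lambda>(z, \<xi>). F z \<xi>)" "continuous_on UNIV A" "continuous_on UNIV B"
  shows "continuous_on UNIV (\<lambda>w. F (A w) (B w))"
  using continuous_on_compose2[OF assms(1) continuous_on_Pair[OF assms(2,3)]] by simp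

text \<open>Where w > 0, u exceeds U and monotonicity gives F(u) >= F(U); where w < 0 the inequality
  is reversed. Hence only the continuous function X + F(U) has to be bounded. All larger constants
  are allowed so that both equations can share one.\<close>

lemma superposition_sign:
  fixes F :: "real \<times> real \<Rightarrow> real \<Rightarrow> real"
  assumes F: "continuous_on UNIV (\<lambda>(z, \<xi>). F z \<xi>)" "\<And>z. mono (F z)"
    and UX: "continuous_on UNIV U" "continuous_on UNIV X" and ae: "AE z in cyl. u z = U z + w z"
  obtains C where "C \<ge> 0" "\<And>C'. C' \<ge> C \<Longrightarrow> sign_bounded w (\<lambda>z. X z + F z (u z)) C'"
proof -
  have "continuous_on UNIV (\<lambda>z. X z + F z (U z))"
    by (intro continuous_on_add superposition_continuous[OF F(1)] UX continuous_on_id)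
  then obtain C where C: "C \<ge> 0" "\<And>z. z \<in> Omega \<Longrightarrow> \<bar>X z + F z (U z)\<bar> \<le> C"
    by (rule continuous_bounded_Omega) blast
  have "sign_bounded w (\<lambda>z. X z + F z (u z)) C'" if "C' \<ge> C" for C'
    unfolding sign_bounded_def using ae AE_cyl_Omega
  proof eventually_elim
    case (elim z)
    then show ?case
      using C(2)[OF elim(2)] that monoD[OF F(2)[of z], of "U z" "u z"] monoD[OF F(2)[of z], of "u z" "U z"]
      by auto
  qed
  with C(1) show thesis by (rule that)
qed

lemma clamped_superposition:
  fixes F :: "real \<times> real \<Rightarrow> real \<Rightarrow> real"
  assumes F: "continuous_on UNIV (\<lambda>(z, \<xi>). F z \<xi>)" "\<And>x \<xi>. periodic (\<lambda>t. F (t, x) \<xi>)"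
    and U: "continuous_on UNIV U" "\<And>x. periodic (\<lambda>t. U (t, x))"
    and X: "continuous_on UNIV X" "\<And>x. periodic (\<lambda>t. X (t, x))"
    and p: "integrable circ p" "periodic p" "integral\<^sup>L circ p = 0" "AE s in circ. \<bar>p s\<bar> \<le> R" "R \<ge> 0"
    and up: "AE z in cyl. u z = U z + wave p z" and Fu: "integrable cyl (\<lambda>z. F z (u z))"
  obtains p' where "integrable circ p'" "periodic p'" "integral\<^sup>L circ p' = 0" "\<And>s. \<bar>p' s\<bar> \<le> R"
    "AE z in cyl. u z = U z + wave p' z"
    "integrable cyl (\<lambda>z. X z + F z (U z + wave p' z))"
    "\<And>x. periodic (\<lambda>t. X (t, x) + F (t, x) (U (t, x) + wave p' (t, x)))"
proof -
  obtain p' where p': "integrable circ p'" "periodic p'" "integral\<^sup>L circ p' = 0" "\<And>s. \<bar>p' s\<bar> \<le> R"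
      and pp': "AE z in cyl. wave p z = wave p' z"
    by (rule clamp_wave[OF p]) blast
  have up': "AE z in cyl. u z = U z + wave p' z"
    using up pp' by eventually_elim simp
  have [measurable]: "p' \<in> borel_measurable borel" "U \<in> borel_measurable borel2"
    using borel_measurable_integrable[OF p'(1)] continuous_measurable_pair[OF U(1)] by simp_all
  have "(\<lambda>z. F z (U z + wave p' z)) \<in> borel_measurable borel2"
    by (rule superposition_measurable[OF F(1)]) measurable
  then have "integrable cyl (\<lambda>z. F z (U z + wave p' z))"
    by (intro integrable_cong_AE_imp[OF Fu]) (auto intro!: eventually_mono[OF up'])
  then have "integrable cyl (\<lambda>z. X z + F z (U z + wave p' z))"
    using continuous_integrable_cyl[OF X(1)] by simp
  moreover have "periodic (\<lambda>t. X (t, x) + F (t, x) (U (t, x) + wave p' (t, x)))" for x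
    using X(2)[of x] U(2)[of x] F(2)[of x] periodic_wave[OF p'(2), of x] by (simp add: periodic_def)
  ultimately show thesis using p' up' by (intro that[of p'])
qed

lemma uniform_modulus:
  fixes \<Psi> :: "(real \<times> real) \<times> real \<Rightarrow> real"
  assumes cont: "continuous_on UNIV \<Psi>" and e: "e > 0"
  obtains \<delta> where "\<delta> > 0" "\<And>\<tau> t x y. \<bar>\<tau>\<bar> < \<delta> \<Longrightarrow> (t, x) \<in> Omega \<Longrightarrow> \<bar>y\<bar> \<le> R \<Longrightarrow> \<bar>\<Psi> ((t + \<tau>, x), y) - \<Psi> ((t, x), y)\<bar> \<le> e"
proof -
  \<comment> \<open>The time interval is enlarged by 1 on both sides to hold the translated points,
    hence the cap of the modulus at 1.\<close>
  define K where "K = ({- 1..2 * pi + 1} \<times> {0..pi}) \<times> {- R..R}"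
  have "compact K" unfolding K_def by (intro compact_Times) auto
  then have "uniformly_continuous_on K \<Psi>"
    using cont continuous_on_subset by (intro compact_uniformly_continuous) auto
  then obtain d where d: "d > 0" "\<And>k k'. k \<in> K \<Longrightarrow> k' \<in> K \<Longrightarrow> dist k' k < d \<Longrightarrow> dist (\<Psi> k') (\<Psi> k) < e"
    unfolding uniformly_continuous_on_def using e by meson
  show thesis
  proof (rule that[of "min d 1"])
    fix \<tau> t x y :: real assume \<tau>: "\<bar>\<tau>\<bar> < min d 1" and tx: "(t, x) \<in> Omega" and y: "\<bar>y\<bar> \<le> R"
    have "((t, x), y) \<in> K" "((t + \<tau>, x), y) \<in> K"
      using \<tau> tx y by (auto simp: K_def Omega_def)
    moreover have "dist ((t + \<tau>, x), y) ((t, x), y) < d"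
      using \<tau> by (simp add: dist_Pair_Pair dist_real_def)
    ultimately have "dist (\<Psi> ((t + \<tau>, x), y)) (\<Psi> ((t, x), y)) < e" by (intro d)
    then show "\<bar>\<Psi> ((t + \<tau>, x), y) - \<Psi> ((t, x), y)\<bar> \<le> e" by (simp add: dist_real_def)
  qed (use d in auto)
qed

text \<open>Insert the shifted kernel value y at the unshifted point. The first difference is small
  by uniform continuity, uniformly for |y| <= 2 R. The second has, by monotonicity, the sign of
  \<open>y - wave p z\<close>, which is \<open>wave\<close> of the increment of p.\<close>

lemma shifted_superposition_sign:
  fixes F :: "real \<times> real \<Rightarrow> real \<Rightarrow> real"
  assumes F: "continuous_on UNIV (\<lambda>(z, \<xi>). F z \<xi>)" "\<And>z. mono (F z)"
    and UX: "continuous_on UNIV U" "continuous_on UNIV X"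
    and bd: "\<And>s. \<bar>p s\<bar> \<le> R" and e: "e > 0"
  defines "H \<equiv> \<lambda>z. X z + F z (U z + wave p z)"
  shows "\<exists>\<delta>>0. \<forall>\<tau>. \<bar>\<tau>\<bar> < \<delta> \<longrightarrow>
    sign_bounded (wave (\<lambda>s. p (s + \<tau>) - p s)) (\<lambda>z. H (fst z + \<tau>, snd z) - H z) e"
proof -
  have "continuous_on UNIV (\<lambda>(z, y). X z + F z (U z + y))"
    unfolding split_beta'
    by (intro continuous_on_add superposition_continuous[OF F(1)] continuous_on_compose2[OF UX(1)]
      continuous_on_compose2[OF UX(2)] continuous_on_fst continuous_on_snd continuous_on_id) auto
  then obtain \<delta> where "\<delta> > 0" and C: "\<And>\<tau> t x y. \<bar>\<tau>\<bar> < \<delta> \<Longrightarrow> (t, x) \<in> Omega \<Longrightarrow> \<bar>y\<bar> \<le> 2 * R \<Longrightarrow>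
      \<bar>(\<lambda>(z, y). X z + F z (U z + y)) ((t + \<tau>, x), y) - (\<lambda>(z, y). X z + F z (U z + y)) ((t, x), y)\<bar> \<le> e"
    using e by (rule uniform_modulus) blast
  have "sign_bounded (wave (\<lambda>s. p (s + \<tau>) - p s)) (\<lambda>z. H (fst z + \<tau>, snd z) - H z) e"
    if \<tau>: "\<bar>\<tau>\<bar> < \<delta>" for \<tau>
    unfolding sign_bounded_def using AE_cyl_Omega
  proof eventually_elim
    case (elim z)
    obtain t x where z: "z = (t, x)" by (cases z)
    define y where "y = wave p (t + \<tau>, x)"
    have "\<bar>p (t + \<tau> + x)\<bar> \<le> R" "\<bar>p (t + \<tau> - x)\<bar> \<le> R" by (rule bd)+
    then have y: "\<bar>y\<bar> \<le> 2 * R" unfolding y_def wave_def split_beta' fst_conv snd_conv by linarith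
    have diff: "wave (\<lambda>s. p (s + \<tau>) - p s) z = y - wave p z"
      by (simp add: y_def z wave_def algebra_simps)
    have "\<bar>(X (t + \<tau>, x) + F (t + \<tau>, x) (U (t + \<tau>, x) + y)) - (X (t, x) + F (t, x) (U (t, x) + y))\<bar> \<le> e"
      using C[OF \<tau> _ y, of t x] elim by (simp add: z)
    moreover have "F (t, x) (U (t, x) + wave p z) \<le> F (t, x) (U (t, x) + y)" if "wave p z < y"
      using that by (intro monoD[OF F(2)]) simp
    moreover have "F (t, x) (U (t, x) + y) \<le> F (t, x) (U (t, x) + wave p z)" if "y < wave p z"
      using that by (intro monoD[OF F(2)]) simp
    ultimately show ?case
      unfolding diff H_def by (auto simp: z y_def[symmetric])
  qed
  with \<open>\<delta> > 0\<close> show ?thesis by blast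
qed

lemma continuous_component:
  assumes U: "continuous_on UNIV U" and p: "integrable circ p" "periodic p"
    and up: "AE z in cyl. u z = U z + wave p z"
    and uc: "\<And>\<eta>. \<eta> > 0 \<Longrightarrow> \<exists>\<delta>>0. \<forall>\<tau>. \<bar>\<tau>\<bar> < \<delta> \<longrightarrow> (AE s in circ. \<bar>p (s + \<tau>) - p s\<bar> \<le> \<eta>)"
  shows "\<exists>w. continuous_on UNIV w \<and> (AE z in cyl. u z = w z)"
proof -
  have mp: "p \<in> borel_measurable borel" using borel_measurable_integrable[OF p(1)] by simp
  obtain g where g: "continuous_on UNIV g" "AE s in lborel. p s = g s"
    using essentially_uniformly_continuous[OF mp p(2) uc] by blast
  have "AE z in cyl. wave p z = wave g z"
    by (intro AE_wave_cong mp borel_measurable_continuous_onI g)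
  with up have "AE z in cyl. u z = U z + wave g z" by eventually_elim simp
  moreover have "continuous_on UNIV (\<lambda>z. U z + wave g z)"
    unfolding wave_def split_beta'
    by (intro continuous_intros U continuous_on_compose2[OF g(1)]) auto
  ultimately show ?thesis by blast
qed

lemma increment_circ:
  fixes p :: "real \<Rightarrow> real"
  assumes p: "integrable circ p" "periodic p"
  shows "integrable circ (\<lambda>s. p (s + \<tau>) - p s)" "periodic (\<lambda>s. p (s + \<tau>) - p s)"
    "(\<integral>s. p (s + \<tau>) - p s \<partial>circ) = 0"
proof -
  note [measurable] = borel_measurable_seg[OF p(1)]
  have sh: "integrable circ (\<lambda>s. p (s + \<tau>))" "(\<integral>s. p (s + \<tau>) \<partial>circ) = integral\<^sup>L circ p"
    using circ_shift[of p \<tau>] p by auto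
  then show "integrable circ (\<lambda>s. p (s + \<tau>) - p s)" "(\<integral>s. p (s + \<tau>) - p s \<partial>circ) = 0"
    using p by auto
  show "periodic (\<lambda>s. p (s + \<tau>) - p s)"
    using p(2) p(2)[unfolded periodic_def, rule_format, of "_ + \<tau>"] by (simp add: periodic_def algebra_simps)
qed

lemma periodic_system_regularity:
  fixes F G :: "real \<times> real \<Rightarrow> real \<Rightarrow> real"
  assumes b: "\<bar>\<epsilon>\<bar> < b"
    and F: "continuous_on UNIV (\<lambda>(z, \<xi>). F z \<xi>)" "\<And>x \<xi>. periodic (\<lambda>t. F (t, x) \<xi>)" "\<And>z. mono (F z)"
    and G: "continuous_on UNIV (\<lambda>(z, \<xi>). G z \<xi>)" "\<And>x \<xi>. periodic (\<lambda>t. G (t, x) \<xi>)" "\<And>z. mono (G z)"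
    and u: "integrable cyl u" "\<And>x. periodic (\<lambda>t. u (t, x))"
    and v: "integrable cyl v" "\<And>x. periodic (\<lambda>t. v (t, x))"
    and Fu: "integrable cyl (\<lambda>z. F z (u z))" and Gv: "integrable cyl (\<lambda>z. G z (v z))"
    and relu: "\<And>j k. j \<ge> 1 \<Longrightarrow> of_int (j\<^sup>2 - k\<^sup>2) * cf u j k + cf (\<lambda>z. b * u z + \<epsilon> * v z + F z (u z)) j k = 0"
    and relv: "\<And>j k. j \<ge> 1 \<Longrightarrow> of_int (j\<^sup>2 - k\<^sup>2) * cf v j k + cf (\<lambda>z. b * v z + \<epsilon> * u z + G z (v z)) j k = 0"
  shows "\<exists>w. continuous_on UNIV w \<and> (AE z in cyl. u z = w z)"
    and "\<exists>w. continuous_on UNIV w \<and> (AE z in cyl. v z = w z)"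
proof -
  define hu where "hu = (\<lambda>z. b * u z + \<epsilon> * v z + F z (u z))"
  define hv where "hv = (\<lambda>z. b * v z + \<epsilon> * u z + G z (v z))"
  have hu: "integrable cyl hu" "periodic (\<lambda>t. hu (t, x))" and hv: "integrable cyl hv" "periodic (\<lambda>t. hv (t, x))" for x
    using u v Fu Gv F(2)[of x] G(2)[of x] by (auto simp: hu_def hv_def periodic_def)
  have [measurable]: "u \<in> borel_measurable borel2" "v \<in> borel_measurable borel2"
    "hu \<in> borel_measurable borel2" "hv \<in> borel_measurable borel2"
    using borel_measurable_integrable[OF u(1)] borel_measurable_integrable[OF v(1)]
      borel_measurable_integrable[OF hu(1)] borel_measurable_integrable[OF hv(1)] by simp_all
  \<comment> \<open>At j = |k| the factor j^2 - k^2 is 0, so the relations say that the sources have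
    no resonant coefficients.\<close>
  have orth: "kernel_orthogonal hu" "kernel_orthogonal hv"
  proof -
    have "cf hu j k = 0" "cf hv j k = 0" if "j \<ge> 1" "j = \<bar>k\<bar>" for j k
      using relu[of j k] relv[of j k] that by (auto simp: hu_def hv_def)
    then show "kernel_orthogonal hu" "kernel_orthogonal hv"
      by (intro resonance_orthogonal hu hv; blast)+
  qed
  obtain U p where U: "continuous_on UNIV U" "\<And>x. periodic (\<lambda>t. U (t, x))"
    and p: "integrable circ p" "periodic p" "integral\<^sup>L circ p = 0" and up: "AE z in cyl. u z = U z + wave p z"
    using wave_decomposition[OF u hu] relu unfolding hu_def by blast
  obtain V q where V: "continuous_on UNIV V" "\<And>x. periodic (\<lambda>t. V (t, x))"
    and q: "integrable circ q" "periodic q" "integral\<^sup>L circ q = 0" and vq: "AE z in cyl. v z = V z + wave q z"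
    using wave_decomposition[OF v hv] relv unfolding hv_def by blast
  \<comment> \<open>Of the linear terms, the continuous parts go into X and Y as data; the kernel
    parts stay explicit because b supplies the coercivity in \<open>sup_bound\<close>.\<close>
  define X where "X = (\<lambda>z. b * U z + \<epsilon> * V z)"
  define Y where "Y = (\<lambda>z. b * V z + \<epsilon> * U z)"
  have contX: "continuous_on UNIV X" "continuous_on UNIV Y"
    unfolding X_def Y_def by (intro continuous_intros U V)+
  have XY: "integrable cyl X" "integrable cyl Y"
    using contX by (auto intro: continuous_integrable_cyl)
  have perX: "periodic (\<lambda>t. X (t, x))" "periodic (\<lambda>t. Y (t, x))" for x
    using U(2)[of x] V(2)[of x] by (auto simp: X_def Y_def periodic_def)
  obtain C1 where C1: "C1 \<ge> 0" "\<And>C'. C' \<ge> C1 \<Longrightarrow> sign_bounded (wave p) (\<lambda>z. X z + F z (u z)) C'"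
    by (rule superposition_sign[OF F(1,3) U(1) contX(1) up]) blast
  obtain C2 where C2: "C2 \<ge> 0" "\<And>C'. C' \<ge> C2 \<Longrightarrow> sign_bounded (wave q) (\<lambda>z. Y z + G z (v z)) C'"
    by (rule superposition_sign[OF G(1,3) V(1) contX(2) vq]) blast
  define C where "C = max C1 C2"
  define R where "R = C / (b - \<bar>\<epsilon>\<bar>)"
  have C: "C \<ge> 0" using C1 by (simp add: C_def)
  then have R: "R \<ge> 0" using b by (simp add: R_def)
  have "AE s in circ. \<bar>p s\<bar> \<le> R \<and> \<bar>q s\<bar> \<le> R"
    unfolding R_def
  proof (rule sup_bound[where K="\<lambda>z. X z + F z (u z)" and L="\<lambda>z. Y z + G z (v z)", OF p q])
    show "integrable cyl (\<lambda>z. X z + F z (u z))" "integrable cyl (\<lambda>z. Y z + G z (v z))"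
      using XY Fu Gv by auto
    show "sign_bounded (wave p) (\<lambda>z. X z + F z (u z)) C"
      by (rule C1(2)) (simp add: C_def)
    show "sign_bounded (wave q) (\<lambda>z. Y z + G z (v z)) C"
      by (rule C2(2)) (simp add: C_def)
    have [measurable]: "p \<in> borel_measurable borel" "q \<in> borel_measurable borel"
      using borel_measurable_integrable[OF p(1)] borel_measurable_integrable[OF q(1)] by simp_all
    note [measurable] = borel_measurable_integrable[OF Fu, simplified] borel_measurable_integrable[OF Gv, simplified]
      continuous_measurable_pair[OF contX(1)] continuous_measurable_pair[OF contX(2)]
    show "kernel_orthogonal (\<lambda>z. b * wave p z + \<epsilon> * wave q z + (X z + F z (u z)))"
    proof (rule kernel_orthogonal_cong_AE[OF orth(1)])
      show "AE z in cyl. hu z = b * wave p z + \<epsilon> * wave q z + (X z + F z (u z))"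
        using up vq by eventually_elim (simp add: hu_def X_def algebra_simps)
    qed measurable
    show "kernel_orthogonal (\<lambda>z. b * wave q z + \<epsilon> * wave p z + (Y z + G z (v z)))"
    proof (rule kernel_orthogonal_cong_AE[OF orth(2)])
      show "AE z in cyl. hv z = b * wave q z + \<epsilon> * wave p z + (Y z + G z (v z))"
        using up vq by eventually_elim (simp add: hv_def Y_def algebra_simps)
    qed measurable
  qed (use C b in auto)
  then have bp: "AE s in circ. \<bar>p s\<bar> \<le> R" and bq: "AE s in circ. \<bar>q s\<bar> \<le> R"
    by (auto elim: eventually_mono)
  obtain p' where p': "integrable circ p'" "periodic p'" "integral\<^sup>L circ p' = 0" "\<And>s. \<bar>p' s\<bar> \<le> R"
      and up': "AE z in cyl. u z = U z + wave p' z"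
      and HX: "integrable cyl (\<lambda>z. X z + F z (U z + wave p' z))"
        "\<And>x. periodic (\<lambda>t. X (t, x) + F (t, x) (U (t, x) + wave p' (t, x)))"
    by (rule clamped_superposition[OF F(1,2) U contX(1) perX(1) p bp R up Fu]) blast
  obtain q' where q': "integrable circ q'" "periodic q'" "integral\<^sup>L circ q' = 0" "\<And>s. \<bar>q' s\<bar> \<le> R"
      and vq': "AE z in cyl. v z = V z + wave q' z"
      and HY: "integrable cyl (\<lambda>z. Y z + G z (V z + wave q' z))"
        "\<And>x. periodic (\<lambda>t. Y (t, x) + G (t, x) (V (t, x) + wave q' (t, x)))"
    by (rule clamped_superposition[OF G(1,2) V contX(2) perX(2) q bq R vq Gv]) blast
  define HX where "HX = (\<lambda>z. X z + F z (U z + wave p' z))"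
  define HY where "HY = (\<lambda>z. Y z + G z (V z + wave q' z))"
  have perH: "periodic (\<lambda>t. HX (t, x))" "periodic (\<lambda>t. HY (t, x))" for x
    using HX(2) HY(2) by (simp_all add: HX_def HY_def)
  have intH: "integrable cyl HX" "integrable cyl HY"
    using HX(1) HY(1) by (simp_all add: HX_def HY_def)
  have [measurable]: "HX \<in> borel_measurable borel2" "HY \<in> borel_measurable borel2"
    using borel_measurable_integrable[OF intH(1)] borel_measurable_integrable[OF intH(2)] by simp_all
  define ku where "ku = (\<lambda>z. b * wave p' z + \<epsilon> * wave q' z + HX z)"
  define kv where "kv = (\<lambda>z. b * wave q' z + \<epsilon> * wave p' z + HY z)"
  have aeX: "AE z in cyl. hu z = ku z"
    using up' vq' by eventually_elim (simp add: ku_def hu_def HX_def X_def algebra_simps)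
  have aeY: "AE z in cyl. hv z = kv z"
    using up' vq' by eventually_elim (simp add: kv_def hv_def HY_def Y_def algebra_simps)
  have ku: "integrable cyl ku" "periodic (\<lambda>t. ku (t, x))" and kv: "integrable cyl kv" "periodic (\<lambda>t. kv (t, x))" for x
    using intH integrable_wave[OF p'(1,2)] integrable_wave[OF q'(1,2)] perH[of x]
      periodic_wave[OF p'(2), of x] periodic_wave[OF q'(2), of x]
    by (auto simp: ku_def kv_def periodic_def)
  have [measurable]: "ku \<in> borel_measurable borel2" "kv \<in> borel_measurable borel2"
    using borel_measurable_integrable[OF ku(1)] borel_measurable_integrable[OF kv(1)] by simp_all
  have orthk: "kernel_orthogonal ku" "kernel_orthogonal kv"
    by (rule kernel_orthogonal_cong_AE[OF orth(1) aeX], measurable)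
      (rule kernel_orthogonal_cong_AE[OF orth(2) aeY], measurable)
  have modulus: "\<exists>\<delta>>0. \<forall>\<tau>. \<bar>\<tau>\<bar> < \<delta> \<longrightarrow> (AE s in circ. \<bar>p' (s + \<tau>) - p' s\<bar> \<le> \<eta>) \<and> (AE s in circ. \<bar>q' (s + \<tau>) - q' s\<bar> \<le> \<eta>)"
    if \<eta>: "\<eta> > 0" for \<eta>
  proof -
    \<comment> \<open>Chosen so that the bound e / (b - |\<epsilon>|) of \<open>sup_bound\<close>
      equals \<eta>.\<close>
    define e where "e = \<eta> * (b - \<bar>\<epsilon>\<bar>)"
    have e: "e > 0" using \<eta> b by (simp add: e_def)
    have "\<exists>\<delta>>0. \<forall>\<tau>. \<bar>\<tau>\<bar> < \<delta> \<longrightarrow>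
        sign_bounded (wave (\<lambda>s. p' (s + \<tau>) - p' s)) (\<lambda>z. HX (fst z + \<tau>, snd z) - HX z) e"
      unfolding HX_def by (rule shifted_superposition_sign[OF F(1,3) U(1) contX(1) p'(4) e])
    then obtain \<delta>1 where \<delta>1: "\<delta>1 > 0" "\<And>\<tau>. \<bar>\<tau>\<bar> < \<delta>1 \<Longrightarrow>
        sign_bounded (wave (\<lambda>s. p' (s + \<tau>) - p' s)) (\<lambda>z. HX (fst z + \<tau>, snd z) - HX z) e"
      by blast
    have "\<exists>\<delta>>0. \<forall>\<tau>. \<bar>\<tau>\<bar> < \<delta> \<longrightarrow>
        sign_bounded (wave (\<lambda>s. q' (s + \<tau>) - q' s)) (\<lambda>z. HY (fst z + \<tau>, snd z) - HY z) e"
      unfolding HY_def by (rule shifted_superposition_sign[OF G(1,3) V(1) contX(2) q'(4) e])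
    then obtain \<delta>2 where \<delta>2: "\<delta>2 > 0" "\<And>\<tau>. \<bar>\<tau>\<bar> < \<delta>2 \<Longrightarrow>
        sign_bounded (wave (\<lambda>s. q' (s + \<tau>) - q' s)) (\<lambda>z. HY (fst z + \<tau>, snd z) - HY z) e"
      by blast
    show ?thesis
    proof (rule exI[of _ "min \<delta>1 \<delta>2"], rule conjI, safe)
      fix \<tau> assume \<tau>: "\<bar>\<tau>\<bar> < min \<delta>1 \<delta>2"
      define P where "P = (\<lambda>s. p' (s + \<tau>) - p' s)"
      define Q where "Q = (\<lambda>s. q' (s + \<tau>) - q' s)"
      note P = increment_circ[OF p'(1,2), of \<tau>, folded P_def]
      note Q = increment_circ[OF q'(1,2), of \<tau>, folded Q_def]
      have dP: "wave P z = wave p' (fst z + \<tau>, snd z) - wave p' z"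
        and dQ: "wave Q z = wave q' (fst z + \<tau>, snd z) - wave q' z" for z
        by (simp_all add: P_def Q_def wave_def split_beta' algebra_simps)
      have "AE s in circ. \<bar>P s\<bar> \<le> e / (b - \<bar>\<epsilon>\<bar>) \<and> \<bar>Q s\<bar> \<le> e / (b - \<bar>\<epsilon>\<bar>)"
      proof (rule sup_bound[where K="\<lambda>z. HX (fst z + \<tau>, snd z) - HX z" and L="\<lambda>z. HY (fst z + \<tau>, snd z) - HY z", OF P Q])
        show "integrable cyl (\<lambda>z. HX (fst z + \<tau>, snd z) - HX z)" "integrable cyl (\<lambda>z. HY (fst z + \<tau>, snd z) - HY z)"
          using shear_integrable_iff[of HX "\<lambda>_. \<tau>"] shear_integrable_iff[of HY "\<lambda>_. \<tau>"] intH perH by (auto simp: split_beta')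
        show "sign_bounded (wave P) (\<lambda>z. HX (fst z + \<tau>, snd z) - HX z) e"
          unfolding P_def using \<tau> by (intro \<delta>1(2)) simp
        show "sign_bounded (wave Q) (\<lambda>z. HY (fst z + \<tau>, snd z) - HY z) e"
          unfolding Q_def using \<tau> by (intro \<delta>2(2)) simp
        have "(\<lambda>z. b * wave P z + \<epsilon> * wave Q z + (HX (fst z + \<tau>, snd z) - HX z)) = (\<lambda>z. ku (fst z + \<tau>, snd z) - ku z)"
          "(\<lambda>z. b * wave Q z + \<epsilon> * wave P z + (HY (fst z + \<tau>, snd z) - HY z)) = (\<lambda>z. kv (fst z + \<tau>, snd z) - kv z)"
          by (auto simp: dP dQ ku_def kv_def algebra_simps)
        then show "kernel_orthogonal (\<lambda>z. b * wave P z + \<epsilon> * wave Q z + (HX (fst z + \<tau>, snd z) - HX z))"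
          "kernel_orthogonal (\<lambda>z. b * wave Q z + \<epsilon> * wave P z + (HY (fst z + \<tau>, snd z) - HY z))"
          using kernel_orthogonal_increment[OF ku orthk(1)] kernel_orthogonal_increment[OF kv orthk(2)] by simp_all
      qed (use e b in auto)
      then show "AE s in circ. \<bar>p' (s + \<tau>) - p' s\<bar> \<le> \<eta>" "AE s in circ. \<bar>q' (s + \<tau>) - q' s\<bar> \<le> \<eta>"
        using b by (auto simp: P_def Q_def e_def)
    qed (use \<delta>1 \<delta>2 in auto)
  qed
  show "\<exists>w. continuous_on UNIV w \<and> (AE z in cyl. u z = w z)"
    by (rule continuous_component[OF U(1) p'(1,2) up']) (use modulus in blast)
  show "\<exists>w. continuous_on UNIV w \<and> (AE z in cyl. v z = w z)"
    by (rule continuous_component[OF V(1) q'(1,2) vq']) (use modulus in blast)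
qed

section \<open>Weak solutions\<close>

lemma C1_on_add: "C1_on S f \<Longrightarrow> C1_on S g \<Longrightarrow> C1_on S (\<lambda>z. f z + g z)"
  unfolding C1_on_def
proof (elim exE conjE)
  fix f' g'
  assume *: "\<forall>z\<in>S. (f has_derivative blinfun_apply (f' z)) (at z within S)" "continuous_on S f'"
    "\<forall>z\<in>S. (g has_derivative blinfun_apply (g' z)) (at z within S)" "continuous_on S g'"
  show "\<exists>h'. (\<forall>z\<in>S. ((\<lambda>z. f z + g z) has_derivative blinfun_apply (h' z)) (at z within S)) \<and> continuous_on S h'"
  proof (intro exI[of _ "\<lambda>z. f' z + g' z"] conjI ballI)
    fix z assume "z \<in> S"
    then show "((\<lambda>z. f z + g z) has_derivative blinfun_apply (f' z + g' z)) (at z within S)"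
      using has_derivative_add[of f "blinfun_apply (f' z)" "at z within S" g "blinfun_apply (g' z)"] *
      by (simp add: plus_blinfun.rep_eq)
  qed (use * in \<open>auto intro!: continuous_intros\<close>)
qed

text \<open>The factor e lies in an arbitrary normed space so that \<open>C1_on_product\<close> also
  applies to the two summands of this derivative, where e is itself a bounded linear map. Second
  derivatives then need no separate computation.\<close>

definition product_derivative ::
  "(real \<Rightarrow> real) \<Rightarrow> (real \<Rightarrow> real) \<Rightarrow> (real \<Rightarrow> real) \<Rightarrow> (real \<Rightarrow> real) \<Rightarrow> 'b::real_normed_vector \<Rightarrow> real \<times> real \<Rightarrow> (real \<times> real) \<Rightarrow>\<^sub>L 'b" where
  "product_derivative A A' B B' e z =
     (A' (fst z) * B (snd z)) *\<^sub>R (blinfun_scaleR_left e o\<^sub>L fst_blinfun)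
   + (A (fst z) * B' (snd z)) *\<^sub>R (blinfun_scaleR_left e o\<^sub>L snd_blinfun)"

lemma product_has_derivative:
  assumes "\<And>t. (A has_real_derivative A' t) (at t)" "\<And>x. (B has_real_derivative B' x) (at x)"
  shows "((\<lambda>z. (A (fst z) * B (snd z)) *\<^sub>R e) has_derivative blinfun_apply (product_derivative A A' B B' e z)) (at z within S)"
proof -
  have A: "((\<lambda>z. A (fst z)) has_derivative (\<lambda>w. fst w * A' (fst z))) (at z within S)"
    using has_derivative_compose[OF bounded_linear_imp_has_derivative[OF bounded_linear_fst], of A "\<lambda>h. h * A' (fst z)" z S]
      assms(1)[of "fst z"] by (simp add: has_field_derivative_def mult_commute_abs)
  have B: "((\<lambda>z. B (snd z)) has_derivative (\<lambda>w. snd w * B' (snd z))) (at z within S)"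
    using has_derivative_compose[OF bounded_linear_imp_has_derivative[OF bounded_linear_snd], of B "\<lambda>h. h * B' (snd z)" z S]
      assms(2)[of "snd z"] by (simp add: has_field_derivative_def mult_commute_abs)
  have "((\<lambda>z. (A (fst z) * B (snd z)) *\<^sub>R e) has_derivative
     (\<lambda>w. (A (fst z) * (snd w * B' (snd z)) + fst w * A' (fst z) * B (snd z)) *\<^sub>R e)) (at z within S)"
    by (intro has_derivative_scaleR_left has_derivative_mult A B)
  also have "(\<lambda>w. (A (fst z) * (snd w * B' (snd z)) + fst w * A' (fst z) * B (snd z)) *\<^sub>R e)
     = blinfun_apply (product_derivative A A' B B' e z)"
    by (rule ext) (simp add: product_derivative_def plus_blinfun.rep_eq scaleR_blinfun.rep_eq algebra_simps)
  finally show ?thesis .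
qed

lemma C1_on_product:
  assumes "\<And>t. (A has_real_derivative A' t) (at t)" "\<And>x. (B has_real_derivative B' x) (at x)"
    and cont: "continuous_on UNIV A'" "continuous_on UNIV B'"
  shows "C1_on UNIV (\<lambda>z. (A (fst z) * B (snd z)) *\<^sub>R e)"
  unfolding C1_on_def
proof (intro exI conjI ballI)
  have AB: "continuous_on UNIV A" "continuous_on UNIV B"
    using assms(1,2) by (auto intro: DERIV_continuous_on)
  show "((\<lambda>z. (A (fst z) * B (snd z)) *\<^sub>R e) has_derivative blinfun_apply (product_derivative A A' B B' e z)) (at z within UNIV)" for z
    by (rule product_has_derivative[OF assms(1,2)])
  show "continuous_on UNIV (product_derivative A A' B B' e)"
    unfolding product_derivative_def[abs_def]
    by (intro continuous_intros continuous_on_compose2[OF AB(1)] continuous_on_compose2[OF AB(2)]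
      continuous_on_compose2[OF cont(1)] continuous_on_compose2[OF cont(2)]) auto
qed

lemma C2_on_product:
  assumes A: "\<And>t. (A has_real_derivative A' t) (at t)" "\<And>t. (A' has_real_derivative A'' t) (at t)" "continuous_on UNIV A''"
    and B: "\<And>x. (B has_real_derivative B' x) (at x)" "\<And>x. (B' has_real_derivative B'' x) (at x)" "continuous_on UNIV B''"
  shows "C2_on UNIV (\<lambda>z. A (fst z) * B (snd z))"
  unfolding C2_on_def
proof (intro exI conjI ballI)
  show "((\<lambda>z. A (fst z) * B (snd z)) has_derivative blinfun_apply (product_derivative A A' B B' (1::real) z)) (at z within UNIV)" for z
    using product_has_derivative[where e="1::real", OF A(1) B(1), of z UNIV] by simp
  have cont: "continuous_on UNIV A'" "continuous_on UNIV B'"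
    by (rule DERIV_continuous_on, rule A(2)) (rule DERIV_continuous_on, rule B(2))
  show "C1_on UNIV (product_derivative A A' B B' (1::real))"
    unfolding product_derivative_def[abs_def]
    by (intro C1_on_add C1_on_product[OF A(2) B(1) A(3) cont(2)] C1_on_product[OF A(1) B(2) cont(1) B(3)])
qed

lemma partial_t_product:
  assumes "\<And>t. (A has_real_derivative A' t) (at t)"
  shows "partial_t (\<lambda>z. A (fst z) * B (snd z)) = (\<lambda>z. A' (fst z) * B (snd z))"
proof (rule ext, unfold partial_t_def split_beta' fst_conv snd_conv)
  fix z :: "real \<times> real"
  show "deriv (\<lambda>s. A s * B (snd z)) (fst z) = A' (fst z) * B (snd z)"
    by (intro DERIV_imp_deriv DERIV_cmult_right assms)
qed

lemma partial_x_product: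
  assumes "\<And>x. (B has_real_derivative B' x) (at x)"
  shows "partial_x (\<lambda>z. A (fst z) * B (snd z)) = (\<lambda>z. A (fst z) * B' (snd z))"
proof (rule ext, unfold partial_x_def split_beta' fst_conv snd_conv)
  fix z :: "real \<times> real"
  show "deriv (\<lambda>y. A (fst z) * B y) (snd z) = A (fst z) * B' (snd z)"
    by (intro DERIV_imp_deriv DERIV_cmult assms)
qed

section \<open>Transfer from Lebesgue measure on \<open>Omega\<close> to the cylinder\<close>

lemma Omega_sets [measurable]: "Omega \<in> sets borel" "Omega \<in> sets lebesgue"
  using compact_Omega by (auto intro: borel_compact lmeasurable_compact fmeasurableD)

lemma AE_lebesgue_on_Omega: "(AE z in lebesgue_on Omega. P z) \<longleftrightarrow> (AE z in cyl. P z)"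
proof -
  have "(AE z in lebesgue_on Omega. P z) \<longleftrightarrow> (AE z in lebesgue. z \<in> Omega \<longrightarrow> P z)"
    by (rule AE_restrict_space_iff) simp
  also have "\<dots> \<longleftrightarrow> (AE z in lborel. z \<in> Omega \<longrightarrow> P z)"
    by (rule AE_completion_iff)
  also have "\<dots> \<longleftrightarrow> (AE z in cyl. P z)"
    unfolding cyl_eq_density by (subst AE_density) (auto simp: indicator_def)
  finally show ?thesis .
qed

lemma lebesgue_on_Omega_borel:
  fixes X :: "real \<times> real \<Rightarrow> 'b::{banach, second_countable_topology}"
  assumes X: "X \<in> borel_measurable borel"
  shows "X \<in> borel_measurable (lebesgue_on Omega)"
    and "integrable (lebesgue_on Omega) X \<longleftrightarrow> integrable cyl X"
    and "integral\<^sup>L (lebesgue_on Omega) X = integral\<^sup>L cyl X"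
proof -
  let ?X = "\<lambda>z. indicat_real Omega z *\<^sub>R X z"
  have mX: "X \<in> borel_measurable lborel" using X by simp
  show "X \<in> borel_measurable (lebesgue_on Omega)"
    by (intro measurable_restrict_space1 measurable_completion mX)
  have ind: "(\<lambda>z. indicat_real Omega z *\<^sub>R X z) \<in> borel_measurable lborel"
    using X by measurable
  have "integrable (lebesgue_on Omega) X \<longleftrightarrow> integrable lebesgue ?X"
    by (rule integrable_restrict_space) simp
  also have "\<dots> \<longleftrightarrow> integrable lborel ?X"
    by (rule integrable_completion[OF ind])
  also have "\<dots> \<longleftrightarrow> integrable cyl X"
    unfolding cyl_eq_density using mX by (subst integrable_density) auto
  finally show "integrable (lebesgue_on Omega) X \<longleftrightarrow> integrable cyl X" .
  have "integral\<^sup>L (lebesgue_on Omega) X = integral\<^sup>L lebesgue ?X"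
    by (rule integral_restrict_space) simp
  also have "\<dots> = integral\<^sup>L lborel ?X"
    by (rule integral_completion[OF ind])
  also have "\<dots> = integral\<^sup>L cyl X"
    unfolding cyl_eq_density using mX by (subst integral_density) auto
  finally show "integral\<^sup>L (lebesgue_on Omega) X = integral\<^sup>L cyl X" .
qed

lemma fourier_coeff_product:
  assumes A: "continuous_on UNIV A" and j: "j \<ge> 1"
  shows "fourier_coeff (\<lambda>z. A (fst z) * sin (of_int j * snd z)) j' k'
    = (\<integral>t. of_real (A t) * cis (- (of_int k' * t)) \<partial>circ)
      * complex_of_real (\<integral>x. sin (of_int j * x) * sin (of_int (int j') * x) \<partial>seg 0 pi) / (of_real pi)\<^sup>2"
proof -
  let ?X = "\<lambda>z. complex_of_real (A (fst z) * sin (of_int j * snd z) * sin (of_nat j' * snd z)) * cis (- (of_int k' * fst z))"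
  let ?A = "\<lambda>t. complex_of_real (A t) * cis (- (of_int k' * t))"
  let ?B = "\<lambda>x. sin (of_int j * x) * sin (of_int (int j') * x)"
  have [measurable]: "A \<in> borel_measurable borel" using A by (rule borel_measurable_continuous_onI)
  have "continuous_on UNIV (\<lambda>z::real \<times> real. ?X z)"
    by (intro continuous_intros continuous_on_compose2[OF A]) auto
  then have m: "(\<lambda>z::real \<times> real. ?X z) \<in> borel_measurable borel"
    by (rule borel_measurable_continuous_onI)
  have iA: "integrable circ (\<lambda>t. ?A t)"
    by (intro integrable_seg_bounded continuous_intros continuous_on_subset[OF A]) auto
  have iB: "integrable (seg 0 pi) (\<lambda>x. complex_of_real (?B x))"
    by (intro integrable_seg_bounded continuous_intros) measurable
  have "fourier_coeff (\<lambda>z. A (fst z) * sin (of_int j * snd z)) j' k'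
    = (\<integral>z. ?X z \<partial>cyl) / (of_real pi)\<^sup>2"
    unfolding fourier_coeff_def split_beta' fst_conv snd_conv prod.collapse
    by (subst lebesgue_on_Omega_borel(3)[OF m]) simp
  also have "(\<integral>z. ?X z \<partial>cyl)
    = (\<integral>(t, x). (?A t) * of_real (?B x) \<partial>cyl)"
    by (intro Bochner_Integration.integral_cong) auto
  also have "\<dots> = (\<integral>t. ?A t \<partial>circ)
      * complex_of_real (\<integral>x. ?B x \<partial>seg 0 pi)"
    by (simp only: cyl_product(2)[OF iA iB] integral_complex_of_real)
  finally show ?thesis .
qed

text \<open>The sum defining membership in \<open>H_space\<close> is finite: orthogonality in x
  leaves only the index j, and \<open>spec\<close> leaves only the frequencies k and - k.\<close>

lemma product_test_function:
  assumes A: "\<And>t. (A has_real_derivative A' t) (at t)" "\<And>t. (A' has_real_derivative - (of_int k)\<^sup>2 * A t) (at t)"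
    and per: "periodic A" and j: "j \<ge> 1"
    and spec: "\<And>k'. k' \<noteq> k \<Longrightarrow> k' \<noteq> - k \<Longrightarrow> (\<integral>t. of_real (A t) * cis (- (of_int k' * t)) \<partial>circ) = 0"
  defines "\<phi> \<equiv> \<lambda>z. A (fst z) * sin (of_int j * snd z)"
  shows "\<phi> \<in> test_functions b" and "wave_op \<phi> z = of_int (j\<^sup>2 - k\<^sup>2) * \<phi> z"
proof -
  let ?h = "\<lambda>j' k'. pi\<^sup>2 * H_weight b j' k' * (cmod (fourier_coeff \<phi> j' k'))\<^sup>2"
  have contA: "continuous_on UNIV A" using A(1) by (auto intro: DERIV_continuous_on)
  have cont\<phi>: "continuous_on UNIV \<phi>"
    unfolding \<phi>_def by (intro continuous_intros continuous_on_compose2[OF contA]) auto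
  have S: "((\<lambda>x. sin (of_int j * x)) has_real_derivative of_int j * cos (of_int j * x)) (at x)"
    "((\<lambda>x. of_int j * cos (of_int j * x)) has_real_derivative - (of_int j)\<^sup>2 * sin (of_int j * x)) (at x)" for x
    by (auto intro!: derivative_eq_intros simp: power2_eq_square)
  show "wave_op \<phi> z = of_int (j\<^sup>2 - k\<^sup>2) * \<phi> z"
    unfolding wave_op_def \<phi>_def
      partial_t_product[OF A(1), where B="\<lambda>x. sin (of_int j * x)"] partial_t_product[OF A(2), where B="\<lambda>x. sin (of_int j * x)"]
      partial_x_product[OF S(1), where A=A] partial_x_product[OF S(2), where A=A]
    by (simp add: algebra_simps)
  have C2: "C2_on UNIV \<phi>"
    unfolding \<phi>_def
    by (intro C2_on_product[OF A(1) A(2) _ S(1) S(2)] continuous_intros contA)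
  have m: "\<phi> \<in> borel_measurable borel" "(\<lambda>z. (\<phi> z)\<^sup>2) \<in> borel_measurable borel"
    using cont\<phi> by (auto intro!: borel_measurable_continuous_onI continuous_intros)
  have "\<phi> \<in> L2_Omega"
    unfolding L2_Omega_def mem_Collect_eq lebesgue_on_Omega_borel(2)[OF m(2)]
    using lebesgue_on_Omega_borel(1)[OF m(1)] cont\<phi> by (auto intro!: continuous_integrable_cyl continuous_intros)
  moreover have "(\<lambda>(j', k'). ?h j' k') summable_on ({1..} \<times> UNIV)"
  proof (rule finite_nonzero_values_imp_summable_on, rule finite_subset)
    show "{p \<in> {1..} \<times> UNIV. (case p of (j', k') \<Rightarrow> ?h j' k') \<noteq> 0} \<subseteq> {nat j} \<times> {k, - k}"
    proof (rule subsetI)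
      fix p assume "p \<in> {p \<in> {1..} \<times> UNIV. (case p of (j', k') \<Rightarrow> ?h j' k') \<noteq> 0}"
      then obtain j' k' where p: "p = (j', k')" and nz: "fourier_coeff \<phi> j' k' \<noteq> 0" by (cases p) auto
      have "j' = nat j"
      proof (rule ccontr)
        assume "j' \<noteq> nat j"
        then have ne: "j \<noteq> \<bar>int j'\<bar>" using j by auto
        have "fourier_coeff \<phi> j' k' = 0"
          unfolding \<phi>_def fourier_coeff_product[OF contA j] sin_orthogonal[OF j ne] by simp
        then show False using nz by simp
      qed
      moreover have "k' = k \<or> k' = - k"
      proof (rule ccontr)
        assume "\<not> (k' = k \<or> k' = - k)"
        then have "fourier_coeff \<phi> j' k' = 0"
          unfolding \<phi>_def fourier_coeff_product[OF contA j] using spec[of k'] by simp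
        then show False using nz by simp
      qed
      ultimately show "p \<in> {nat j} \<times> {k, - k}" by (auto simp: p)
    qed
  qed simp
  ultimately have "\<phi> \<in> H_space b" by (simp add: H_space_def)
  moreover have "\<phi> (t + 2 * pi, x) = \<phi> (t, x)" for t x
    using per by (simp add: \<phi>_def periodic_def)
  moreover have "\<phi> (t, 0) = 0 \<and> \<phi> (t, pi) = 0" for t
    by (simp add: \<phi>_def sin_int_pi)
  ultimately show "\<phi> \<in> test_functions b"
    using C2 by (simp add: test_functions_def)
qed

lemma integrable_circ_cis: "integrable circ (\<lambda>t. cis (- (of_int k * t)))"
  by (rule seg.integrable_const_bound[of _ 1]) auto

lemma trig_test_function:
  fixes j k :: int
  assumes j: "j \<ge> 1" and A: "A = cos \<or> A = (sin :: real \<Rightarrow> real)"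
  defines "\<phi> \<equiv> \<lambda>z. A (of_int k * fst z) * sin (of_int j * snd z)"
  shows "\<phi> \<in> test_functions b" "wave_op \<phi> z = of_int (j\<^sup>2 - k\<^sup>2) * \<phi> z"
proof -
  obtain A' where d: "\<And>t. (A has_real_derivative A' t) (at t)" "\<And>t. (A' has_real_derivative - A t) (at t)"
  proof (rule disjE[OF A])
    assume "A = cos"
    then show thesis by (intro that[of "\<lambda>t. - sin t"]) (auto intro!: derivative_eq_intros)
  next
    assume "A = sin"
    then show thesis by (intro that[of cos]) (auto intro!: derivative_eq_intros)
  qed
  have per: "periodic (\<lambda>t. A (of_int k * t))"
    using A periodic_trig by auto
  obtain c c' where expand: "\<And>s. of_real (A s) = c * cis s + c' * cis (- s)"
  proof (rule disjE[OF A])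
    assume "A = cos"
    then show thesis by (intro that[of "1/2" "1/2"]) (simp add: complex_eq_iff)
  next
    assume "A = sin"
    then show thesis by (intro that[of "- \<i>/2" "\<i>/2"]) (simp add: complex_eq_iff)
  qed
  have eq: "of_real (A (of_int k * t)) * cis (- (of_int k' * t))
      = c * cis (- (of_int (k' - k) * t)) + c' * cis (- (of_int (k' + k) * t))" for k' t
  proof -
    have "of_int k * t + - (of_int k' * t) = - (of_int (k' - k) * t)"
      "- (of_int k * t) + - (of_int k' * t) = - (of_int (k' + k) * t)"
      by (simp_all add: algebra_simps)
    then show ?thesis by (simp only: expand distrib_right mult.assoc cis_mult)
  qed
  have spec: "(\<integral>t. of_real (A (of_int k * t)) * cis (- (of_int k' * t)) \<partial>circ) = 0" if "k' \<noteq> k" "k' \<noteq> - k" for k'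
    unfolding eq using that
    by (simp add: integral_cis integrable_circ_cis eq_neg_iff_add_eq_0 del: of_int_diff of_int_add)
  have lin: "((\<lambda>t. of_int k * t) has_real_derivative of_int k) (at t)" for t :: real
    by (auto intro!: derivative_eq_intros)
  have d1: "((\<lambda>t. A (of_int k * t)) has_real_derivative of_int k * A' (of_int k * t)) (at t)" for t
    using DERIV_chain2[OF d(1) lin, of t] by (simp add: mult.commute)
  have d2: "((\<lambda>t. of_int k * A' (of_int k * t)) has_real_derivative - (of_int k)\<^sup>2 * A (of_int k * t)) (at t)" for t
    using DERIV_cmult[OF DERIV_chain2[OF d(2) lin, of t], of "of_int k"] by (simp add: power2_eq_square mult_ac)
  show "\<phi> \<in> test_functions b" "wave_op \<phi> z = of_int (j\<^sup>2 - k\<^sup>2) * \<phi> z"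
    unfolding \<phi>_def by (rule product_test_function[OF d1 d2 per j spec]; assumption)+
qed

text \<open>Test functions are real, so a complex coefficient is reached through its cosine and sine
  parts.\<close>

lemma cf_eq_real:
  assumes "integrable cyl X"
  shows "cf X j k = complex_of_real (\<integral>z. X z * (cos (of_int k * fst z) * sin (of_int j * snd z)) \<partial>cyl)
    - \<i> * complex_of_real (\<integral>z. X z * (sin (of_int k * fst z) * sin (of_int j * snd z)) \<partial>cyl)"
proof -
  have int: "integrable cyl (\<lambda>z. X z * (cos (of_int k * fst z) * sin (of_int j * snd z)))"
    "integrable cyl (\<lambda>z. X z * (sin (of_int k * fst z) * sin (of_int j * snd z)))"
    by (rule integrable_mult_bounded[OF assms, where B=1]; auto simp: abs_mult intro!: mult_le_one)+
  have "cf X j k = (\<integral>z. complex_of_real (X z * (cos (of_int k * fst z) * sin (of_int j * snd z)))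
    - \<i> * complex_of_real (X z * (sin (of_int k * fst z) * sin (of_int j * snd z))) \<partial>cyl)"
    unfolding cf_def by (intro Bochner_Integration.integral_cong refl) (simp add: complex_eq_iff)
  also have "\<dots> = complex_of_real (\<integral>z. X z * (cos (of_int k * fst z) * sin (of_int j * snd z)) \<partial>cyl)
    - \<i> * complex_of_real (\<integral>z. X z * (sin (of_int k * fst z) * sin (of_int j * snd z)) \<partial>cyl)"
    using int by (subst Bochner_Integration.integral_diff) (simp_all del: of_real_mult)
  finally show ?thesis .
qed

text \<open>The modes are eigenfunctions of \<open>wave_op\<close> with eigenvalue j^2 - k^2. The
  integral is moved to the Borel representatives as a whole and split only there, where each piece
  is known to be integrable.\<close>

lemma weak_equation_coefficients:
  assumes weak: "\<And>\<phi>. \<phi> \<in> test_functions b \<Longrightarrow>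
      (\<integral>z. u z * wave_op \<phi> z + b * u z * \<phi> z + \<epsilon> * v z * \<phi> z + m z * \<phi> z \<partial>lebesgue_on Omega) = 0"
    and meas: "u \<in> borel_measurable (lebesgue_on Omega)" "v \<in> borel_measurable (lebesgue_on Omega)"
      "m \<in> borel_measurable (lebesgue_on Omega)"
    and u': "integrable cyl u'" "AE z in cyl. u z = u' z"
    and v': "integrable cyl v'" "AE z in cyl. v z = v' z"
    and m': "integrable cyl m'" "AE z in cyl. m z = m' z"
    and j: "j \<ge> 1"
  shows "of_int (j\<^sup>2 - k\<^sup>2) * cf u' j k + cf (\<lambda>z. b * u' z + \<epsilon> * v' z + m' z) j k = 0"
proof -
  have [measurable]: "u' \<in> borel_measurable borel" "v' \<in> borel_measurable borel" "m' \<in> borel_measurable borel"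
    using borel_measurable_integrable[OF u'(1)] borel_measurable_integrable[OF v'(1)] borel_measurable_integrable[OF m'(1)]
    by (simp_all add: measurable_cong_sets[OF sets_cyl refl])
  define X where "X = (\<lambda>z. b * u' z + \<epsilon> * v' z + m' z)"
  have X: "integrable cyl X" unfolding X_def using u' v' m' by auto
  define D where "D = real_of_int (j\<^sup>2 - k\<^sup>2)"
  have key: "D * (\<integral>z. u' z * \<phi> z \<partial>cyl) + (\<integral>z. X z * \<phi> z \<partial>cyl) = 0"
    if \<phi>: "\<phi> \<in> test_functions b" "\<And>z. wave_op \<phi> z = D * \<phi> z" and cont: "continuous_on UNIV \<phi>" and bd: "\<And>z. \<bar>\<phi> z\<bar> \<le> 1" for \<phi>
  proof -
    let ?L = "\<lambda>z. u z * (D * \<phi> z) + b * u z * \<phi> z + \<epsilon> * v z * \<phi> z + m z * \<phi> z"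
    let ?R = "\<lambda>z. D * (u' z * \<phi> z) + X z * \<phi> z"
    have [measurable]: "\<phi> \<in> borel_measurable borel" using cont by (rule borel_measurable_continuous_onI)
    have mcyl: "\<phi> \<in> borel_measurable cyl" by (simp add: measurable_cong_sets[OF sets_cyl refl])
    have int: "integrable cyl (\<lambda>z. u' z * \<phi> z)" "integrable cyl (\<lambda>z. X z * \<phi> z)"
      by (rule integrable_mult_bounded[OF u'(1) mcyl, of 1], use bd in simp)
        (rule integrable_mult_bounded[OF X mcyl, of 1], use bd in simp)
    have mb: "(\<lambda>z. ?R z) \<in> borel_measurable borel"
      unfolding X_def by measurable
    have "0 = (\<integral>z. ?L z \<partial>lebesgue_on Omega)"
      using weak[OF \<phi>(1)] by (simp add: \<phi>(2))
    also have "\<dots> = (\<integral>z. ?R z \<partial>lebesgue_on Omega)"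
    proof (rule integral_cong_AE)
      show "(\<lambda>z. ?L z) \<in> borel_measurable (lebesgue_on Omega)"
        using meas lebesgue_on_Omega_borel(1)[of \<phi>] by auto
      show "(\<lambda>z. ?R z) \<in> borel_measurable (lebesgue_on Omega)"
        by (rule lebesgue_on_Omega_borel(1)[OF mb])
      show "AE z in lebesgue_on Omega. ?L z = ?R z"
        unfolding AE_lebesgue_on_Omega using u'(2) v'(2) m'(2)
        by eventually_elim (simp add: X_def algebra_simps)
    qed
    also have "\<dots> = (\<integral>z. ?R z \<partial>cyl)"
      by (rule lebesgue_on_Omega_borel(3)[OF mb])
    also have "\<dots> = D * (\<integral>z. u' z * \<phi> z \<partial>cyl) + (\<integral>z. X z * \<phi> z \<partial>cyl)"
      using int by simp
    finally show ?thesis by simp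
  qed
  have c: "D * (\<integral>z. u' z * (cos (of_int k * fst z) * sin (of_int j * snd z)) \<partial>cyl)
     + (\<integral>z. X z * (cos (of_int k * fst z) * sin (of_int j * snd z)) \<partial>cyl) = 0"
    unfolding D_def[symmetric]
    by (intro key trig_test_function[OF j, of cos k, folded D_def] continuous_intros) (simp_all add: abs_mult mult_le_one)
  have s: "D * (\<integral>z. u' z * (sin (of_int k * fst z) * sin (of_int j * snd z)) \<partial>cyl)
     + (\<integral>z. X z * (sin (of_int k * fst z) * sin (of_int j * snd z)) \<partial>cyl) = 0"
    by (intro key trig_test_function[OF j, of sin k, folded D_def] continuous_intros) (simp_all add: abs_mult mult_le_one)
  have "complex_of_int (j\<^sup>2 - k\<^sup>2) = complex_of_real D" by (simp add: D_def)
  then show ?thesis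
    unfolding X_def[symmetric] cf_eq_real[OF u'(1)] cf_eq_real[OF X]
    using c s by (simp add: complex_eq_iff)
qed


section \<open>Periodic representatives and extensions\<close>

text \<open>A Borel version comes from the completion, and reducing t modulo 2 pi makes it periodic;
  for interior points the floor is 0, so nothing changes there.\<close>

lemma periodic_representative:
  fixes u :: "real \<times> real \<Rightarrow> real"
  assumes u: "u \<in> borel_measurable (lebesgue_on Omega)"
  obtains u' where "u' \<in> borel_measurable borel2" "\<And>x. periodic (\<lambda>t. u' (t, x))"
    "AE z in cyl. u z = u' z"
proof -
  have "(\<lambda>z. indicat_real Omega z *\<^sub>R u z) \<in> borel_measurable lebesgue"
    using u by (subst (asm) borel_measurable_restrict_space_iff) auto
  then obtain u0 where u0: "u0 \<in> borel_measurable lborel" "AE z in lborel. indicat_real Omega z *\<^sub>R u z = u0 z"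
    using completion_ex_borel_measurable_real by blast
  have [measurable]: "u0 \<in> borel_measurable borel2"
    using u0(1) unfolding measurable_borel_prod[symmetric] by simp
  define u' where "u' = (\<lambda>z. u0 (fst z - of_int \<lfloor>fst z / (2 * pi)\<rfloor> * (2 * pi), snd z))"
  show thesis
  proof (rule that)
    show "u' \<in> borel_measurable borel2" unfolding u'_def by measurable
    have "(t + 2 * pi) / (2 * pi) = t / (2 * pi) + 1" for t :: real
      by (simp add: field_simps)
    then show "periodic (\<lambda>t. u' (t, x))" for x
      by (simp add: periodic_def u'_def algebra_simps)
    have "AE z in cyl. u z = u0 z"
      unfolding cyl_eq_density using u0(2) by (subst AE_density) (auto simp: indicator_def elim!: eventually_mono)
    then show "AE z in cyl. u z = u' z"
      using AE_cyl_interior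
    proof eventually_elim
      case (elim z)
      then have "\<lfloor>fst z / (2 * pi)\<rfloor> = 0" by (simp add: floor_eq_iff)
      then show ?case using elim(1) by (simp add: u'_def)
    qed
  qed
qed

text \<open>Clipping \<open>x\<close> to \<open>[0, \<pi>]\<close> makes the nonlinearities continuous and monotone on the whole plane.\<close>

definition clip :: "real \<Rightarrow> real" where
  "clip x = max 0 (min pi x)"

text \<open>Continuity on \<open>Omega\<close> is one-sided at t = 0 and t = 2 pi. On each closed
  strip of one period the extension is a translate of f, and two neighbouring strips are pasted
  together.\<close>

lemma periodic_extension_continuous:
  fixes f :: "real \<times> real \<Rightarrow> real \<Rightarrow> real"
  assumes cont: "continuous_on (Omega \<times> UNIV) (\<lambda>(z, \<xi>). f z \<xi>)"
    and per: "\<And>t x \<xi>. x \<in> {0..pi} \<Longrightarrow> f (t + 2 * pi, x) \<xi> = f (t, x) \<xi>"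
  shows "continuous_on UNIV (\<lambda>(z, \<xi>). f (fst z, clip (snd z)) \<xi>)"
proof (rule continuous_at_imp_continuous_on, rule ballI)
  let ?m = "\<lambda>(n::int) y :: (real \<times> real) \<times> real. ((fst (fst y) - of_int n * (2 * pi), clip (snd (fst y))), snd y)"
  define H where "H = (\<lambda>(z, \<xi>). f (fst z, clip (snd z)) \<xi>)"
  have clip: "clip x \<in> {0..pi}" for x by (auto simp: clip_def)
  have contc: "continuous_on UNIV clip" unfolding clip_def by (intro continuous_intros)
  define S where "S = (\<lambda>n::int. ({of_int n * (2 * pi)..of_int (n + 1) * (2 * pi)} \<times> (UNIV :: real set)) \<times> (UNIV :: real set))"
  have contS: "continuous_on (S n) H" for n
  proof -
    have eq: "H y = (\<lambda>(z, \<xi>). f z \<xi>) (?m n y)" for y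
    proof -
      have "periodic (\<lambda>t. f (t, clip (snd (fst y))) (snd y))"
        using per[OF clip] by (simp add: periodic_def)
      from periodic_add_int[OF this, of "fst (fst y) - of_int n * (2 * pi)" n]
      show ?thesis by (simp add: H_def split_beta')
    qed
    have "continuous_on (S n) (\<lambda>y. (\<lambda>(z, \<xi>). f z \<xi>) (?m n y))"
    proof (rule continuous_on_compose2[OF cont])
      show "continuous_on (S n) (\<lambda>y. (?m n y))"
        by (intro continuous_intros continuous_on_compose2[OF contc]) auto
      show "(\<lambda>y. (?m n y)) ` S n \<subseteq> Omega \<times> UNIV"
        using clip by (auto simp: S_def Omega_def algebra_simps)
    qed
    then show ?thesis by (simp only: eq[symmetric])
  qed
  fix y :: "(real \<times> real) \<times> real"
  define n where "n = \<lfloor>fst (fst y) / (2 * pi)\<rfloor>"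
  have n: "of_int n * (2 * pi) \<le> fst (fst y)" "fst (fst y) < of_int (n + 1) * (2 * pi)"
    using floor_divide_lower[of "2 * pi" "fst (fst y)"] floor_divide_upper[of "2 * pi" "fst (fst y)"]
    by (auto simp: n_def)
  \<comment> \<open>As n is a floor, y may lie on the left edge of strip n but not on its right
    edge, so strip n - 1 is the one to add.\<close>
  have "continuous_on (S (n - 1) \<union> S n) H"
    by (intro continuous_on_closed_Un contS) (auto simp: S_def intro!: closed_Times)
  moreover have "y \<in> interior (S (n - 1) \<union> S n)"
  proof (rule interiorI)
    show "open (({of_int (n - 1) * (2 * pi)<..<of_int (n + 1) * (2 * pi)} \<times> (UNIV :: real set)) \<times> (UNIV :: real set))"
      by (intro open_Times) auto
    have "of_int (n - 1) * (2 * pi) < of_int n * (2 * pi)" by simp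
    from order_less_le_trans[OF this n(1)] show "y \<in> ({of_int (n - 1) * (2 * pi)<..<of_int (n + 1) * (2 * pi)} \<times> UNIV) \<times> UNIV"
      using n(2) by (cases y) (auto simp del: of_int_diff of_int_add)
    show "({of_int (n - 1) * (2 * pi)<..<of_int (n + 1) * (2 * pi)} \<times> UNIV) \<times> UNIV \<subseteq> S (n - 1) \<union> S n"
      by (auto simp: S_def)
  qed
  ultimately show "isCont (\<lambda>(z, \<xi>). f (fst z, clip (snd z)) \<xi>) y"
    unfolding H_def by (rule continuous_on_interior)
qed

text \<open>The cylinder has finite measure, so L^2 embeds into L^1 through |y| <= 1 + y^2.\<close>

lemma L2_integrable_representative:
  assumes u: "u \<in> L2_Omega" and u': "u' \<in> borel_measurable borel2" "AE z in cyl. u z = u' z"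
  shows "integrable cyl u'"
proof -
  note [measurable] = u'(1)
  have iu: "integrable (lebesgue_on Omega) (\<lambda>z. (u z)\<^sup>2)" using u by (simp add: L2_Omega_def)
  have m: "(\<lambda>z. (u' z)\<^sup>2) \<in> borel_measurable borel"
    unfolding measurable_borel_prod by measurable
  have ae: "AE z in lebesgue_on Omega. (u z)\<^sup>2 = (u' z)\<^sup>2"
    unfolding AE_lebesgue_on_Omega using u'(2) by (rule eventually_mono) simp
  have "integrable (lebesgue_on Omega) (\<lambda>z. (u' z)\<^sup>2)"
    by (rule integrable_cong_AE_imp[OF iu lebesgue_on_Omega_borel(1)[OF m] ae])
  then have sq: "integrable cyl (\<lambda>z. (u' z)\<^sup>2)"
    using lebesgue_on_Omega_borel(2)[OF m] by simp
  show ?thesis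
  proof (rule Bochner_Integration.integrable_bound)
    show "integrable cyl (\<lambda>z. 1 + (u' z)\<^sup>2)" using sq by simp
    have "\<bar>y\<bar> \<le> 1 + y\<^sup>2" for y :: real
      using sum_squares_ge_zero[of "\<bar>y\<bar> - 1/2" 0] by (simp add: power2_eq_square algebra_simps)
    then show "AE z in cyl. norm (u' z) \<le> norm (1 + (u' z)\<^sup>2)"
      by (auto intro: order_trans[OF _ abs_ge_self])
  qed measurable
qed

text \<open>All data matter only up to null sets, so the problem is transported to periodic Borel
  representatives and to nonlinearities extended to the plane.\<close>

lemma weak_solution_continuous:
  fixes f g :: "real \<times> real \<Rightarrow> real \<Rightarrow> real"
  assumes sol: "weak_solution b \<epsilon> f g u v" and b: "\<bar>\<epsilon>\<bar> < b"
    and f: "continuous_on (Omega \<times> UNIV) (\<lambda>(z, \<xi>). f z \<xi>)"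
      "\<And>t x \<xi>. x \<in> {0..pi} \<Longrightarrow> f (t + 2 * pi, x) \<xi> = f (t, x) \<xi>" "\<And>z. z \<in> Omega \<Longrightarrow> mono (f z)"
    and g: "continuous_on (Omega \<times> UNIV) (\<lambda>(z, \<xi>). g z \<xi>)"
      "\<And>t x \<xi>. x \<in> {0..pi} \<Longrightarrow> g (t + 2 * pi, x) \<xi> = g (t, x) \<xi>" "\<And>z. z \<in> Omega \<Longrightarrow> mono (g z)"
  shows "continuous_ae_on_Omega u \<and> continuous_ae_on_Omega v"
proof -
  have uv: "u \<in> L2_Omega" "v \<in> L2_Omega"
    using sol by (auto simp: weak_solution_def E_space_def H_space_def)
  then have muv: "u \<in> borel_measurable (lebesgue_on Omega)" "v \<in> borel_measurable (lebesgue_on Omega)"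
    by (auto simp: L2_Omega_def)
  obtain u' where u': "u' \<in> borel_measurable borel2" "\<And>x. periodic (\<lambda>t. u' (t, x))" "AE z in cyl. u z = u' z"
    by (rule periodic_representative[OF muv(1)]) blast
  obtain v' where v': "v' \<in> borel_measurable borel2" "\<And>x. periodic (\<lambda>t. v' (t, x))" "AE z in cyl. v z = v' z"
    by (rule periodic_representative[OF muv(2)]) blast
  have int: "integrable cyl u'" "integrable cyl v'"
    using L2_integrable_representative[OF uv(1) u'(1,3)] L2_integrable_representative[OF uv(2) v'(1,3)] .
  define ext where "ext = (\<lambda>(f :: real \<times> real \<Rightarrow> real \<Rightarrow> real) z. f (fst z, clip (snd z)))"
  have clip: "clip x \<in> {0..pi}" for x by (auto simp: clip_def)
  have ext: "continuous_on UNIV (\<lambda>(z, \<xi>). ext k z \<xi>)" "\<And>x \<xi>. periodic (\<lambda>t. ext k (t, x) \<xi>)" "\<And>z. mono (ext k z)"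
    "integrable cyl (\<lambda>z. ext k z (w' z))" "AE z in cyl. k z (w z) = ext k z (w' z)"
    if k: "continuous_on (Omega \<times> UNIV) (\<lambda>(z, \<xi>). k z \<xi>)"
      "\<And>t x \<xi>. x \<in> {0..pi} \<Longrightarrow> k (t + 2 * pi, x) \<xi> = k (t, x) \<xi>" "\<And>z. z \<in> Omega \<Longrightarrow> mono (k z)"
      and w: "w' \<in> borel_measurable borel2" "AE z in cyl. w z = w' z" "integrable (lebesgue_on Omega) (\<lambda>z. k z (w z))"
    for k w w'
  proof -
    show c: "continuous_on UNIV (\<lambda>(z, \<xi>). ext k z \<xi>)"
      unfolding ext_def by (rule periodic_extension_continuous[OF k(1,2)])
    show per: "periodic (\<lambda>t. ext k (t, x) \<xi>)" for x \<xi>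
      using k(2)[OF clip] by (simp add: ext_def periodic_def)
    show "mono (ext k z)" for z
    proof -
      \<comment> \<open>Reduction of t modulo 2 pi identifies \<open>ext k z\<close> with k at a
        point of \<open>Omega\<close>, from which monotonicity is inherited.\<close>
      define t where "t = fst z - of_int \<lfloor>fst z / (2 * pi)\<rfloor> * (2 * pi)"
      have "ext k z = k (t, clip (snd z))"
      proof
        fix \<xi>
        show "ext k z \<xi> = k (t, clip (snd z)) \<xi>"
          using periodic_add_int[OF per[of "snd z" \<xi>], of t "\<lfloor>fst z / (2 * pi)\<rfloor>"] by (simp add: t_def ext_def)
      qed
      moreover have "(t, clip (snd z)) \<in> Omega"
        using floor_divide_lower[of "2 * pi" "fst z"] floor_divide_upper[of "2 * pi" "fst z"] clip[of "snd z"]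
        by (auto simp: t_def Omega_def algebra_simps)
      ultimately show ?thesis using k(3) by simp
    qed
    show ae: "AE z in cyl. k z (w z) = ext k z (w' z)"
      using w(2) AE_cyl_interior by eventually_elim (simp add: ext_def clip_def)
    have m: "(\<lambda>z. ext k z (w' z)) \<in> borel_measurable borel"
      using superposition_measurable[OF c w(1)] unfolding measurable_borel_prod .
    have "integrable (lebesgue_on Omega) (\<lambda>z. ext k z (w' z))"
      by (rule integrable_cong_AE_imp[OF w(3) lebesgue_on_Omega_borel(1)[OF m]])
        (use ae in \<open>simp add: AE_lebesgue_on_Omega\<close>)
    then show "integrable cyl (\<lambda>z. ext k z (w' z))"
      using lebesgue_on_Omega_borel(2)[OF m] by simp
  qed
  have fu: "integrable (lebesgue_on Omega) (\<lambda>z. f z (u z))" and gv: "integrable (lebesgue_on Omega) (\<lambda>z. g z (v z))"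
    and weaku: "\<And>\<phi>. \<phi> \<in> test_functions b \<Longrightarrow>
      (\<integral>z. u z * wave_op \<phi> z + b * u z * \<phi> z + \<epsilon> * v z * \<phi> z + f z (u z) * \<phi> z \<partial>lebesgue_on Omega) = 0"
    and weakv: "\<And>\<phi>. \<phi> \<in> test_functions b \<Longrightarrow>
      (\<integral>z. v z * wave_op \<phi> z + b * v z * \<phi> z + \<epsilon> * u z * \<phi> z + g z (v z) * \<phi> z \<partial>lebesgue_on Omega) = 0"
    using sol by (auto simp: weak_solution_def)
  note F = ext[OF f u'(1,3) fu]
  note G = ext[OF g v'(1,3) gv]
  have relu: "of_int (j\<^sup>2 - k\<^sup>2) * cf u' j k + cf (\<lambda>z. b * u' z + \<epsilon> * v' z + ext f z (u' z)) j k = 0" if "j \<ge> 1" for j k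
    by (rule weak_equation_coefficients[OF weaku muv borel_measurable_integrable[OF fu] int(1) u'(3) int(2) v'(3) F(4,5) that])
  have relv: "of_int (j\<^sup>2 - k\<^sup>2) * cf v' j k + cf (\<lambda>z. b * v' z + \<epsilon> * u' z + ext g z (v' z)) j k = 0" if "j \<ge> 1" for j k
    by (rule weak_equation_coefficients[OF weakv muv(2,1) borel_measurable_integrable[OF gv] int(2) v'(3) int(1) u'(3) G(4,5) that])
  note reg = periodic_system_regularity[OF b F(1-3) G(1-3) int(1) u'(2) int(2) v'(2) F(4) G(4) relu relv]
  have "continuous_ae_on_Omega w" if ae: "AE z in cyl. w z = w' z"
    and ex: "\<exists>c. continuous_on UNIV c \<and> (AE z in cyl. w' z = c z)" for w w'
  proof -
    obtain c where c: "continuous_on UNIV c" "AE z in cyl. w' z = c z" using ex by blast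
    have "AE z in cyl. w z = c z" using ae c(2) by eventually_elim simp
    then show ?thesis
      unfolding continuous_ae_on_Omega_def AE_lebesgue_on_Omega
      using continuous_on_subset[OF c(1)] by blast
  qed
  from this[OF u'(3) reg(1)] this[OF v'(3) reg(2)] show ?thesis ..
qed

theorem theorem1p5:
  fixes b p q :: real
    and f g :: "real \<times> real \<Rightarrow> real \<Rightarrow> real"
  assumes b_pos: "b > 0"
    and b_spec: "- b \<notin> spectrum_L"
    and f_cont: "continuous_on (Omega \<times> UNIV) (\<lambda>(z, \<xi>). f z \<xi>)"
    and g_cont: "continuous_on (Omega \<times> UNIV) (\<lambda>(z, \<xi>). g z \<xi>)"
    and f_per: "\<And>t x \<xi>. x \<in> {0..pi} \<Longrightarrow> f (t + 2 * pi, x) \<xi> = f (t, x) \<xi>"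
    and g_per: "\<And>t x \<xi>. x \<in> {0..pi} \<Longrightarrow> g (t + 2 * pi, x) \<xi> = g (t, x) \<xi>"
    and p_gt: "p > 1" and q_gt: "q > 1"
    and h1: "\<exists>c0>0. \<forall>z\<in>Omega. \<forall>\<xi>. \<bar>f z \<xi>\<bar> \<le> c0 * (1 + \<bar>\<xi>\<bar> powr p)
                                  \<and> \<bar>g z \<xi>\<bar> \<le> c0 * (1 + \<bar>\<xi>\<bar> powr q)"
    and h2_f: "uniform_limit Omega (\<lambda>\<xi> z. f z \<xi> / \<bar>\<xi>\<bar>) (\<lambda>_. 0) (at 0)"
    and h2_g: "uniform_limit Omega (\<lambda>\<xi> z. g z \<xi> / \<bar>\<xi>\<bar>) (\<lambda>_. 0) (at 0)"
    and h3_f: "\<And>z \<xi>. z \<in> Omega \<Longrightarrow> (p + 1) * primitive f z \<xi> \<le> f z \<xi> * \<xi>"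
    and h3_g: "\<And>z \<xi>. z \<in> Omega \<Longrightarrow> (q + 1) * primitive g z \<xi> \<le> g z \<xi> * \<xi>"
    and h4_f: "\<And>z. z \<in> Omega \<Longrightarrow> mono (f z)"
    and h4_g: "\<And>z. z \<in> Omega \<Longrightarrow> mono (g z)"
    and f_C1: "C1_on (Omega \<times> UNIV) (\<lambda>(z, \<xi>). f z \<xi>)"
    and g_C1: "C1_on (Omega \<times> UNIV) (\<lambda>(z, \<xi>). g z \<xi>)"
    and f_strict: "\<And>z. z \<in> Omega \<Longrightarrow> strict_mono (f z)"
    and g_strict: "\<And>z. z \<in> Omega \<Longrightarrow> strict_mono (g z)"
  shows "\<exists>\<epsilon>0>0. \<forall>\<epsilon>. \<bar>\<epsilon>\<bar> < \<epsilon>0 \<longrightarrow>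
           (\<forall>u v. nontrivial_weak_solution b \<epsilon> f g u v \<longrightarrow>
              continuous_ae_on_Omega u \<and> continuous_ae_on_Omega v)"
proof (intro exI[of _ b] conjI b_pos allI impI)
  fix \<epsilon> u v assume eps: "\<bar>\<epsilon>\<bar> < b" and sol: "nontrivial_weak_solution b \<epsilon> f g u v"
  then have "weak_solution b \<epsilon> f g u v"
    by (simp add: nontrivial_weak_solution_def)
  then show "continuous_ae_on_Omega u" "continuous_ae_on_Omega v"
    using weak_solution_continuous[OF _ eps f_cont f_per h4_f g_cont g_per h4_g] by blast+
qed

end
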